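(* Let $P^{(\mathrm{B})}$ and $P^{(\mathrm{MH})}$ be the transition kernels of the Barker and of the Metropolis–Hastings algorithm, respectively, with the same target distribution $\pi$ and the same irreducible proposal kernel $Q$, and for $\varepsilon\in(0,1)$ let $P^{(\mathrm{MH})}_\varepsilon:=\varepsilon\,\mathrm{Id}+(1-\varepsilon)P^{(\mathrm{MH})}$; assume $P^{(\mathrm{MH})}$ is ergodic. Let $f\in L^2(\pi)$ and suppose that the CLT holds for $f$ and $P^{(\mathrm{MH})}$, with $\sigma^2_{f,P^{(\mathrm{MH})}}=\mathrm{Var}(f,P^{(\mathrm{MH})})<\infty$. Then the CLT also holds for (i) $f$ and $P^{(\mathrm{MH})}_\varepsilon$, with $$\sigma^2_{f,P^{(\mathrm{MH})}_\varepsilon}=\frac{1}{1-\varepsilon}\,\sigma^2_{f,P^{(\mathrm{MH})}}+\frac{\varepsilon}{1-\varepsilon}\,\sigma^2_f;$$ (ii) $f$ and $P^{(\mathrm{B})}$, with $$\sigma^2_{f,P^{(\mathrm{MH})}}\;\le\;\sigma^2_{f,P^{(\mathrm{B})}}\;\le\;\sigma^2_{f,P^{(\mathrm{MH})}_{1/2}}\;=\;2\,\sigma^2_{f,P^{(\mathrm{MH})}}+\sigma^2_f.$$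
   Context: $\pi$ is a probability distribution on $(\mathcal{X},\mathcal{B}(\mathcal{X}))$ and $Q$ is an irreducible transition kernel; $\pi$ and all $Q(x,\cdot)$ have densities $\pi(\cdot)$ and $q(x,\cdot)$ with respect to a common dominating measure. Given an acceptance rule $\alpha(x,y)\in[0,1]$, the corresponding kernel is that of the chain which, given $X_n=x$, draws $y\sim Q(x,\cdot)$ and sets $X_{n+1}=y$ with probability $\alpha(x,y)$ and $X_{n+1}=x$ otherwise. $P^{(\mathrm{MH})}$ uses $$\alpha^{(\mathrm{MH})}(x,y)=\min\Big\{1,\frac{\pi(y)q(y,x)}{\pi(x)q(x,y)}\Big\},$$ and $P^{(\mathrm{B})}$ uses $$\alpha^{(\mathrm{B})}(x,y)=\frac{\pi(y)q(y,x)}{\pi(y)q(y,x)+\pi(x)q(x,y)}.$$ Both kernels are reversible with respect to $\pi$. Ergodic means that $\pi$ is the limiting distribution in the usual MCMC sense: $\|P^n(x,\cdot)-\pi\|_{TV}\to0$ for $\pi$-almost every $x$. For a chain $(X_n)_{n\ge0}$ with kernel $R$ having stationary distribution $\pi$, put $\hat I_n:=\frac1n\sum_{i=0}^{n-1}f(X_i)$ and $\pi f:=\int f\,d\pi$. "The CLT holds for $f$ and $R$" means that (for the chain started from $X_0\sim\pi$) $\sqrt n(\hat I_n-\pi f)$ converges in distribution to $\mathcal N(0,\sigma^2_{f,R})$ with $\sigma^2_{f,R}<\infty$, the asymptotic variance. $\mathrm{Var}(f,R):=\lim_{n\to\infty}n\,\mathrm{Var}_\pi(\hat I_n)$, where $\mathrm{Var}_\pi$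 is the variance when $X_0\sim\pi$. $\sigma^2_f:=\pi f^2-(\pi f)^2$ is the stationary variance of $f$. *)

theory Defs
  imports "HOL-Probability.Probability"
begin

text \<open>
  Throughout, the dominating measure \<open>\<nu>\<close> also carries the measurable structure of the state space:
  a Markov kernel on the state space is an element of \<open>\<nu> \<rightarrow>\<^sub>M prob_algebra \<nu>\<close>.
\<close>

primrec kernel_pow :: "'a measure \<Rightarrow> ('a \<Rightarrow> 'a measure) \<Rightarrow> nat \<Rightarrow> 'a \<Rightarrow> 'a measure" where
  "kernel_pow \<nu> R 0 = return \<nu>"
| "kernel_pow \<nu> R (Suc n) = (\<lambda>x. R x \<bind> kernel_pow \<nu> R n)"

text \<open>Irreducibility on a general state space: \<open>\<phi>\<close>-irreducibility for some nontrivial \<open>\<phi>\<close>.\<close>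

definition irreducible_kernel :: "'a measure \<Rightarrow> ('a \<Rightarrow> 'a measure) \<Rightarrow> bool" where
  "irreducible_kernel \<nu> R \<longleftrightarrow>
    (\<exists>\<phi>. sets \<phi> = sets \<nu> \<and> sigma_finite_measure \<phi> \<and> emeasure \<phi> (space \<nu>) \<noteq> 0 \<and>
      (\<forall>A\<in>sets \<nu>. emeasure \<phi> A > 0 \<longrightarrow>
        (\<forall>x\<in>space \<nu>. \<exists>n\<ge>1. emeasure (kernel_pow \<nu> R n x) A > 0)))"

definition tv_dist :: "'a measure \<Rightarrow> 'a measure \<Rightarrow> 'a measure \<Rightarrow> real" where
  "tv_dist \<nu> \<mu>1 \<mu>2 = (SUP A\<in>sets \<nu>. \<bar>measure \<mu>1 A - measure \<mu>2 A\<bar>)"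

definition ergodic_kernel :: "'a measure \<Rightarrow> 'a measure \<Rightarrow> ('a \<Rightarrow> 'a measure) \<Rightarrow> bool" where
  "ergodic_kernel \<nu> \<pi> R \<longleftrightarrow>
    (AE x in \<pi>. (\<lambda>n. tv_dist \<nu> (kernel_pow \<nu> R n x) \<pi>) \<longlonglongrightarrow> 0)"

text \<open>\<open>\<epsilon> Id + (1 - \<epsilon>) R\<close>, see \<open>emeasure_lazy_kernel\<close> below.\<close>

definition lazy_kernel :: "'a measure \<Rightarrow> real \<Rightarrow> ('a \<Rightarrow> 'a measure) \<Rightarrow> 'a \<Rightarrow> 'a measure" where
  "lazy_kernel \<nu> \<epsilon> R x =
    measure_pmf (bernoulli_pmf \<epsilon>) \<bind> (\<lambda>b. if b then return \<nu> x else R x)"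

definition accept_kernel ::
    "'a measure \<Rightarrow> ('a \<Rightarrow> 'a \<Rightarrow> real) \<Rightarrow> ('a \<Rightarrow> 'a measure) \<Rightarrow> 'a \<Rightarrow> 'a measure" where
  "accept_kernel \<nu> \<alpha> Q x =
    Q x \<bind> (\<lambda>y. measure_pmf (bernoulli_pmf (\<alpha> x y)) \<bind> (\<lambda>b. return \<nu> (if b then y else x)))"

text \<open>
  Where the denominators below vanish, a proposal is accepted. For \<open>\<pi>\<close>-almost every \<open>x\<close> this
  happens only for \<open>y\<close> in a \<open>Q(x,\<cdot>)\<close>-null set.
\<close>

definition mh_accept :: "('a \<Rightarrow> real) \<Rightarrow> ('a \<Rightarrow> 'a \<Rightarrow> real) \<Rightarrow> 'a \<Rightarrow> 'a \<Rightarrow> real" where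
  "mh_accept p q x y =
    (if p x * q x y = 0 then 1 else min 1 ((p y * q y x) / (p x * q x y)))"

definition barker_accept :: "('a \<Rightarrow> real) \<Rightarrow> ('a \<Rightarrow> 'a \<Rightarrow> real) \<Rightarrow> 'a \<Rightarrow> 'a \<Rightarrow> real" where
  "barker_accept p q x y =
    (if p y * q y x + p x * q x y = 0 then 1 else (p y * q y x) / (p y * q y x + p x * q x y))"

definition mh_kernel ::
    "'a measure \<Rightarrow> ('a \<Rightarrow> real) \<Rightarrow> ('a \<Rightarrow> 'a \<Rightarrow> real) \<Rightarrow> ('a \<Rightarrow> 'a measure) \<Rightarrow> 'a \<Rightarrow> 'a measure" where
  "mh_kernel \<nu> p q Q = accept_kernel \<nu> (mh_accept p q) Q"

definition barker_kernel ::
    "'a measure \<Rightarrow> ('a \<Rightarrow> real) \<Rightarrow> ('a \<Rightarrow> 'a \<Rightarrow> real) \<Rightarrow> ('a \<Rightarrow> 'a measure) \<Rightarrow> 'a \<Rightarrow> 'a measure" where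
  "barker_kernel \<nu> p q Q = accept_kernel \<nu> (barker_accept p q) Q"

definition chain_step ::
    "'a measure \<Rightarrow> ('a \<Rightarrow> 'a measure) \<Rightarrow> nat \<Rightarrow> (nat \<Rightarrow> 'a) \<Rightarrow> 'a measure" where
  "chain_step \<mu> R n \<omega> = (if n = 0 then \<mu> else R (\<omega> (n - 1)))"

text \<open>
  The law on path space \<open>PiM UNIV (\<lambda>_. \<nu>)\<close> of the Markov chain with initial distribution \<open>\<mu>\<close> and
  kernel \<open>R\<close>; the chain itself is \<open>X n \<omega> = \<omega> n\<close>. This is \<open>PF.lim\<close> of the locale
  \<open>Ionescu_Tulcea\<close>, whose assumptions hold by \<open>Ionescu_Tulcea_chain\<close> below.
\<close>

definition chain_law :: "'a measure \<Rightarrow> 'a measure \<Rightarrow> ('a \<Rightarrow> 'a measure) \<Rightarrow> (nat \<Rightarrow> 'a) measure" where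
  "chain_law \<nu> \<mu> R =
    projective_family.lim UNIV (Ionescu_Tulcea.CI (chain_step \<mu> R) (\<lambda>_. \<nu>)) (\<lambda>_. \<nu>)"

definition path_avg :: "('a \<Rightarrow> real) \<Rightarrow> nat \<Rightarrow> (nat \<Rightarrow> 'a) \<Rightarrow> real" where
  "path_avg f n \<omega> = (\<Sum>i<n. f (\<omega> i)) / real n"

definition var_path_avg ::
    "'a measure \<Rightarrow> 'a measure \<Rightarrow> ('a \<Rightarrow> 'a measure) \<Rightarrow> ('a \<Rightarrow> real) \<Rightarrow> nat \<Rightarrow> real" where
  "var_path_avg \<nu> \<pi> R f n =
    (\<integral>\<omega>. (path_avg f n \<omega> - (\<integral>\<omega>'. path_avg f n \<omega>' \<partial>chain_law \<nu> \<pi> R))\<^sup>2 \<partial>chain_law \<nu> \<pi> R)"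

text \<open>\<open>has_Var \<nu> \<pi> R f v\<close>: the limit defining \<open>Var(f,R)\<close> exists, is finite and equals \<open>v\<close>.\<close>

definition has_Var ::
    "'a measure \<Rightarrow> 'a measure \<Rightarrow> ('a \<Rightarrow> 'a measure) \<Rightarrow> ('a \<Rightarrow> real) \<Rightarrow> real \<Rightarrow> bool" where
  "has_Var \<nu> \<pi> R f v \<longleftrightarrow> (\<lambda>n. real n * var_path_avg \<nu> \<pi> R f n) \<longlonglongrightarrow> v"

text \<open>\<open>N(0,v)\<close> as the law of \<open>sqrt v * Z\<close>, which covers the degenerate case \<open>v = 0\<close>.\<close>

definition centered_normal :: "real \<Rightarrow> real measure" where
  "centered_normal v = distr std_normal_distribution borel (\<lambda>z. sqrt v * z)"

definition CLT_with ::
    "'a measure \<Rightarrow> 'a measure \<Rightarrow> ('a \<Rightarrow> 'a measure) \<Rightarrow> ('a \<Rightarrow> real) \<Rightarrow> real \<Rightarrow> bool" where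
  "CLT_with \<nu> \<pi> R f v \<longleftrightarrow> 0 \<le> v \<and>
    weak_conv_m
      (\<lambda>n. distr (chain_law \<nu> \<pi> R) borel (\<lambda>\<omega>. sqrt (real n) * (path_avg f n \<omega> - (\<integral>x. f x \<partial>\<pi>))))
      (centered_normal v)"

definition CLT_holds ::
    "'a measure \<Rightarrow> 'a measure \<Rightarrow> ('a \<Rightarrow> 'a measure) \<Rightarrow> ('a \<Rightarrow> real) \<Rightarrow> bool" where
  "CLT_holds \<nu> \<pi> R f \<longleftrightarrow> (\<exists>v. CLT_with \<nu> \<pi> R f v)"

text \<open>Well defined whenever the CLT holds, see \<open>asymp_var_eqI\<close> below.\<close>

definition asymp_var ::
    "'a measure \<Rightarrow> 'a measure \<Rightarrow> ('a \<Rightarrow> 'a measure) \<Rightarrow> ('a \<Rightarrow> real) \<Rightarrow> real" where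
  "asymp_var \<nu> \<pi> R f = (THE v. CLT_with \<nu> \<pi> R f v)"

definition stationary_var :: "'a measure \<Rightarrow> ('a \<Rightarrow> real) \<Rightarrow> real" where
  "stationary_var \<pi> f = (\<integral>x. (f x)\<^sup>2 \<partial>\<pi>) - (\<integral>x. f x \<partial>\<pi>)\<^sup>2"

lemma emeasure_bind_bernoulli:
  assumes "0 \<le> e" "e \<le> 1" "N1 \<in> space (subprob_algebra \<nu>)" "N2 \<in> space (subprob_algebra \<nu>)"
    and A: "A \<in> sets \<nu>"
  shows "emeasure (measure_pmf (bernoulli_pmf e) \<bind> (\<lambda>b. if b then N1 else N2)) A =
    ennreal e * emeasure N1 A + ennreal (1 - e) * emeasure N2 A"
proof -
  have "(\<lambda>b. if b then N1 else N2) \<in> measure_pmf (bernoulli_pmf e) \<rightarrow>\<^sub>M subprob_algebra \<nu>"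
    using assms by auto
  then show ?thesis
    using assms by (subst emeasure_bind[OF _ _ A]) (auto simp: mult.commute)
qed

lemma emeasure_lazy_kernel:
  assumes "0 \<le> \<epsilon>" "\<epsilon> \<le> 1" and R: "R \<in> \<nu> \<rightarrow>\<^sub>M prob_algebra \<nu>" and x: "x \<in> space \<nu>"
    and A: "A \<in> sets \<nu>"
  shows "emeasure (lazy_kernel \<nu> \<epsilon> R x) A =
    ennreal \<epsilon> * indicator A x + ennreal (1 - \<epsilon>) * emeasure (R x) A"
proof -
  have 1: "R x \<in> space (subprob_algebra \<nu>)" "return \<nu> x \<in> space (subprob_algebra \<nu>)"
    using measurable_space[OF measurable_prob_algebraD[OF R] x]
      measurable_space[OF return_measurable x] by auto
  show ?thesis
    unfolding lazy_kernel_def using assms 1 by (subst emeasure_bind_bernoulli) auto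
qed

lemma emeasure_accept_kernel:
  assumes Q: "Q \<in> \<nu> \<rightarrow>\<^sub>M prob_algebra \<nu>" and x: "x \<in> space \<nu>" and A: "A \<in> sets \<nu>"
    and \<alpha>: "(\<lambda>y. \<alpha> x y) \<in> borel_measurable \<nu>"
    and \<alpha>01: "\<And>y. y \<in> space \<nu> \<Longrightarrow> 0 \<le> \<alpha> x y \<and> \<alpha> x y \<le> 1"
  shows "emeasure (accept_kernel \<nu> \<alpha> Q x) A =
    (\<integral>\<^sup>+y. ennreal (\<alpha> x y) * indicator A y \<partial>Q x) +
    (\<integral>\<^sup>+y. ennreal (1 - \<alpha> x y) \<partial>Q x) * indicator A x"
proof -
  let ?K = "\<lambda>y. measure_pmf (bernoulli_pmf (\<alpha> x y)) \<bind> (\<lambda>b. return \<nu> (if b then y else x))"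
  have Qx: "Q x \<in> space (prob_algebra \<nu>)" using measurable_space[OF Q x] .
  then have sQ[measurable_cong]: "sets (Q x) = sets \<nu>" and spQ: "space (Q x) = space \<nu>"
    and neQ: "space (Q x) \<noteq> {}"
    using prob_space.not_empty[of "Q x"]
    by (auto simp: space_prob_algebra dest: sets_eq_imp_space_eq)
  have eq: "?K y = measure_pmf (bernoulli_pmf (\<alpha> x y)) \<bind>
      (\<lambda>b. if b then return \<nu> y else return \<nu> x)" for y
    by (simp add: if_distrib)
  have ret: "return \<nu> y \<in> space (subprob_algebra \<nu>)" if "y \<in> space \<nu>" for y
    using measurable_space[OF return_measurable that] .
  have em: "emeasure (?K y) B = ennreal (\<alpha> x y) * indicator B y + ennreal (1 - \<alpha> x y) * indicator B x"
    if "y \<in> space \<nu>" "B \<in> sets \<nu>" for y B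
    unfolding eq using that \<alpha>01[OF that(1)] ret x by (subst emeasure_bind_bernoulli) auto
  have K: "?K \<in> \<nu> \<rightarrow>\<^sub>M subprob_algebra \<nu>"
  proof (rule measurable_subprob_algebra)
    fix y assume y: "y \<in> space \<nu>"
    have "(\<lambda>b. return \<nu> (if b then y else x)) \<in>
        measure_pmf (bernoulli_pmf (\<alpha> x y)) \<rightarrow>\<^sub>M subprob_algebra \<nu>"
      using ret[OF y] ret[OF x] by auto
    then show "subprob_space (?K y)" "sets (?K y) = sets \<nu>"
      by (auto intro!: subprob_space_bind sets_bind simp: subprob_space_measure_pmf)
  next
    fix B assume [measurable]: "B \<in> sets \<nu>"
    note \<alpha>[measurable]
    have "(\<lambda>y. ennreal (\<alpha> x y) * indicator B y + ennreal (1 - \<alpha> x y) * indicator B x)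
        \<in> borel_measurable \<nu>"
      by measurable
    then show "(\<lambda>y. emeasure (?K y) B) \<in> borel_measurable \<nu>"
      by (subst measurable_cong[OF em]) auto
  qed
  note \<alpha>[measurable] A[measurable]
  have "emeasure (accept_kernel \<nu> \<alpha> Q x) A = (\<integral>\<^sup>+y. emeasure (?K y) A \<partial>Q x)"
    unfolding accept_kernel_def using K neQ A
    by (subst emeasure_bind[where N=\<nu>]) (auto simp: measurable_cong_sets[OF sQ refl])
  also have "\<dots> = (\<integral>\<^sup>+y. ennreal (\<alpha> x y) * indicator A y + ennreal (1 - \<alpha> x y) * indicator A x \<partial>Q x)"
    by (rule nn_integral_cong) (simp add: em A spQ)
  also have "\<dots> = (\<integral>\<^sup>+y. ennreal (\<alpha> x y) * indicator A y \<partial>Q x) +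
      (\<integral>\<^sup>+y. ennreal (1 - \<alpha> x y) * indicator A x \<partial>Q x)"
    by (rule nn_integral_add) measurable
  also have "(\<integral>\<^sup>+y. ennreal (1 - \<alpha> x y) * indicator A x \<partial>Q x) =
      (\<integral>\<^sup>+y. ennreal (1 - \<alpha> x y) \<partial>Q x) * indicator A x"
    by (rule nn_integral_multc) measurable
  finally show ?thesis .
qed

lemma Ionescu_Tulcea_chain:
  assumes "\<mu> \<in> space (prob_algebra \<nu>)" and R: "R \<in> \<nu> \<rightarrow>\<^sub>M prob_algebra \<nu>"
  shows "Ionescu_Tulcea (chain_step \<mu> R) (\<lambda>_. \<nu>)"
proof (rule Ionescu_Tulcea.intro)
  fix i :: nat
  have step: "chain_step \<mu> R i \<in> PiM {0..<i} (\<lambda>_. \<nu>) \<rightarrow>\<^sub>M prob_algebra \<nu>"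
  proof (cases i)
    case 0
    then show ?thesis using assms by (simp add: chain_step_def[abs_def])
  next
    case (Suc n)
    have "(\<lambda>\<omega>. R (\<omega> n)) \<in> PiM {0..<i} (\<lambda>_. \<nu>) \<rightarrow>\<^sub>M prob_algebra \<nu>"
      by (rule measurable_compose[OF _ R], rule measurable_component_singleton) (simp add: Suc)
    then show ?thesis by (simp add: chain_step_def[abs_def] Suc)
  qed
  then show "chain_step \<mu> R i \<in> PiM {0..<i} (\<lambda>_. \<nu>) \<rightarrow>\<^sub>M subprob_algebra \<nu>"
    by (rule measurable_prob_algebraD)
  fix \<omega> assume "\<omega> \<in> space (PiM {0..<i} (\<lambda>_. \<nu>))"
  from measurable_space[OF step this] show "prob_space (chain_step \<mu> R i \<omega>)"
    by (simp add: space_prob_algebra)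
qed

lemma sets_chain_law:
  assumes "\<mu> \<in> space (prob_algebra \<nu>)" "R \<in> \<nu> \<rightarrow>\<^sub>M prob_algebra \<nu>"
  shows "sets (chain_law \<nu> \<mu> R) = sets (PiM UNIV (\<lambda>_. \<nu>))"
proof -
  interpret Ionescu_Tulcea "chain_step \<mu> R" "\<lambda>_. \<nu>"
    using assms by (rule Ionescu_Tulcea_chain)
  show ?thesis unfolding chain_law_def by (rule PF.sets_lim)
qed

lemma prob_space_chain_law:
  assumes "\<mu> \<in> space (prob_algebra \<nu>)" "R \<in> \<nu> \<rightarrow>\<^sub>M prob_algebra \<nu>"
  shows "prob_space (chain_law \<nu> \<mu> R)"
proof -
  interpret Ionescu_Tulcea "chain_step \<mu> R" "\<lambda>_. \<nu>"
    using assms by (rule Ionescu_Tulcea_chain)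
  have "prob_space (distr PF.lim (PiM {} (\<lambda>_. \<nu>)) (\<lambda>x. restrict x {}))"
    by (subst distr_lim) (auto intro: PF.prob_space_P)
  moreover have "(\<lambda>x. restrict x {}) \<in> PF.lim \<rightarrow>\<^sub>M PiM {} (\<lambda>_. \<nu>)"
    by (subst measurable_cong_sets[OF PF.sets_lim refl]) (rule measurable_restrict_subset, simp)
  ultimately show ?thesis
    unfolding chain_law_def by (rule prob_space_distrD[rotated])
qed

lemma real_distribution_centered_normal: "real_distribution (centered_normal v)"
proof -
  interpret real_distribution std_normal_distribution
    by (rule real_dist_normal_dist)
  show ?thesis
    unfolding centered_normal_def by (rule real_distribution_distr) simp
qed

lemma char_centered_normal:
  assumes "0 \<le> v" shows "char (centered_normal v) t = complex_of_real (exp (- (v * t\<^sup>2) / 2))"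
proof -
  interpret real_distribution std_normal_distribution
    by (rule real_dist_normal_dist)
  have "char (centered_normal v) t = char std_normal_distribution (sqrt v * t)"
    unfolding centered_normal_def char_def
    by (subst integral_distr) (auto simp: ac_simps)
  then show ?thesis using assms
    by (simp add: char_std_normal_distribution power_mult_distrib)
qed

lemma asymp_var_eqI:
  assumes \<mu>: "\<pi> \<in> space (prob_algebra \<nu>)" and R: "R \<in> \<nu> \<rightarrow>\<^sub>M prob_algebra \<nu>"
    and f[measurable]: "f \<in> borel_measurable \<nu>" and v: "CLT_with \<nu> \<pi> R f v"
  shows "asymp_var \<nu> \<pi> R f = v"
  unfolding asymp_var_def
proof (rule the_equality[of "\<lambda>v. CLT_with \<nu> \<pi> R f v", OF v])
  fix w assume w: "CLT_with \<nu> \<pi> R f w"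
  let ?D = "\<lambda>n. distr (chain_law \<nu> \<pi> R) borel
    (\<lambda>\<omega>. sqrt (real n) * (path_avg f n \<omega> - (\<integral>x. f x \<partial>\<pi>)))"
  interpret L: prob_space "chain_law \<nu> \<pi> R" by (rule prob_space_chain_law[OF \<mu> R])
  note sets_chain_law[OF \<mu> R, measurable_cong]
  have D: "real_distribution (?D n)" for n
    by (rule L.real_distribution_distr) (unfold path_avg_def, measurable)
  have lim: "(\<lambda>n. char (?D n) 1) \<longlonglongrightarrow> char (centered_normal u) 1" if "CLT_with \<nu> \<pi> R f u" for u
    using that by (intro levy_continuity1 D real_distribution_centered_normal) (simp add: CLT_with_def)
  have "char (centered_normal w) 1 = char (centered_normal v) 1"
    using LIMSEQ_unique[OF lim[OF w] lim[OF v]] .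
  then show "w = v"
    using v w by (simp add: char_centered_normal CLT_with_def del: of_real_exp)
qed

end

theory Submission
  imports Defs
begin

text \<open>
  All three algorithms have kernels that are reversible with respect to \<open>\<pi>\<close>, and off the diagonal each
  kernel has a symmetric density with respect to \<open>\<pi> \<otimes> \<pi>\<close>. Since
  \<open>b / (a + b) \<le> min 1 (b / a) \<le> 2 * b / (a + b)\<close>, the Barker density lies between one half of the
  Metropolis-Hastings density and the whole of it. The Dirichlet forms \<open>E(h) = \<langle>h, (1 - R) h\<rangle>\<close> therefore
  satisfy \<open>E\<^sub>B \<le> E\<^sub>M\<^sub>H \<le> 2 * E\<^sub>B\<close>, and the lazy kernel has \<open>E\<^sub>\<epsilon> = (1 - \<epsilon>) * E\<^sub>M\<^sub>H\<close>.

  The asymptotic variance is a decreasing function of the Dirichlet form. Let \<open>g = f - \<pi> f\<close> and let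
  \<open>u\<^sub>\<lambda>\<close> solve \<open>(1 + \<lambda> - R) u = g\<close> for \<open>\<lambda> > 0\<close>. The theorem of Kipnis and Varadhan says that, for an ergodic
  reversible chain with \<open>\<langle>g, u\<^sub>\<lambda>\<rangle>\<close> bounded, the CLT holds with variance \<open>2 * \<Phi> - \<parallel>g\<parallel>\<^sup>2\<close>, where
  \<open>\<Phi> = lim \<langle>g, u\<^sub>\<lambda>\<rangle>\<close> as \<open>\<lambda>\<close> decreases to \<open>0\<close>. The variational formula
  \<open>\<langle>g, u\<^sub>\<lambda>\<rangle> = sup\<^sub>h (2 * \<langle>g, h\<rangle> - \<lambda> * \<parallel>h\<parallel>\<^sup>2 - E(h))\<close> turns the comparison of Dirichlet forms into
  \<open>\<Phi>\<^sub>M\<^sub>H \<le> \<Phi>\<^sub>B \<le> \<Phi>\<^sub>\<epsilon>\<close> for \<open>\<epsilon> = 1/2\<close>, and into \<open>\<Phi>\<^sub>\<epsilon> = \<Phi>\<^sub>M\<^sub>H / (1 - \<epsilon>)\<close>. Both claims of the theorem follow.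

  The classical proof of Kipnis and Varadhan uses the spectral theorem. It is replaced here by
  the resolvent identity alone, which gives every estimate in terms of \<open>\<Phi> - \<langle>g, u\<^sub>\<lambda>\<rangle>\<close>
  (\<open>resolvent_form_scaled\<close>). The path sum of \<open>g\<close> is a martingale built from \<open>u\<^sub>\<lambda>\<close>, a boundary term, and the
  path sum of \<open>\<lambda> u\<^sub>\<lambda>\<close>; the last one has variance at most of order \<open>n * (\<Phi> - \<langle>g, u\<^sub>\<lambda>\<rangle>)\<close>
  (\<open>norm2_path_sum_diff_mart\<close>). For the martingale the characteristic function is computed by a
  recursion in \<open>n\<close> (\<open>mart_CLT\<close>). Its conditional variances are averaged by writing them as a constant
  plus a coboundary \<open>h - R h\<close> plus a small remainder; this is the only form in which ergodicity enters.

  Three facts connect this with the hypotheses. Convergence in total variation makes every indicator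
  function approximable by constants plus coboundaries (\<open>indicator_ergodic_if_ergodic_kernel\<close>).
  This property passes to every kernel whose Dirichlet form dominates a positive multiple of the given one
  (\<open>indicator_ergodic_transfer\<close>), hence to the Barker and lazy kernels. Convergence of
  \<open>n * Var\<close> of the path averages bounds \<open>\<langle>g, u\<^sub>\<lambda>\<rangle>\<close> by an Abel summation argument
  (\<open>resolvent_form_bounded_if_has_Var\<close>).
\<close>

section \<open>Square-integrable functions\<close>

text \<open>
  Square integrability is a predicate on functions and \<open>norm2\<close> only a seminorm: passing to classes
  modulo null sets would hide the pointwise values that enter path sums.
\<close>

definition L2 :: "'b measure \<Rightarrow> ('b \<Rightarrow> real) \<Rightarrow> bool" where
  "L2 M h \<longleftrightarrow> h \<in> borel_measurable M \<and> integrable M (\<lambda>x. (h x)\<^sup>2)"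

definition norm2 :: "'b measure \<Rightarrow> ('b \<Rightarrow> real) \<Rightarrow> real" where
  "norm2 M h = sqrt (\<integral>x. (h x)\<^sup>2 \<partial>M)"

lemma L2_measurable [measurable_dest]: "L2 M h \<Longrightarrow> h \<in> borel_measurable M"
  by (simp add: L2_def)

lemma L2_square_integrable: "L2 M h \<Longrightarrow> integrable M (\<lambda>x. (h x)\<^sup>2)"
  by (simp add: L2_def)

lemma L2_mult_integrable:
  assumes "L2 M h" "L2 M k"
  shows "integrable M (\<lambda>x. h x * k x)"
proof (rule Bochner_Integration.integrable_bound)
  show "integrable M (\<lambda>x. (h x)\<^sup>2 + (k x)\<^sup>2)"
    using assms by (simp add: L2_def)
  show "(\<lambda>x. h x * k x) \<in> borel_measurable M"
    using assms by measurable
  have "\<bar>a * b\<bar> \<le> a\<^sup>2 + b\<^sup>2" for a b :: real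
  proof -
    have "2 * (\<bar>a\<bar> * \<bar>b\<bar>) \<le> a\<^sup>2 + b\<^sup>2"
      using zero_le_power2[of "\<bar>a\<bar> - \<bar>b\<bar>"] by (simp add: power2_diff)
    moreover have "0 \<le> \<bar>a\<bar> * \<bar>b\<bar>" by simp
    ultimately show ?thesis unfolding abs_mult by linarith
  qed
  then show "AE x in M. norm (h x * k x) \<le> norm ((h x)\<^sup>2 + (k x)\<^sup>2)"
    by simp
qed

lemma L2_cmult: "L2 M h \<Longrightarrow> L2 M (\<lambda>x. c * h x)"
  unfolding L2_def by (auto simp: power_mult_distrib)

lemma L2_add:
  assumes "L2 M h" "L2 M k" shows "L2 M (\<lambda>x. h x + k x)"
proof -
  have "integrable M (\<lambda>x. (h x)\<^sup>2 + (k x)\<^sup>2 + 2 * (h x * k x))"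
    using assms L2_mult_integrable[OF assms] by (simp add: L2_def)
  moreover have "(\<lambda>x. h x + k x) \<in> borel_measurable M"
    using assms by measurable
  ultimately show ?thesis
    by (simp add: L2_def power2_sum mult.assoc)
qed

lemma L2_diff: "L2 M h \<Longrightarrow> L2 M k \<Longrightarrow> L2 M (\<lambda>x. h x - k x)"
  using L2_add[of M h "\<lambda>x. -1 * k x"] L2_cmult[of M k "-1"] by simp

lemma L2_zero: "L2 M (\<lambda>_. 0)"
  by (simp add: L2_def)

lemma L2_sum: "(\<And>i. i \<in> A \<Longrightarrow> L2 M (h i)) \<Longrightarrow> L2 M (\<lambda>x. \<Sum>i\<in>A. h i x)"
  by (induction A rule: infinite_finite_induct) (auto intro: L2_add L2_zero)

lemma L2_abs: "L2 M h \<Longrightarrow> L2 M (\<lambda>x. \<bar>h x\<bar>)"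
  by (auto simp: L2_def)

lemma (in prob_space) L2_const: "L2 M (\<lambda>_. c)"
  by (simp add: L2_def)

lemma (in prob_space) L2_bounded:
  assumes [measurable]: "h \<in> borel_measurable M" and bd: "\<And>x. x \<in> space M \<Longrightarrow> \<bar>h x\<bar> \<le> c"
  shows "L2 M h"
  unfolding L2_def
proof (intro conjI assms(1) integrable_const_bound[of _ "c\<^sup>2"] AE_I2)
  fix x assume "x \<in> space M"
  then have "\<bar>h x\<bar> \<le> \<bar>c\<bar>" using bd[of x] by linarith
  then show "norm ((h x)\<^sup>2) \<le> c\<^sup>2" by (simp add: abs_le_square_iff)
qed measurable

lemma (in prob_space) L2_integrable: "L2 M h \<Longrightarrow> integrable M h"
  using L2_mult_integrable[of M h "\<lambda>_. 1"] by (simp add: L2_const)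

lemma norm2_cong_AE:
  assumes "h \<in> borel_measurable M" "k \<in> borel_measurable M" "AE x in M. h x = k x"
  shows "norm2 M h = norm2 M k"
  unfolding norm2_def using assms
  by (intro arg_cong[where f=sqrt] integral_cong_AE) (measurable, auto)

lemma norm2_nonneg [simp]: "0 \<le> norm2 M h"
  by (simp add: norm2_def)

lemma norm2_power2: "(norm2 M h)\<^sup>2 = (\<integral>x. (h x)\<^sup>2 \<partial>M)"
  by (simp add: norm2_def)

lemma norm2_cmult: "norm2 M (\<lambda>x. c * h x) = \<bar>c\<bar> * norm2 M h"
  by (simp add: norm2_def power_mult_distrib real_sqrt_mult)

lemma norm2_abs: "norm2 M (\<lambda>x. \<bar>h x\<bar>) = norm2 M h"
  by (simp add: norm2_def)

lemma integral_mult_cmult: "(\<integral>x. f x * (c * h x) \<partial>M) = c * (\<integral>x. f x * h x \<partial>M)" for f h :: "'b \<Rightarrow> real"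
  by (subst integral_mult_right_zero[symmetric]) (simp add: ac_simps)

lemma L2_Cauchy_Schwarz:
  assumes h: "L2 M h" and k: "L2 M k"
  shows "\<bar>\<integral>x. h x * k x \<partial>M\<bar> \<le> norm2 M h * norm2 M k"
proof -
  define a b c where "a = (\<integral>x. (h x)\<^sup>2 \<partial>M)" and "b = (\<integral>x. h x * k x \<partial>M)" and "c = (\<integral>x. (k x)\<^sup>2 \<partial>M)"
  have quad: "0 \<le> s\<^sup>2 * a + 2 * s * t * b + t\<^sup>2 * c" for s t
  proof -
    have "0 \<le> (\<integral>x. (s * h x + t * k x)\<^sup>2 \<partial>M)" by simp
    also have "\<dots> = (\<integral>x. s\<^sup>2 * (h x)\<^sup>2 + 2 * s * t * (h x * k x) + t\<^sup>2 * (k x)\<^sup>2 \<partial>M)"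
      by (rule Bochner_Integration.integral_cong) (auto simp: power2_eq_square algebra_simps)
    also have "\<dots> = s\<^sup>2 * a + 2 * s * t * b + t\<^sup>2 * c"
      using L2_square_integrable[OF h] L2_square_integrable[OF k] L2_mult_integrable[OF h k]
      by (simp add: a_def b_def c_def)
    finally show ?thesis .
  qed
  have a: "0 \<le> a" and c: "0 \<le> c" by (auto simp: a_def c_def)
  \<comment> \<open>Discriminant of the quadratic form; if \<open>c\<close> vanishes, it is affine in \<open>t\<close> for \<open>s = 1\<close>.\<close>
  have "b\<^sup>2 \<le> a * c"
  proof (cases "c = 0")
    case True
    have "b = 0"
    proof (rule ccontr)
      assume "b \<noteq> 0"
      have "2 * 1 * (- (a + 1) / (2 * b)) * b = - (a + 1)"
        using \<open>b \<noteq> 0\<close> by (simp add: field_simps)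
      then show False
        using quad[of 1 "- (a + 1) / (2 * b)"] True by simp
    qed
    then show ?thesis using a c by simp
  next
    case False
    have "c\<^sup>2 * a + 2 * c * (- b) * b + (- b)\<^sup>2 * c = c * (a * c - b\<^sup>2)"
      by (simp add: power2_eq_square algebra_simps)
    then have "0 \<le> c * (a * c - b\<^sup>2)" using quad[of c "- b"] by simp
    then show ?thesis using False c by (simp add: zero_le_mult_iff)
  qed
  then have "sqrt (b\<^sup>2) \<le> sqrt (a * c)" by (rule real_sqrt_le_mono)
  then show ?thesis by (simp add: a_def b_def c_def norm2_def real_sqrt_mult)
qed

lemma integral_abs_mult_le_norm2:
  assumes h: "L2 M h" and k: "L2 M k"
  shows "(\<integral>x. \<bar>h x * k x\<bar> \<partial>M) \<le> norm2 M h * norm2 M k"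
  using L2_Cauchy_Schwarz[OF L2_abs[OF h] L2_abs[OF k]]
  by (simp add: abs_mult norm2_abs)

lemma (in prob_space) integral_abs_le_norm2:
  assumes h: "L2 M h"
  shows "(\<integral>x. \<bar>h x\<bar> \<partial>M) \<le> norm2 M h"
  using integral_abs_mult_le_norm2[OF h L2_const[of 1]] by (simp add: norm2_def prob_space)

lemma norm2_triangle:
  assumes h: "L2 M h" and k: "L2 M k"
  shows "norm2 M (\<lambda>x. h x + k x) \<le> norm2 M h + norm2 M k"
proof (rule power2_le_imp_le)
  have "(norm2 M (\<lambda>x. h x + k x))\<^sup>2 = (\<integral>x. (h x)\<^sup>2 + (k x)\<^sup>2 + 2 * (h x * k x) \<partial>M)"
    unfolding norm2_power2
    by (rule Bochner_Integration.integral_cong) (auto simp: power2_eq_square algebra_simps)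
  also have "\<dots> = (norm2 M h)\<^sup>2 + (norm2 M k)\<^sup>2 + 2 * (\<integral>x. h x * k x \<partial>M)"
    using L2_square_integrable[OF h] L2_square_integrable[OF k] L2_mult_integrable[OF h k]
    by (simp add: norm2_power2)
  also have "\<dots> \<le> (norm2 M h)\<^sup>2 + (norm2 M k)\<^sup>2 + 2 * (norm2 M h * norm2 M k)"
    using L2_Cauchy_Schwarz[OF h k] by simp
  also have "\<dots> = (norm2 M h + norm2 M k)\<^sup>2" by (simp add: power2_sum)
  finally show "(norm2 M (\<lambda>x. h x + k x))\<^sup>2 \<le> (norm2 M h + norm2 M k)\<^sup>2" .
qed simp

lemma norm2_triangle_diff:
  assumes h: "L2 M h" and k: "L2 M k"
  shows "norm2 M (\<lambda>x. h x - k x) \<le> norm2 M h + norm2 M k"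
  using norm2_triangle[OF h L2_cmult[OF k, of "-1"]] norm2_cmult[of M "-1" k] by simp

lemma norm2_sum:
  assumes "finite A" "\<And>i. i \<in> A \<Longrightarrow> L2 M (h i)"
  shows "norm2 M (\<lambda>x. \<Sum>i\<in>A. h i x) \<le> (\<Sum>i\<in>A. norm2 M (h i))"
  using assms
proof (induction A rule: finite_induct)
  case empty then show ?case by (simp add: norm2_def)
next
  case (insert a A)
  have "norm2 M (\<lambda>x. h a x + (\<Sum>i\<in>A. h i x)) \<le> norm2 M (h a) + norm2 M (\<lambda>x. \<Sum>i\<in>A. h i x)"
    using insert by (intro norm2_triangle L2_sum) auto
  with insert show ?case by auto
qed

lemma integral_square_add:
  assumes h: "L2 M h" and k: "L2 M k"
  shows "(\<integral>x. (h x + k x)\<^sup>2 \<partial>M) = (\<integral>x. (h x)\<^sup>2 \<partial>M) + 2 * (\<integral>x. h x * k x \<partial>M) + (\<integral>x. (k x)\<^sup>2 \<partial>M)"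
proof -
  have "(\<integral>x. (h x + k x)\<^sup>2 \<partial>M) = (\<integral>x. (h x)\<^sup>2 + 2 * (h x * k x) + (k x)\<^sup>2 \<partial>M)"
    by (rule Bochner_Integration.integral_cong) (auto simp: power2_eq_square algebra_simps)
  then show ?thesis
    using L2_square_integrable[OF h] L2_square_integrable[OF k] L2_mult_integrable[OF h k]
    by simp
qed

lemma integral_square_diff:
  assumes h: "L2 M h" and k: "L2 M k"
  shows "(\<integral>x. (h x - k x)\<^sup>2 \<partial>M) = (\<integral>x. (h x)\<^sup>2 \<partial>M) - 2 * (\<integral>x. h x * k x \<partial>M) + (\<integral>x. (k x)\<^sup>2 \<partial>M)"
  using integral_square_add[OF h L2_cmult[OF k, of "-1"]] by simp

lemma L2_distr_iff:
  assumes [measurable]: "T \<in> M \<rightarrow>\<^sub>M N" "h \<in> borel_measurable N"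
  shows "L2 (distr M N T) h \<longleftrightarrow> L2 M (\<lambda>x. h (T x))"
  unfolding L2_def by (subst integrable_distr_eq) auto

lemma norm2_distr:
  assumes [measurable]: "T \<in> M \<rightarrow>\<^sub>M N" "h \<in> borel_measurable N"
  shows "norm2 (distr M N T) h = norm2 M (\<lambda>x. h (T x))"
  unfolding norm2_def by (subst integral_distr) auto

section \<open>Integrals against a mixture of measures\<close>

text \<open>
  Fubini's theorem for the mixture \<open>M \<bind> K\<close> and an integrand that need not be bounded. The
  nonnegative case is the corresponding rule for \<open>nn_integral\<close>, applied to both parts of \<open>g\<close>.
\<close>

lemma integrable_bind_real:
  fixes g :: "'b \<Rightarrow> real"
  assumes K [measurable]: "K \<in> M \<rightarrow>\<^sub>M subprob_algebra B" and g: "integrable (M \<bind> K) g" and ne: "space M \<noteq> {}"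
  shows "AE x in M. integrable (K x) g"
    and "integrable M (\<lambda>x. \<integral>y. g y \<partial>K x)"
    and "(\<integral>y. g y \<partial>(M \<bind> K)) = (\<integral>x. \<integral>y. g y \<partial>K x \<partial>M)"
proof -
  have sets: "sets (M \<bind> K) = sets B"
    using sets_kernel[OF K] ne by (rule sets_bind)
  have gB [measurable]: "g \<in> borel_measurable B"
    using borel_measurable_integrable[OF g] sets by (simp cong: measurable_cong_sets)
  have KB: "h \<in> borel_measurable (K x)" if "x \<in> space M" "h \<in> borel_measurable B" for x and h :: "'b \<Rightarrow> real"
    using that sets_kernel[OF K that(1)] by (simp cong: measurable_cong_sets)
  have main: "(AE x in M. integrable (K x) h) \<and> integrable M (\<lambda>x. \<integral>y. h y \<partial>K x) \<and>
      (\<integral>y. h y \<partial>(M \<bind> K)) = (\<integral>x. \<integral>y. h y \<partial>K x \<partial>M)"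
    if h: "integrable (M \<bind> K) h" and [measurable]: "h \<in> borel_measurable B" and nn: "\<And>y. 0 \<le> h y"
    for h :: "'b \<Rightarrow> real"
  proof -
    have eq: "(\<integral>\<^sup>+x. \<integral>\<^sup>+y. ennreal (h y) \<partial>K x \<partial>M) = ennreal (\<integral>y. h y \<partial>(M \<bind> K))"
      using nn by (subst nn_integral_bind[symmetric, where B=B]) (auto simp: nn_integral_eq_integral[OF h])
    have "AE x in M. (\<integral>\<^sup>+y. ennreal (h y) \<partial>K x) \<noteq> \<infinity>"
      by (rule nn_integral_PInf_AE) (auto simp: eq)
    then have A: "AE x in M. integrable (K x) h"
      using AE_space
    proof eventually_elim
      case (elim x)
      have "h \<in> borel_measurable (K x)" using elim(2) by (rule KB) measurable
      then show ?case
        using elim(1) nn by (auto simp: integrable_iff_bounded top.not_eq_extremum)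
    qed
    have B: "AE x in M. (\<integral>\<^sup>+y. ennreal (h y) \<partial>K x) = ennreal (\<integral>y. h y \<partial>K x)"
      using A by eventually_elim (simp add: nn_integral_eq_integral nn)
    have C: "(\<integral>\<^sup>+x. ennreal (\<integral>y. h y \<partial>K x) \<partial>M) = ennreal (\<integral>y. h y \<partial>(M \<bind> K))"
      unfolding eq[symmetric] by (rule nn_integral_cong_AE) (use B in \<open>auto elim: eventually_mono\<close>)
    have m: "(\<lambda>x. \<integral>y. h y \<partial>K x) \<in> borel_measurable M" by measurable
    have D: "integrable M (\<lambda>x. \<integral>y. h y \<partial>K x)"
      using C nn m by (intro integrableI_nonneg) auto
    have "ennreal (\<integral>x. \<integral>y. h y \<partial>K x \<partial>M) = ennreal (\<integral>y. h y \<partial>(M \<bind> K))"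
      using nn_integral_eq_integral[OF D] C nn by simp
    then show ?thesis using A D nn by simp
  qed
  define p n where "p = (\<lambda>y. max 0 (g y))" and "n = (\<lambda>y. max 0 (- g y))"
  have [measurable]: "p \<in> borel_measurable B" "n \<in> borel_measurable B" unfolding p_def n_def by measurable
  have gpn: "g = (\<lambda>y. p y - n y)" by (auto simp: p_def n_def max_def)
  have ip: "integrable (M \<bind> K) p" "integrable (M \<bind> K) n"
    using g by (auto simp: p_def n_def)
  have P: "AE x in M. integrable (K x) p" "integrable M (\<lambda>x. \<integral>y. p y \<partial>K x)"
      "(\<integral>y. p y \<partial>(M \<bind> K)) = (\<integral>x. \<integral>y. p y \<partial>K x \<partial>M)"
    using main[OF ip(1)] by (auto simp: p_def)
  have N: "AE x in M. integrable (K x) n" "integrable M (\<lambda>x. \<integral>y. n y \<partial>K x)"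
      "(\<integral>y. n y \<partial>(M \<bind> K)) = (\<integral>x. \<integral>y. n y \<partial>K x \<partial>M)"
    using main[OF ip(2)] by (auto simp: n_def)
  show "AE x in M. integrable (K x) g"
    using P(1) N(1) unfolding gpn by eventually_elim simp
  have E: "AE x in M. (\<integral>y. p y \<partial>K x) - (\<integral>y. n y \<partial>K x) = (\<integral>y. g y \<partial>K x)"
    using P(1) N(1) by eventually_elim (simp add: gpn)
  have m: "(\<lambda>x. \<integral>y. g y \<partial>K x) \<in> borel_measurable M" by measurable
  have I: "integrable M (\<lambda>x. (\<integral>y. p y \<partial>K x) - (\<integral>y. n y \<partial>K x))" using P(2) N(2) by simp
  show "integrable M (\<lambda>x. \<integral>y. g y \<partial>K x)"
    by (rule integrable_cong_AE_imp[OF I m]) (use E in auto)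
  have "(\<integral>y. g y \<partial>(M \<bind> K)) = (\<integral>y. p y \<partial>(M \<bind> K)) - (\<integral>y. n y \<partial>(M \<bind> K))"
    using ip by (simp add: gpn)
  also have "\<dots> = (\<integral>x. (\<integral>y. p y \<partial>K x) - (\<integral>y. n y \<partial>K x) \<partial>M)"
    using P N by simp
  also have "\<dots> = (\<integral>x. \<integral>y. g y \<partial>K x \<partial>M)"
    by (rule integral_cong_AE) (use E m I in auto)
  finally show "(\<integral>y. g y \<partial>(M \<bind> K)) = (\<integral>x. \<integral>y. g y \<partial>K x \<partial>M)" .
qed

section \<open>Reversible kernels as self-adjoint operators\<close>

locale reversible_kernel =
  fixes \<nu> \<pi> :: "'a measure" and R :: "'a \<Rightarrow> 'a measure"
  assumes pi_prob_algebra: "\<pi> \<in> space (prob_algebra \<nu>)"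
    and R_kernel: "R \<in> \<nu> \<rightarrow>\<^sub>M prob_algebra \<nu>"
    and detailed_balance: "\<And>A B. A \<in> sets \<nu> \<Longrightarrow> B \<in> sets \<nu> \<Longrightarrow>
      (\<integral>\<^sup>+x. indicator A x * emeasure (R x) B \<partial>\<pi>) = (\<integral>\<^sup>+x. indicator B x * emeasure (R x) A \<partial>\<pi>)"
begin

lemma sets_pi [measurable_cong, simp]: "sets \<pi> = sets \<nu>"
  using pi_prob_algebra by (simp add: space_prob_algebra)

lemma space_pi [simp]: "space \<pi> = space \<nu>"
  using sets_eq_imp_space_eq[OF sets_pi] .

sublocale prob_space \<pi>
  using pi_prob_algebra by (simp add: space_prob_algebra)

lemma R_measurable [measurable]: "R \<in> \<nu> \<rightarrow>\<^sub>M subprob_algebra \<nu>"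
  by (rule measurable_prob_algebraD[OF R_kernel])

lemma R_measurable_pi [measurable]: "R \<in> \<pi> \<rightarrow>\<^sub>M subprob_algebra \<nu>"
  by measurable

lemma prob_space_R: "x \<in> space \<nu> \<Longrightarrow> prob_space (R x)"
  using measurable_space[OF R_kernel] by (simp add: space_prob_algebra)

lemma sets_R: "x \<in> space \<nu> \<Longrightarrow> sets (R x) = sets \<nu>"
  using measurable_space[OF R_kernel] by (simp add: space_prob_algebra)

lemma emeasure_R_space: "x \<in> space \<nu> \<Longrightarrow> emeasure (R x) (space \<nu>) = 1"
  using prob_space.emeasure_space_1[OF prob_space_R] sets_eq_imp_space_eq[OF sets_R] by simp

lemma measurable_R: "x \<in> space \<nu> \<Longrightarrow> h \<in> borel_measurable \<nu> \<Longrightarrow> h \<in> borel_measurable (R x)"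
  using sets_R by (simp cong: measurable_cong_sets)

lemma measurable_pi_iff: "h \<in> borel_measurable \<pi> \<longleftrightarrow> h \<in> borel_measurable \<nu>"
  by (simp cong: measurable_cong_sets)

lemma L2_measurable_nu [measurable_dest]: "L2 \<pi> h \<Longrightarrow> h \<in> borel_measurable \<nu>"
  by (simp add: L2_def measurable_pi_iff)

lemma integrable_measurable_nu: "integrable \<pi> h \<Longrightarrow> h \<in> borel_measurable \<nu>"
  using borel_measurable_integrable measurable_pi_iff by blast

text \<open>
  \<open>joint\<close> is the law of two consecutive states of the stationary chain. Detailed balance says that
  it is invariant under exchanging them, which is what makes \<open>op\<close> below self-adjoint.
\<close>

definition joint_kernel :: "'a \<Rightarrow> ('a \<times> 'a) measure" where
  "joint_kernel x = distr (R x) (\<nu> \<Otimes>\<^sub>M \<nu>) (Pair x)"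

definition joint :: "('a \<times> 'a) measure" where
  "joint = \<pi> \<bind> joint_kernel"

lemma joint_kernel_measurable [measurable]: "joint_kernel \<in> \<nu> \<rightarrow>\<^sub>M subprob_algebra (\<nu> \<Otimes>\<^sub>M \<nu>)"
  unfolding joint_kernel_def by (rule measurable_distr2[OF _ R_measurable]) measurable

lemma joint_kernel_measurable_pi [measurable]: "joint_kernel \<in> \<pi> \<rightarrow>\<^sub>M subprob_algebra (\<nu> \<Otimes>\<^sub>M \<nu>)"
  by measurable

lemma sets_joint [measurable_cong, simp]: "sets joint = sets (\<nu> \<Otimes>\<^sub>M \<nu>)"
  unfolding joint_def using not_empty
  by (intro sets_bind) (auto simp: joint_kernel_def)

lemma space_joint: "space joint = space \<nu> \<times> space \<nu>"
  using sets_eq_imp_space_eq[OF sets_joint] by (simp add: space_pair_measure)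

lemma Pair_measurable_R: "x \<in> space \<nu> \<Longrightarrow> Pair x \<in> R x \<rightarrow>\<^sub>M \<nu> \<Otimes>\<^sub>M \<nu>"
  using sets_R[of x] measurable_Pair1'[of x \<nu> \<nu>] by (simp cong: measurable_cong_sets)

lemma nn_integral_joint:
  assumes [measurable]: "F \<in> borel_measurable (\<nu> \<Otimes>\<^sub>M \<nu>)"
  shows "(\<integral>\<^sup>+z. F z \<partial>joint) = (\<integral>\<^sup>+x. \<integral>\<^sup>+y. F (x, y) \<partial>R x \<partial>\<pi>)"
proof -
  have "(\<integral>\<^sup>+z. F z \<partial>joint) = (\<integral>\<^sup>+x. \<integral>\<^sup>+z. F z \<partial>joint_kernel x \<partial>\<pi>)"
    unfolding joint_def by (rule nn_integral_bind[where B="\<nu> \<Otimes>\<^sub>M \<nu>"]) measurable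
  also have "\<dots> = (\<integral>\<^sup>+x. \<integral>\<^sup>+y. F (x, y) \<partial>R x \<partial>\<pi>)"
    by (rule nn_integral_cong)
       (simp add: joint_kernel_def nn_integral_distr[OF Pair_measurable_R])
  finally show ?thesis .
qed

lemma emeasure_joint:
  assumes [measurable]: "A \<in> sets \<nu>" "B \<in> sets \<nu>"
  shows "emeasure joint (A \<times> B) = (\<integral>\<^sup>+x. indicator A x * emeasure (R x) B \<partial>\<pi>)"
proof -
  have "emeasure joint (A \<times> B) = (\<integral>\<^sup>+z. indicator (A \<times> B) z \<partial>joint)" by simp
  also have "\<dots> = (\<integral>\<^sup>+x. \<integral>\<^sup>+y. indicator (A \<times> B) (x, y) \<partial>R x \<partial>\<pi>)"
    by (rule nn_integral_joint) measurable
  also have "\<dots> = (\<integral>\<^sup>+x. indicator A x * emeasure (R x) B \<partial>\<pi>)"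
    by (rule nn_integral_cong) (simp add: indicator_times nn_integral_cmult sets_R measurable_R)
  finally show ?thesis .
qed

sublocale joint: prob_space joint
proof
  have "emeasure joint (space joint) = (\<integral>\<^sup>+x. indicator (space \<nu>) x * emeasure (R x) (space \<nu>) \<partial>\<pi>)"
    unfolding space_joint by (rule emeasure_joint) auto
  also have "\<dots> = (\<integral>\<^sup>+x. 1 \<partial>\<pi>)"
    by (rule nn_integral_cong) (simp add: emeasure_R_space)
  finally show "emeasure joint (space joint) = 1"
    using emeasure_space_1 by simp
qed

lemma distr_joint_swap: "distr joint (\<nu> \<Otimes>\<^sub>M \<nu>) (\<lambda>(x, y). (y, x)) = joint"
proof (rule measure_eqI_generator_eq[OF Int_stable_pair_measure_generator[of \<nu> \<nu>]])
  let ?E = "{a \<times> b |a b. a \<in> sets \<nu> \<and> b \<in> sets \<nu>}"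
  show "?E \<subseteq> Pow (space \<nu> \<times> space \<nu>)"
    by (auto dest: sets.sets_into_space)
  show "sets (distr joint (\<nu> \<Otimes>\<^sub>M \<nu>) (\<lambda>(x, y). (y, x))) = sigma_sets (space \<nu> \<times> space \<nu>) ?E"
    and "sets joint = sigma_sets (space \<nu> \<times> space \<nu>) ?E"
    by (simp_all add: sets_pair_measure)
  show "range (\<lambda>i::nat. space \<nu> \<times> space \<nu>) \<subseteq> ?E" "(\<Union>i::nat. space \<nu> \<times> space \<nu>) = space \<nu> \<times> space \<nu>"
    by auto
  fix X assume "X \<in> ?E"
  then obtain A B where X: "X = A \<times> B" and [measurable]: "A \<in> sets \<nu>" "B \<in> sets \<nu>" by auto
  have "(\<lambda>(x, y). (y, x)) -` (A \<times> B) \<inter> space joint = B \<times> A"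
    using sets.sets_into_space[of A \<nu>] sets.sets_into_space[of B \<nu>] by (auto simp: space_joint)
  then show "emeasure (distr joint (\<nu> \<Otimes>\<^sub>M \<nu>) (\<lambda>(x, y). (y, x))) X = emeasure joint X"
    unfolding X by (subst emeasure_distr) (auto simp: emeasure_joint detailed_balance[of A B])
next
  interpret D: prob_space "distr joint (\<nu> \<Otimes>\<^sub>M \<nu>) (\<lambda>(x, y). (y, x))"
    by (rule joint.prob_space_distr) simp
  show "emeasure (distr joint (\<nu> \<Otimes>\<^sub>M \<nu>) (\<lambda>(x, y). (y, x))) (space \<nu> \<times> space \<nu>) \<noteq> \<infinity>"
    using D.emeasure_finite by simp
qed

lemma distr_joint_fst: "distr joint \<nu> fst = \<pi>"
proof (rule measure_eqI)
  fix A assume "A \<in> sets (distr joint \<nu> fst)"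
  then have A [measurable]: "A \<in> sets \<nu>" by simp
  have "fst -` A \<inter> space joint = A \<times> space \<nu>"
    using sets.sets_into_space[OF A] by (auto simp: space_joint)
  then have "emeasure (distr joint \<nu> fst) A = (\<integral>\<^sup>+x. indicator A x * emeasure (R x) (space \<nu>) \<partial>\<pi>)"
    by (subst emeasure_distr) (auto simp: emeasure_joint)
  also have "\<dots> = (\<integral>\<^sup>+x. indicator A x \<partial>\<pi>)"
    by (intro nn_integral_cong) (simp add: emeasure_R_space)
  finally show "emeasure (distr joint \<nu> fst) A = emeasure \<pi> A" by simp
qed simp

lemma distr_joint_snd: "distr joint \<nu> snd = \<pi>"
proof -
  have "distr joint \<nu> snd = distr (distr joint (\<nu> \<Otimes>\<^sub>M \<nu>) (\<lambda>(x, y). (y, x))) \<nu> fst"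
    by (subst distr_distr) (auto intro!: distr_cong)
  then show ?thesis by (simp add: distr_joint_swap distr_joint_fst)
qed

lemma bind_pi_R: "\<pi> \<bind> R = \<pi>"
proof (rule measure_eqI)
  show s: "sets (\<pi> \<bind> R) = sets \<pi>"
    using not_empty by (subst sets_bind[where N=\<nu>]) (auto simp: sets_R)
  fix A assume "A \<in> sets (\<pi> \<bind> R)"
  then have A [measurable]: "A \<in> sets \<nu>" by (simp add: s)
  have "emeasure (\<pi> \<bind> R) A = (\<integral>\<^sup>+x. emeasure (R x) A \<partial>\<pi>)"
    using not_empty by (intro emeasure_bind[where N=\<nu>]) auto
  also have "\<dots> = (\<integral>\<^sup>+x. indicator (space \<nu>) x * emeasure (R x) A \<partial>\<pi>)"
    by (rule nn_integral_cong) simp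
  also have "\<dots> = emeasure joint (space \<nu> \<times> A)" by (rule emeasure_joint[symmetric]) auto
  also have "\<dots> = emeasure (distr joint \<nu> snd) A"
  proof -
    have "snd -` A \<inter> space joint = space \<nu> \<times> A"
      using sets.sets_into_space[OF A] by (auto simp: space_joint)
    then show ?thesis by (subst emeasure_distr) auto
  qed
  finally show "emeasure (\<pi> \<bind> R) A = emeasure \<pi> A" by (simp add: distr_joint_snd)
qed

lemma L2_joint_fst: "L2 \<pi> h \<Longrightarrow> L2 joint (\<lambda>z. h (fst z))"
  using L2_distr_iff[of fst joint \<nu> h] by (simp add: distr_joint_fst)

lemma L2_joint_snd: "L2 \<pi> h \<Longrightarrow> L2 joint (\<lambda>z. h (snd z))"
  using L2_distr_iff[of snd joint \<nu> h] by (simp add: distr_joint_snd)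

definition op :: "('a \<Rightarrow> real) \<Rightarrow> 'a \<Rightarrow> real" where
  "op h x = (\<integral>y. h y \<partial>R x)"

lemma op_measurable [measurable]:
  "h \<in> borel_measurable \<nu> \<Longrightarrow> op h \<in> borel_measurable \<nu>"
  unfolding op_def
  by (rule measurable_compose[OF R_measurable integral_measurable_subprob_algebra])

text \<open>
  The stationary chain does not leave a set of full measure. Pointwise identities in what follows
  hold only almost everywhere, and this lets \<open>op\<close> be applied to them.
\<close>

lemma AE_R:
  assumes "AE x in \<pi>. P x"
  shows "AE x in \<pi>. AE y in R x. P y"
proof -
  obtain N where N: "N \<in> sets \<nu>" "emeasure \<pi> N = 0" "{x \<in> space \<nu>. \<not> P x} \<subseteq> N"
    using assms by (auto elim!: AE_E)
  have "N \<in> null_sets (\<pi> \<bind> R)" unfolding bind_pi_R using N by auto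
  then have "AE x in \<pi> \<bind> R. x \<notin> N" by (rule AE_not_in)
  then have "AE x in \<pi>. AE y in R x. y \<notin> N"
    using N(1) by (subst (asm) AE_bind[where B=\<nu>]) (auto simp: pred_def)
  then show ?thesis
    using AE_space
  proof eventually_elim
    case (elim x)
    then show ?case
      using AE_space[of "R x"] N(3) sets_eq_imp_space_eq[OF sets_R[of x]] by (auto elim!: eventually_elim2)
  qed
qed

lemma AE_R_integrable: "integrable \<pi> h \<Longrightarrow> AE x in \<pi>. integrable (R x) h"
  and op_integrable: "integrable \<pi> h \<Longrightarrow> integrable \<pi> (op h)"
  and integral_op: "integrable \<pi> h \<Longrightarrow> (\<integral>x. op h x \<partial>\<pi>) = (\<integral>x. h x \<partial>\<pi>)"
  using integrable_bind_real[of R \<pi> \<nu> h] not_empty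
  unfolding bind_pi_R op_def by simp_all

lemma op_add_AE: "integrable \<pi> h \<Longrightarrow> integrable \<pi> k \<Longrightarrow>
    AE x in \<pi>. op (\<lambda>x. h x + k x) x = op h x + op k x"
  using AE_R_integrable[of h] AE_R_integrable[of k] unfolding op_def
  by (auto elim: eventually_elim2)

lemma op_diff_AE: "integrable \<pi> h \<Longrightarrow> integrable \<pi> k \<Longrightarrow>
    AE x in \<pi>. op (\<lambda>x. h x - k x) x = op h x - op k x"
  using AE_R_integrable[of h] AE_R_integrable[of k] unfolding op_def
  by (auto elim: eventually_elim2)

lemma op_cmult: "op (\<lambda>x. c * h x) x = c * op h x"
  unfolding op_def by simp

lemma op_square_le:
  assumes h: "L2 \<pi> h"
  shows "AE x in \<pi>. (op h x)\<^sup>2 \<le> op (\<lambda>y. (h y)\<^sup>2) x"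
  using AE_R_integrable[OF L2_square_integrable[OF h]] AE_space
proof eventually_elim
  case (elim x)
  interpret Rx: prob_space "R x" using prob_space_R elim by simp
  have L: "L2 (R x) h" using elim h by (auto simp: L2_def measurable_R measurable_pi_iff)
  have "\<bar>op h x\<bar> \<le> norm2 (R x) h"
    using L2_Cauchy_Schwarz[OF L Rx.L2_const[of 1]]
    by (simp add: op_def norm2_def[of _ "\<lambda>_. 1"] Rx.prob_space)
  then have "\<bar>op h x\<bar>\<^sup>2 \<le> (norm2 (R x) h)\<^sup>2" by (rule power_mono) simp
  then show ?case by (simp add: norm2_power2 op_def)
qed

lemma op_L2: "L2 \<pi> h \<Longrightarrow> L2 \<pi> (op h)"
proof -
  assume h: "L2 \<pi> h"
  have [measurable]: "h \<in> borel_measurable \<nu>" using h by measurable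
  have "integrable \<pi> (\<lambda>x. (op h x)\<^sup>2)"
  proof (rule Bochner_Integration.integrable_bound[OF op_integrable[OF L2_square_integrable[OF h]]])
    show "AE x in \<pi>. norm ((op h x)\<^sup>2) \<le> norm (op (\<lambda>y. (h y)\<^sup>2) x)"
      using op_square_le[OF h] by eventually_elim auto
  qed measurable
  then show ?thesis by (simp add: L2_def)
qed

lemma norm2_op_le: "L2 \<pi> h \<Longrightarrow> norm2 \<pi> (op h) \<le> norm2 \<pi> h"
proof -
  assume h: "L2 \<pi> h"
  have "(\<integral>x. (op h x)\<^sup>2 \<partial>\<pi>) \<le> (\<integral>x. op (\<lambda>y. (h y)\<^sup>2) x \<partial>\<pi>)"
    using h op_square_le[OF h]
    by (intro integral_mono_AE op_integrable L2_square_integrable op_L2)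
  then show ?thesis
    using integral_op[OF L2_square_integrable[OF h]] by (simp add: norm2_def)
qed

text \<open>
  Both inner products \<open>\<langle>h, op k\<rangle>\<close> and \<open>\<langle>op h, k\<rangle>\<close> are correlations under \<open>joint\<close>; symmetry of \<open>joint\<close> then
  identifies them.
\<close>

lemma integral_joint_mult:
  assumes h: "L2 \<pi> h" and k: "L2 \<pi> k"
  shows "(\<integral>z. h (fst z) * k (snd z) \<partial>joint) = (\<integral>x. h x * op k x \<partial>\<pi>)"
proof -
  have [measurable]: "h \<in> borel_measurable \<nu>" "k \<in> borel_measurable \<nu>" using h k by measurable
  have "integrable joint (\<lambda>z. h (fst z) * k (snd z))"
    by (intro L2_mult_integrable L2_joint_fst L2_joint_snd h k)
  then have "(\<integral>z. h (fst z) * k (snd z) \<partial>joint) = (\<integral>x. \<integral>z. h (fst z) * k (snd z) \<partial>joint_kernel x \<partial>\<pi>)"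
    unfolding joint_def by (rule integrable_bind_real(3)[OF joint_kernel_measurable_pi]) (use not_empty in auto)
  also have "\<dots> = (\<integral>x. h x * op k x \<partial>\<pi>)"
    by (rule Bochner_Integration.integral_cong)
       (auto simp: joint_kernel_def op_def integral_distr[OF Pair_measurable_R])
  finally show ?thesis .
qed

lemma op_symmetric:
  assumes h: "L2 \<pi> h" and k: "L2 \<pi> k"
  shows "(\<integral>x. h x * op k x \<partial>\<pi>) = (\<integral>x. op h x * k x \<partial>\<pi>)"
proof -
  have [measurable]: "h \<in> borel_measurable \<nu>" "k \<in> borel_measurable \<nu>" using h k by measurable
  have "(\<integral>z. h (fst z) * k (snd z) \<partial>joint) =
      (\<integral>z. h (fst z) * k (snd z) \<partial>distr joint (\<nu> \<Otimes>\<^sub>M \<nu>) (\<lambda>(x, y). (y, x)))"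
    by (simp add: distr_joint_swap)
  also have "\<dots> = (\<integral>z. k (fst z) * h (snd z) \<partial>joint)"
    by (subst integral_distr) (auto simp: split_beta ac_simps)
  finally show ?thesis
    using integral_joint_mult[OF h k] integral_joint_mult[OF k h] by (simp add: ac_simps)
qed

abbreviation ip :: "('a \<Rightarrow> real) \<Rightarrow> ('a \<Rightarrow> real) \<Rightarrow> real" where
  "ip h k \<equiv> \<integral>x. h x * k x \<partial>\<pi>"

text \<open>
  The quadratic form of \<open>1 - R\<close>.
\<close>

definition dirichlet :: "('a \<Rightarrow> real) \<Rightarrow> real" where
  "dirichlet h = (\<integral>x. (h x)\<^sup>2 \<partial>\<pi>) - (\<integral>x. h x * op h x \<partial>\<pi>)"

lemma dirichlet_cmult: "dirichlet (\<lambda>x. c * h x) = c\<^sup>2 * dirichlet h"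
  unfolding dirichlet_def op_cmult
  by (simp add: power_mult_distrib power2_eq_square ac_simps right_diff_distrib flip: integral_mult_right_zero)

lemma dirichlet_eq_joint:
  assumes h: "L2 \<pi> h"
  shows "integrable joint (\<lambda>z. (h (fst z) - h (snd z))\<^sup>2)"
    and "dirichlet h = (\<integral>z. (h (fst z) - h (snd z))\<^sup>2 \<partial>joint) / 2"
proof -
  have [measurable]: "h \<in> borel_measurable \<nu>" using h by measurable
  note L = L2_joint_fst[OF h] L2_joint_snd[OF h]
  show "integrable joint (\<lambda>z. (h (fst z) - h (snd z))\<^sup>2)"
    by (rule L2_square_integrable[OF L2_diff[OF L]])
  have "(\<integral>z. (h (fst z))\<^sup>2 \<partial>joint) = (\<integral>x. (h x)\<^sup>2 \<partial>distr joint \<nu> fst)"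
    by (subst integral_distr) auto
  moreover have "(\<integral>z. (h (snd z))\<^sup>2 \<partial>joint) = (\<integral>x. (h x)\<^sup>2 \<partial>distr joint \<nu> snd)"
    by (subst integral_distr) auto
  ultimately show "dirichlet h = (\<integral>z. (h (fst z) - h (snd z))\<^sup>2 \<partial>joint) / 2"
    unfolding integral_square_diff[OF L] integral_joint_mult[OF h h]
    by (simp add: dirichlet_def distr_joint_fst distr_joint_snd)
qed

lemma dirichlet_nonneg: "L2 \<pi> h \<Longrightarrow> 0 \<le> dirichlet h"
  by (simp add: dirichlet_eq_joint(2))

text \<open>
  Expand the square and use that \<open>op\<close> is a contraction. So a function of small Dirichlet energy
  is almost invariant.
\<close>

lemma norm2_diff_op_le:
  assumes h: "L2 \<pi> h"
  shows "(norm2 \<pi> (\<lambda>x. h x - op h x))\<^sup>2 \<le> 2 * dirichlet h"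
proof -
  have "(\<integral>x. (op h x)\<^sup>2 \<partial>\<pi>) \<le> (\<integral>x. (h x)\<^sup>2 \<partial>\<pi>)"
    using power_mono[OF norm2_op_le[OF h] norm2_nonneg, of 2] by (simp add: norm2_power2)
  then show ?thesis
    by (simp add: norm2_power2 dirichlet_def integral_square_diff[OF h op_L2[OF h]])
qed

end

section \<open>The resolvent of a reversible kernel\<close>

context reversible_kernel
begin

text \<open>
  The equation \<open>f = (1 + lam - R) u\<close>. Solutions are unique up to null sets, but all statements
  below hold for any solution.
\<close>

definition resolvent_eq :: "('a \<Rightarrow> real) \<Rightarrow> real \<Rightarrow> ('a \<Rightarrow> real) \<Rightarrow> bool" where
  "resolvent_eq f lam u \<longleftrightarrow> L2 \<pi> u \<and> (AE x in \<pi>. f x = (1 + lam) * u x - op u x)"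

lemma iterates_L2:
  assumes "L2 \<pi> f" shows "L2 \<pi> ((op ^^ k) f)" and "norm2 \<pi> ((op ^^ k) f) \<le> norm2 \<pi> f"
proof -
  have "L2 \<pi> ((op ^^ k) f) \<and> norm2 \<pi> ((op ^^ k) f) \<le> norm2 \<pi> f"
  proof (induction k)
    case 0 then show ?case using assms by simp
  next
    case (Suc k) then show ?case using op_L2 norm2_op_le[of "(op ^^ k) f"] by simp
  qed
  then show "L2 \<pi> ((op ^^ k) f)" "norm2 \<pi> ((op ^^ k) f) \<le> norm2 \<pi> f" by auto
qed

lemma iterates_nonneg: "(\<And>x. 0 \<le> f x) \<Longrightarrow> 0 \<le> (op ^^ k) f x"
  by (induction k arbitrary: x) (auto simp: op_def)

lemma iterates_abs_le:
  assumes f: "L2 \<pi> f"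
  shows "AE x in \<pi>. \<bar>(op ^^ k) f x\<bar> \<le> (op ^^ k) (\<lambda>x. \<bar>f x\<bar>) x"
proof (induction k)
  case (Suc k)
  have i: "integrable \<pi> ((op ^^ k) f)" "integrable \<pi> ((op ^^ k) (\<lambda>x. \<bar>f x\<bar>))"
    using f by (auto intro!: L2_integrable iterates_L2 L2_abs)
  show ?case
    using AE_R[OF Suc.IH] AE_R_integrable[OF i(1)] AE_R_integrable[OF i(2)]
  proof eventually_elim
    case (elim x)
    have "\<bar>op ((op ^^ k) f) x\<bar> \<le> (\<integral>y. \<bar>(op ^^ k) f y\<bar> \<partial>R x)"
      unfolding op_def[of _ x] by (rule integral_abs_bound)
    also have "\<dots> \<le> op ((op ^^ k) (\<lambda>x. \<bar>f x\<bar>)) x"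
      unfolding op_def[of _ x] using elim by (intro integral_mono_AE) auto
    finally show ?case by simp
  qed
qed simp

text \<open>
  The solution is \<open>\<Sum>k. r ^ k * R ^ k f\<close>, summed pointwise. The partial sums of the series for
  \<open>\<bar>f\<bar>\<close> increase and are bounded in norm, so they converge almost everywhere to a
  square-integrable majorant; it justifies exchanging the sum with \<open>op\<close>.
\<close>

lemma neumann_series:
  assumes f: "L2 \<pi> f" and r: "0 < r" "r < 1"
  shows "\<exists>u. L2 \<pi> u \<and> (AE x in \<pi>. u x - r * op u x = f x)"
proof -
  define A where "A k = (op ^^ k) (\<lambda>x. \<bar>f x\<bar>)" for k
  define B where "B k = (op ^^ k) f" for k
  have A: "L2 \<pi> (A k)" "norm2 \<pi> (A k) \<le> norm2 \<pi> f" "0 \<le> A k x" for k x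
    using iterates_L2[OF L2_abs[OF f], of k] iterates_nonneg[of "\<lambda>x. \<bar>f x\<bar>"]
    by (auto simp: A_def norm2_abs)
  have B: "L2 \<pi> (B k)" for k using iterates_L2[OF f] by (simp add: B_def)
  have [measurable]: "A k \<in> borel_measurable \<nu>" "B k \<in> borel_measurable \<nu>" for k
    using A(1) B by measurable
  have BA: "AE x in \<pi>. \<forall>k. \<bar>B k x\<bar> \<le> A k x"
    unfolding AE_all_countable A_def B_def using iterates_abs_le[OF f] by blast
  define U where "U N x = (\<Sum>k<N. r ^ k * A k x)" for N x
  define c where "c = (norm2 \<pi> f / (1 - r))\<^sup>2"
  have UL: "L2 \<pi> (U N)" for N unfolding U_def by (intro L2_sum L2_cmult A)
  have [measurable]: "U N \<in> borel_measurable \<nu>" for N using UL by measurable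
  have Umono: "U N x \<le> U M x" if "N \<le> M" for N M x
    unfolding U_def using that r A(3) by (intro sum_mono2) auto
  have U0: "0 \<le> U N x" for N x unfolding U_def using r A(3) by (intro sum_nonneg) auto
  have Un: "norm2 \<pi> (U N) \<le> norm2 \<pi> f / (1 - r)" for N
  proof -
    have "norm2 \<pi> (U N) \<le> (\<Sum>k<N. norm2 \<pi> (\<lambda>x. r ^ k * A k x))"
      unfolding U_def by (intro norm2_sum L2_cmult A) simp
    also have "\<dots> \<le> (\<Sum>k<N. r ^ k * norm2 \<pi> f)"
      using r A(2) by (intro sum_mono) (auto simp: norm2_cmult intro!: mult_left_mono)
    also have "\<dots> = norm2 \<pi> f * (\<Sum>k<N. r ^ k)" by (simp add: sum_distrib_left mult.commute)
    also have "\<dots> \<le> norm2 \<pi> f * (1 / (1 - r))"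
      using r sum_le_suminf[of "\<lambda>k. r ^ k" "{..<N}"] suminf_geometric[of r]
      by (intro mult_left_mono) (auto simp: summable_geometric)
    finally show ?thesis by simp
  qed
  \<comment> \<open>Monotone convergence in the extended reals, where no limit has to be shown to exist.\<close>
  define S where "S x = (SUP N. ennreal ((U N x)\<^sup>2))" for x
  have S: "(\<integral>\<^sup>+x. S x \<partial>\<pi>) \<le> ennreal c"
  proof -
    have "(\<integral>\<^sup>+x. S x \<partial>\<pi>) = (SUP N. \<integral>\<^sup>+x. ennreal ((U N x)\<^sup>2) \<partial>\<pi>)"
      unfolding S_def
      by (rule nn_integral_monotone_convergence_SUP)
         (auto simp: incseq_def le_fun_def intro!: ennreal_leI power_mono Umono U0)
    also have "\<dots> \<le> ennreal c"
    proof (rule SUP_least)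
      fix N
      have "(\<integral>\<^sup>+x. ennreal ((U N x)\<^sup>2) \<partial>\<pi>) = ennreal ((norm2 \<pi> (U N))\<^sup>2)"
        unfolding norm2_power2
        by (rule nn_integral_eq_integral) (auto intro: L2_square_integrable UL)
      also have "\<dots> \<le> ennreal c"
        unfolding c_def by (intro ennreal_leI power_mono Un norm2_nonneg)
      finally show "(\<integral>\<^sup>+x. ennreal ((U N x)\<^sup>2) \<partial>\<pi>) \<le> ennreal c" .
    qed
    finally show ?thesis .
  qed
  have Sm [measurable]: "S \<in> borel_measurable \<pi>" unfolding S_def by measurable
  have "AE x in \<pi>. S x \<noteq> \<infinity>"
    using S by (intro nn_integral_PInf_AE) (auto simp: top_unique)
  then have summ: "AE x in \<pi>. summable (\<lambda>k. r ^ k * A k x)"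
  proof eventually_elim
    case (elim x)
    then obtain b where b: "S x = ennreal b" "0 \<le> b" by (cases "S x") auto
    have "U N x \<le> sqrt b" for N
    proof -
      have "ennreal ((U N x)\<^sup>2) \<le> S x" unfolding S_def by (intro SUP_upper) auto
      then have "(U N x)\<^sup>2 \<le> b" using b by simp
      then show ?thesis by (rule real_le_rsqrt)
    qed
    then show ?case
      using r A(3) unfolding U_def
      by (intro bounded_imp_summable[where B="sqrt b"]) (simp_all only: lessThan_Suc_atMost[symmetric], simp)
  qed
  define Ui where "Ui x = (\<Sum>k. r ^ k * A k x)" for x
  define u where "u x = (\<Sum>k. r ^ k * B k x)" for x
  have [measurable]: "Ui \<in> borel_measurable \<nu>" "u \<in> borel_measurable \<nu>"
    unfolding Ui_def[abs_def] u_def[abs_def] by measurable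
  have "AE x in \<pi>. ennreal ((Ui x)\<^sup>2) \<le> S x"
    using summ
  proof eventually_elim
    case (elim x)
    have "(\<lambda>N. ennreal ((U N x)\<^sup>2)) \<longlonglongrightarrow> ennreal ((Ui x)\<^sup>2)"
      unfolding U_def Ui_def by (intro tendsto_intros tendsto_ennrealI summable_LIMSEQ elim)
    moreover have "ennreal ((U N x)\<^sup>2) \<le> S x" for N unfolding S_def by (intro SUP_upper) auto
    ultimately show ?case by (intro LIMSEQ_le_const2[where X="\<lambda>N. ennreal ((U N x)\<^sup>2)"]) blast+
  qed
  then have "(\<integral>\<^sup>+x. ennreal ((Ui x)\<^sup>2) \<partial>\<pi>) \<le> (\<integral>\<^sup>+x. S x \<partial>\<pi>)" by (rule nn_integral_mono_AE)
  also note S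
  finally have "(\<integral>\<^sup>+x. ennreal ((Ui x)\<^sup>2) \<partial>\<pi>) < \<infinity>" by (rule le_less_trans) simp
  then have UiL: "L2 \<pi> Ui" by (auto simp: L2_def measurable_pi_iff integrable_iff_bounded)
  have good: "AE x in \<pi>. (\<lambda>N. \<Sum>k<N. r ^ k * B k x) \<longlonglongrightarrow> u x \<and> \<bar>u x\<bar> \<le> \<bar>Ui x\<bar> \<and>
      (\<forall>N. \<bar>\<Sum>k<N. r ^ k * B k x\<bar> \<le> Ui x)"
    using summ BA
  proof eventually_elim
    case (elim x)
    have le: "norm (r ^ k * B k x) \<le> r ^ k * A k x" for k
      using elim(2) r by (auto simp: abs_mult intro!: mult_left_mono)
    have s: "summable (\<lambda>k. r ^ k * B k x)"
      by (rule summable_comparison_test'[OF elim(1)]) (rule le)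
    have part: "\<bar>\<Sum>k<N. r ^ k * B k x\<bar> \<le> Ui x" for N
    proof -
      have "\<bar>\<Sum>k<N. r ^ k * B k x\<bar> \<le> (\<Sum>k<N. r ^ k * A k x)"
        using le by (intro order_trans[OF sum_abs] sum_mono) auto
      also have "\<dots> \<le> Ui x"
        unfolding Ui_def using r A(3) by (intro sum_le_suminf elim(1)) auto
      finally show ?thesis .
    qed
    have lim: "(\<lambda>N. \<Sum>k<N. r ^ k * B k x) \<longlonglongrightarrow> u x"
      unfolding u_def by (rule summable_LIMSEQ[OF s])
    have "\<bar>u x\<bar> \<le> Ui x"
      by (rule LIMSEQ_le_const2[OF tendsto_rabs[OF lim]]) (use part in auto)
    then show ?case using lim part by auto
  qed
  have uL: "L2 \<pi> u"
    unfolding L2_def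
  proof
    show "integrable \<pi> (\<lambda>x. (u x)\<^sup>2)"
      by (rule Bochner_Integration.integrable_bound[OF L2_square_integrable[OF UiL]])
         (measurable, use good in \<open>auto elim!: eventually_mono simp: abs_le_square_iff\<close>)
  qed measurable
  have "AE x in \<pi>. \<forall>k. integrable (R x) (B k)"
    unfolding AE_all_countable using AE_R_integrable L2_integrable[OF B] by blast
  then have "AE x in \<pi>. u x - r * op u x = f x"
    using AE_R[OF good] AE_R_integrable[OF L2_integrable[OF UiL]] good AE_space
  proof eventually_elim
    case (elim x)
    have [measurable]: "Ui \<in> borel_measurable (R x)" "u \<in> borel_measurable (R x)"
        "B k \<in> borel_measurable (R x)" for k
      using elim(5) by (auto intro!: measurable_R)
    have "(\<lambda>N. \<integral>y. (\<Sum>k<N. r ^ k * B k y) \<partial>R x) \<longlonglongrightarrow> (\<integral>y. u y \<partial>R x)"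
    proof (rule integral_dominated_convergence[where w=Ui])
      show "AE y in R x. (\<lambda>N. \<Sum>k<N. r ^ k * B k y) \<longlonglongrightarrow> u y"
        using elim(2) by eventually_elim blast
      show "AE y in R x. norm (\<Sum>k<N. r ^ k * B k y) \<le> Ui y" for N
        using elim(2) by eventually_elim simp
    qed (use elim(3) in measurable)
    moreover have "(\<integral>y. (\<Sum>k<N. r ^ k * B k y) \<partial>R x) = (\<Sum>k<N. r ^ k * B (Suc k) x)" for N
      using elim(1) by (simp add: B_def op_def)
    ultimately have "(\<lambda>N. r * (\<Sum>k<N. r ^ k * B (Suc k) x)) \<longlonglongrightarrow> r * op u x"
      by (auto simp: op_def intro: tendsto_mult_left)
    moreover have "r * (\<Sum>k<N. r ^ k * B (Suc k) x) = (\<Sum>k<Suc N. r ^ k * B k x) - f x" for N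
      unfolding sum.lessThan_Suc_shift by (simp add: B_def sum_distrib_left ac_simps)
    moreover have "(\<lambda>N. (\<Sum>k<Suc N. r ^ k * B k x) - f x) \<longlonglongrightarrow> u x - f x"
      using elim(4) by (intro tendsto_diff tendsto_const LIMSEQ_Suc) auto
    ultimately have "r * op u x = u x - f x"
      by (auto intro: LIMSEQ_unique)
    then show ?case by simp
  qed
  with uL show ?thesis by blast
qed

lemma resolvent_exists:
  assumes f: "L2 \<pi> f" and lam: "0 < lam"
  shows "\<exists>u. resolvent_eq f lam u"
proof -
  \<comment> \<open>The equation for \<open>lam\<close> is the equation \<open>u - r * op u = f\<close>, multiplied by \<open>1 + lam\<close>.\<close>
  define r where "r = 1 / (1 + lam)"
  have r: "0 < r" "r < 1" "r * (1 + lam) = 1" using lam by (auto simp: r_def)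
  obtain u where u: "L2 \<pi> u" "AE x in \<pi>. u x - r * op u x = f x"
    using neumann_series[OF f r(1,2)] by blast
  have "resolvent_eq f lam (\<lambda>x. r * u x)"
    unfolding resolvent_eq_def
  proof
    have "(1 + lam) * (r * a) = a" for a
      using r(3) by (metis mult.assoc mult.commute mult_1)
    note this[simp]
    show "AE x in \<pi>. f x = (1 + lam) * (r * u x) - op (\<lambda>x. r * u x) x"
      using u(2) by eventually_elim (simp add: op_cmult)
  qed (rule L2_cmult[OF u(1)])
  then show ?thesis by blast
qed

definition resolvent :: "('a \<Rightarrow> real) \<Rightarrow> real \<Rightarrow> 'a \<Rightarrow> real" where
  "resolvent f lam = (SOME u. resolvent_eq f lam u)"

text \<open>
  In spectral terms this is \<open>\<integral> 1 / (1 + lam - x) d\<mu>(x)\<close> for the spectral measure \<open>\<mu>\<close> of \<open>f\<close>.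
\<close>

definition resolvent_form :: "('a \<Rightarrow> real) \<Rightarrow> real \<Rightarrow> real" where
  "resolvent_form f lam = (ip f (resolvent f lam))"

lemma resolvent_eq_resolvent: "L2 \<pi> f \<Longrightarrow> 0 < lam \<Longrightarrow> resolvent_eq f lam (resolvent f lam)"
  unfolding resolvent_def by (rule someI_ex[OF resolvent_exists])

lemma resolvent_eq_L2: "resolvent_eq f lam u \<Longrightarrow> L2 \<pi> u"
  by (simp add: resolvent_eq_def)

lemma resolvent_L2: "L2 \<pi> f \<Longrightarrow> 0 < lam \<Longrightarrow> L2 \<pi> (resolvent f lam)"
  using resolvent_eq_resolvent resolvent_eq_L2 by blast

lemma resolvent_eq_integral:
  assumes f: "f \<in> borel_measurable \<nu>" and u: "resolvent_eq f lam u" and k: "L2 \<pi> k"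
  shows "(ip f k) = (1 + lam) * (ip u k) - (ip (op u) k)"
proof -
  note uL = resolvent_eq_L2[OF u]
  have [measurable]: "u \<in> borel_measurable \<nu>" "k \<in> borel_measurable \<nu>" "f \<in> borel_measurable \<nu>"
    using uL k f by measurable
  have "(ip f k) = (\<integral>x. (1 + lam) * (u x * k x) - op u x * k x \<partial>\<pi>)"
  proof (rule integral_cong_AE)
    show "AE x in \<pi>. f x * k x = (1 + lam) * (u x * k x) - op u x * k x"
      using u[unfolded resolvent_eq_def, THEN conjunct2]
      by eventually_elim (simp add: left_diff_distrib)
  qed measurable
  then show ?thesis
    using L2_mult_integrable[OF uL k] L2_mult_integrable[OF op_L2[OF uL] k] by simp
qed

lemma resolvent_eq_energy:
  assumes f: "f \<in> borel_measurable \<nu>" and u: "resolvent_eq f lam u"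
  shows "(ip f u) = lam * (norm2 \<pi> u)\<^sup>2 + dirichlet u"
proof -
  have "(ip u u) = (norm2 \<pi> u)\<^sup>2" unfolding norm2_power2 by (simp add: power2_eq_square)
  then show ?thesis
    unfolding resolvent_eq_integral[OF f u resolvent_eq_L2[OF u]] dirichlet_def norm2_power2
    by (simp add: algebra_simps)
qed

lemma resolvent_eq_energy_nonneg:
  assumes "f \<in> borel_measurable \<nu>" "resolvent_eq f lam u" "0 \<le> lam"
  shows "0 \<le> (ip f u)"
  using resolvent_eq_energy[OF assms(1,2)] dirichlet_nonneg[OF resolvent_eq_L2[OF assms(2)]] assms(3)
  by simp

text \<open>
  Pair each of the two equations with the solution of the other one; the terms with \<open>op\<close>
  cancel by symmetry.
\<close>

lemma resolvent_identity:
  assumes f: "f \<in> borel_measurable \<nu>" and u: "resolvent_eq f lam u" and v: "resolvent_eq f mu v"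
  shows "(lam - mu) * (ip u v) = (ip f v) - (ip f u)"
  using resolvent_eq_integral[OF f u resolvent_eq_L2[OF v]]
    resolvent_eq_integral[OF f v resolvent_eq_L2[OF u]]
    op_symmetric[OF resolvent_eq_L2[OF u] resolvent_eq_L2[OF v]]
  by (simp add: algebra_simps)

text \<open>
  With \<open>G lam\<close> for the inverse of \<open>1 + lam - R\<close>, this is the identity
  \<open>G mu (G lam f) = (G mu f - G lam f) / (lam - mu)\<close>. It provides a corrector for the remainder \<open>lam * u\<close> of the
  martingale decomposition.
\<close>

lemma resolvent_eq_scaled_resolvent:
  assumes u: "resolvent_eq f lam u" and v: "resolvent_eq f mu v" and ne: "lam \<noteq> mu"
  shows "resolvent_eq (\<lambda>x. lam * u x) mu (\<lambda>x. lam / (lam - mu) * (v x - u x))"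
  unfolding resolvent_eq_def
proof
  note L = resolvent_eq_L2[OF u] resolvent_eq_L2[OF v]
  show "L2 \<pi> (\<lambda>x. lam / (lam - mu) * (v x - u x))" by (intro L2_cmult L2_diff L)
  show "AE x in \<pi>. lam * u x = (1 + mu) * (lam / (lam - mu) * (v x - u x))
      - op (\<lambda>x. lam / (lam - mu) * (v x - u x)) x"
    using op_diff_AE[OF L(2)[THEN L2_integrable] L(1)[THEN L2_integrable]]
      u[unfolded resolvent_eq_def, THEN conjunct2] v[unfolded resolvent_eq_def, THEN conjunct2]
  proof eventually_elim
    case (elim x)
    have "(1 + mu) * (v x - u x) - (op v x - op u x) = (lam - mu) * u x"
      using elim(2,3) by (simp add: algebra_simps)
    then have "lam / (lam - mu) * ((1 + mu) * (v x - u x) - (op v x - op u x)) = lam * u x"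
      using ne by (simp add: field_simps)
    moreover have "op (\<lambda>x. lam / (lam - mu) * (v x - u x)) x = lam / (lam - mu) * (op v x - op u x)"
      unfolding op_cmult elim(1) ..
    ultimately show ?case by (simp only: right_diff_distrib mult.left_commute[of "1 + mu"])
  qed
qed

text \<open>
  As \<open>mu\<close> tends to \<open>0\<close> the right-hand side is at most the distance of \<open>\<langle>f, u\<rangle>\<close> from its limit. This
  replaces the dominated convergence under the spectral measure by which the remainder \<open>lam * u\<close> is
  usually shown to vanish.
\<close>

lemma resolvent_form_scaled:
  assumes f: "f \<in> borel_measurable \<nu>" and u: "resolvent_eq f lam u" and v: "resolvent_eq f mu v"
    and ne: "lam \<noteq> mu"
  shows "(\<integral>x. (lam * u x) * (lam / (lam - mu) * (v x - u x)) \<partial>\<pi>) =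
    (lam / (lam - mu))\<^sup>2 * ((ip f v) - (ip f u) - (lam - mu) * (norm2 \<pi> u)\<^sup>2)"
proof -
  note L = resolvent_eq_L2[OF u] resolvent_eq_L2[OF v]
  have "(\<integral>x. (lam * u x) * (lam / (lam - mu) * (v x - u x)) \<partial>\<pi>) =
      (\<integral>x. lam\<^sup>2 / (lam - mu) * (u x * v x - u x * u x) \<partial>\<pi>)"
    by (rule Bochner_Integration.integral_cong)
       (auto simp: power2_eq_square right_diff_distrib diff_divide_distrib ac_simps)
  also have "\<dots> = lam\<^sup>2 / (lam - mu) * ((ip u v) - (norm2 \<pi> u)\<^sup>2)"
    using L2_mult_integrable[OF L(1,2)] L2_mult_integrable[OF L(1,1)]
    unfolding norm2_power2 by (simp add: power2_eq_square)
  also have "\<dots> = (lam / (lam - mu))\<^sup>2 * ((lam - mu) * ((ip u v) - (norm2 \<pi> u)\<^sup>2))"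
    using ne by (simp add: power2_eq_square)
  finally show ?thesis
    using resolvent_identity[OF f u v] by (simp add: right_diff_distrib)
qed

text \<open>
  The form in the preceding lemma is an energy, hence nonnegative. The term kept on the left
  shows that \<open>lam * \<parallel>u\<parallel>\<^sup>2\<close> vanishes in the limit as soon as the form is bounded.
\<close>

lemma resolvent_form_mono_strong:
  assumes f: "f \<in> borel_measurable \<nu>" and u: "resolvent_eq f lam u" and v: "resolvent_eq f mu v"
    and mu: "0 \<le> mu" "mu < lam"
  shows "(lam - mu) * (norm2 \<pi> u)\<^sup>2 \<le> (ip f v) - (ip f u)"
proof -
  have "(\<lambda>x. lam * u x) \<in> borel_measurable \<nu>" using resolvent_eq_L2[OF u] by measurable
  from resolvent_eq_energy_nonneg[OF this resolvent_eq_scaled_resolvent[OF u v] mu(1)] mu(2)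
  have "0 \<le> (lam / (lam - mu))\<^sup>2 * ((ip f v) - (ip f u) - (lam - mu) * (norm2 \<pi> u)\<^sup>2)"
    using resolvent_form_scaled[OF f u v] by simp
  moreover have "0 < (lam / (lam - mu))\<^sup>2" using mu by simp
  ultimately have "0 \<le> (ip f v) - (ip f u) - (lam - mu) * (norm2 \<pi> u)\<^sup>2"
    by (simp only: zero_le_mult_iff) linarith
  then show ?thesis by linarith
qed

lemma resolvent_form_decreasing:
  assumes f: "L2 \<pi> f" and mu: "0 < mu" "mu \<le> lam"
  shows "resolvent_form f lam \<le> resolvent_form f mu"
proof (cases "mu = lam")
  case False
  have "0 \<le> (lam - mu) * (norm2 \<pi> (resolvent f lam))\<^sup>2" using mu by simp
  also have "\<dots> \<le> resolvent_form f mu - resolvent_form f lam"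
    unfolding resolvent_form_def
    using mu False L2_measurable_nu[OF f]
    by (intro resolvent_form_mono_strong resolvent_eq_resolvent f) auto
  finally show ?thesis by simp
qed simp

lemma dirichlet_diff:
  assumes u: "L2 \<pi> u" and h: "L2 \<pi> h"
  shows "dirichlet (\<lambda>x. u x - h x) =
    dirichlet u - 2 * ((ip u h) - (ip (op u) h)) + dirichlet h"
proof -
  have [measurable]: "u \<in> borel_measurable \<nu>" "h \<in> borel_measurable \<nu>" using u h by measurable
  note L = L2_mult_integrable[OF u op_L2[OF u]] L2_mult_integrable[OF u op_L2[OF h]]
    L2_mult_integrable[OF h op_L2[OF u]] L2_mult_integrable[OF h op_L2[OF h]]
  have "(\<integral>x. (u x - h x) * op (\<lambda>x. u x - h x) x \<partial>\<pi>) =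
      (\<integral>x. u x * op u x - u x * op h x - (h x * op u x - h x * op h x) \<partial>\<pi>)"
  proof (rule integral_cong_AE)
    show "AE x in \<pi>. (u x - h x) * op (\<lambda>x. u x - h x) x = u x * op u x - u x * op h x - (h x * op u x - h x * op h x)"
      using op_diff_AE[OF u[THEN L2_integrable] h[THEN L2_integrable]]
      by eventually_elim (simp only: right_diff_distrib left_diff_distrib)
  qed measurable
  also have "\<dots> = (ip u (op u)) - (ip u (op h))
      - ((ip h (op u)) - (ip h (op h)))"
    using L by simp
  finally show ?thesis
    unfolding dirichlet_def integral_square_diff[OF u h]
    using op_symmetric[OF u h] by (simp add: mult.commute)
qed

text \<open>
  The difference of the two sides is the energy \<open>lam * \<parallel>u - h\<parallel>\<^sup>2 + dirichlet (u - h)\<close>.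
\<close>

lemma resolvent_variational:
  assumes f: "f \<in> borel_measurable \<nu>" and u: "resolvent_eq f lam u" and lam: "0 \<le> lam" and h: "L2 \<pi> h"
  shows "2 * (ip f h) - lam * (norm2 \<pi> h)\<^sup>2 - dirichlet h \<le> (ip f u)"
proof -
  note uL = resolvent_eq_L2[OF u]
  have "0 \<le> lam * (norm2 \<pi> (\<lambda>x. u x - h x))\<^sup>2 + dirichlet (\<lambda>x. u x - h x)"
    using lam dirichlet_nonneg[OF L2_diff[OF uL h]] by simp
  also have "\<dots> = (lam * (norm2 \<pi> u)\<^sup>2 + dirichlet u)
     - 2 * ((1 + lam) * (ip u h) - (ip (op u) h)) + (lam * (norm2 \<pi> h)\<^sup>2 + dirichlet h)"
    unfolding dirichlet_diff[OF uL h] norm2_power2 integral_square_diff[OF uL h]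
    by (simp add: algebra_simps)
  also have "\<dots> = (ip f u) - 2 * (ip f h) + (lam * (norm2 \<pi> h)\<^sup>2 + dirichlet h)"
    using resolvent_eq_integral[OF f u h] resolvent_eq_energy[OF f u] by simp
  finally show ?thesis by linarith
qed

lemma resolvent_form_ge:
  assumes f: "L2 \<pi> f" and lam: "0 < lam" and h: "L2 \<pi> h"
  shows "2 * (ip f h) - lam * (norm2 \<pi> h)\<^sup>2 - dirichlet h \<le> resolvent_form f lam"
  unfolding resolvent_form_def
  using lam by (intro resolvent_variational L2_measurable_nu[OF f] resolvent_eq_resolvent f h) auto

lemma resolvent_form_eq:
  assumes f: "L2 \<pi> f" and lam: "0 < lam"
  shows "resolvent_form f lam = 2 * (ip f (resolvent f lam))
    - lam * (norm2 \<pi> (resolvent f lam))\<^sup>2 - dirichlet (resolvent f lam)"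
  using resolvent_eq_energy[OF L2_measurable_nu[OF f] resolvent_eq_resolvent[OF f lam]]
  by (simp add: resolvent_form_def)

lemma resolvent_form_convergent:
  assumes f: "L2 \<pi> f" and bd: "\<And>lam. 0 < lam \<Longrightarrow> resolvent_form f lam \<le> C"
  obtains \<Phi> where "(resolvent_form f \<longlongrightarrow> \<Phi>) (at_right 0)" "\<And>lam. 0 < lam \<Longrightarrow> resolvent_form f lam \<le> \<Phi>"
proof
  let ?\<Phi> = "SUP lam\<in>{0<..}. resolvent_form f lam"
  have bdd: "bdd_above (resolvent_form f ` {0<..})" using bd by (auto intro!: bdd_aboveI)
  show upper: "resolvent_form f lam \<le> ?\<Phi>" if "0 < lam" for lam
    using that by (intro cSUP_upper bdd) auto
  show "(resolvent_form f \<longlongrightarrow> ?\<Phi>) (at_right 0)"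
  proof (rule order_tendstoI)
    fix a assume "a < ?\<Phi>"
    then obtain lam where lam: "0 < lam" "a < resolvent_form f lam"
      using less_cSUP_iff[OF _ bdd, of a] by auto
    have "a < resolvent_form f mu" if "0 < mu" "mu < lam" for mu
      using resolvent_form_decreasing[OF f, of mu lam] that lam by auto
    then show "\<forall>\<^sub>F mu in at_right 0. a < resolvent_form f mu"
      unfolding eventually_at_right_field using lam by auto
  next
    fix a assume "?\<Phi> < a"
    then show "\<forall>\<^sub>F mu in at_right 0. resolvent_form f mu < a"
      unfolding eventually_at_right_field using upper by (intro exI[of _ 1], auto intro: le_less_trans)
  qed
qed

end

text \<open>
  Insert the resolvent of \<open>B\<close> into the variational formula for \<open>A\<close>.
\<close>

lemma resolvent_form_antimono_dirichlet:
  assumes A: "reversible_kernel \<nu> \<pi> A" and B: "reversible_kernel \<nu> \<pi> B"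
    and f: "L2 \<pi> f" and lam: "0 < lam"
    and le: "\<And>h. L2 \<pi> h \<Longrightarrow> reversible_kernel.dirichlet \<pi> A h \<le> reversible_kernel.dirichlet \<pi> B h"
  shows "reversible_kernel.resolvent_form \<pi> B f lam \<le> reversible_kernel.resolvent_form \<pi> A f lam"
proof -
  interpret A: reversible_kernel \<nu> \<pi> A by fact
  interpret B: reversible_kernel \<nu> \<pi> B by fact
  have v: "L2 \<pi> (B.resolvent f lam)" by (rule B.resolvent_L2[OF f lam])
  show ?thesis
    using A.resolvent_form_ge[OF f lam v] le[OF v] unfolding B.resolvent_form_eq[OF f lam] by linarith
qed

text \<open>
  Formally \<open>lam + c * (1 - B) = c * (lam / c + (1 - B))\<close>. The operators \<open>1 - A\<close> and \<open>c * (1 - B)\<close> are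
  only compared through their quadratic forms, so each inequality comes from inserting the
  rescaled maximiser of one variational problem into the other.
\<close>

lemma resolvent_form_dirichlet_scaled:
  assumes A: "reversible_kernel \<nu> \<pi> A" and B: "reversible_kernel \<nu> \<pi> B"
    and f: "L2 \<pi> f" and lam: "0 < lam" and c: "0 < c"
    and eq: "\<And>h. L2 \<pi> h \<Longrightarrow> reversible_kernel.dirichlet \<pi> A h = c * reversible_kernel.dirichlet \<pi> B h"
  shows "reversible_kernel.resolvent_form \<pi> A f lam = reversible_kernel.resolvent_form \<pi> B f (lam / c) / c"
proof -
  interpret A: reversible_kernel \<nu> \<pi> A by fact
  interpret B: reversible_kernel \<nu> \<pi> B by fact
  have mu: "0 < lam / c" using lam c by simp
  define u v where "u = A.resolvent f lam" and "v = B.resolvent f (lam / c)"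
  have uL: "L2 \<pi> u" and vL: "L2 \<pi> v"
    unfolding u_def v_def by (rule A.resolvent_L2[OF f lam], rule B.resolvent_L2[OF f mu])
  have "c * A.resolvent_form f lam = c * (2 * (\<integral>x. f x * u x \<partial>\<pi>) - lam * (norm2 \<pi> u)\<^sup>2 - c * B.dirichlet u)"
    using A.resolvent_form_eq[OF f lam] eq[OF uL] by (simp add: u_def)
  also have "\<dots> = 2 * (\<integral>x. f x * (c * u x) \<partial>\<pi>) - lam / c * (norm2 \<pi> (\<lambda>x. c * u x))\<^sup>2 - B.dirichlet (\<lambda>x. c * u x)"
    unfolding B.dirichlet_cmult norm2_cmult integral_mult_cmult
    using c by (simp add: power2_eq_square right_diff_distrib)
  also have "\<dots> \<le> B.resolvent_form f (lam / c)" by (rule B.resolvent_form_ge[OF f mu L2_cmult[OF uL]])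
  finally have 1: "c * A.resolvent_form f lam \<le> B.resolvent_form f (lam / c)" .
  have "B.resolvent_form f (lam / c) / c = (2 * (\<integral>x. f x * v x \<partial>\<pi>) - lam / c * (norm2 \<pi> v)\<^sup>2 - B.dirichlet v) / c"
    using B.resolvent_form_eq[OF f mu] by (simp add: v_def)
  also have "\<dots> = 2 * (\<integral>x. f x * ((1 / c) * v x) \<partial>\<pi>) - lam * (norm2 \<pi> (\<lambda>x. (1 / c) * v x))\<^sup>2 - A.dirichlet (\<lambda>x. (1 / c) * v x)"
    unfolding A.dirichlet_cmult norm2_cmult eq[OF vL] integral_mult_cmult
    using c by (simp add: power2_eq_square diff_divide_distrib)
  also have "\<dots> \<le> A.resolvent_form f lam" by (rule A.resolvent_form_ge[OF f lam L2_cmult[OF vL]])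
  finally have "B.resolvent_form f (lam / c) / c \<le> A.resolvent_form f lam" .
  moreover have "A.resolvent_form f lam \<le> B.resolvent_form f (lam / c) / c"
    using 1 c by (simp add: le_divide_eq mult.commute)
  ultimately show ?thesis by simp
qed

section \<open>The stationary chain on path space\<close>

context reversible_kernel
begin

abbreviation chain :: "(nat \<Rightarrow> 'a) measure" where
  "chain \<equiv> chain_law \<nu> \<pi> R"

sublocale IT: Ionescu_Tulcea "chain_step \<pi> R" "\<lambda>_. \<nu>"
  by (rule Ionescu_Tulcea_chain[OF pi_prob_algebra R_kernel])

sublocale chain: prob_space chain
  by (rule prob_space_chain_law[OF pi_prob_algebra R_kernel])

lemma sets_chain [measurable_cong, simp]: "sets chain = sets (PiM UNIV (\<lambda>_. \<nu>))"
  by (rule sets_chain_law[OF pi_prob_algebra R_kernel])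

lemma component_measurable: "(\<lambda>X. X n) \<in> chain \<rightarrow>\<^sub>M \<nu>"
  by measurable

lemma pair_measurable: "(\<lambda>X. (X n, X (Suc n))) \<in> chain \<rightarrow>\<^sub>M \<nu> \<Otimes>\<^sub>M \<nu>"
  by measurable

lemma component_in_space: "X \<in> space chain \<Longrightarrow> X n \<in> space \<nu>"
  using measurable_space[OF component_measurable] .

lemma restrict_measurable [measurable]: "(\<lambda>X. restrict X {0..<n}) \<in> chain \<rightarrow>\<^sub>M PiM {0..<n} (\<lambda>_. \<nu>)"
  by (subst measurable_cong_sets[OF sets_chain refl]) (rule measurable_restrict_subset, simp)

lemma distr_chain_restrict:
  "distr chain (PiM {0..<n} (\<lambda>_. \<nu>)) (\<lambda>X. restrict X {0..<n}) = IT.C 0 n (\<lambda>_. undefined)"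
proof -
  \<comment> \<open>\<open>IT.CI\<close> is defined from the law of the first \<open>IT.up_to J\<close> coordinates.\<close>
  have up: "IT.up_to {0..<n} = n"
  proof (rule antisym)
    show "IT.up_to {0..<n} \<le> n" by (simp add: IT.up_to_iff)
    show "n \<le> IT.up_to {0..<n}"
      using IT.up_to[of "{0..<n}"] by (cases n) (auto simp: subset_iff Suc_le_eq)
  qed
  have "distr chain (PiM {0..<n} (\<lambda>_. \<nu>)) (\<lambda>X. restrict X {0..<n}) = IT.CI {0..<n}"
    unfolding chain_law_def by (rule IT.distr_lim) simp
  also have "\<dots> = IT.C 0 n (\<lambda>_. undefined)"
    unfolding IT.CI_def up using IT.distr_C[of n n "\<lambda>_. undefined" 0] by (simp add: space_PiM)
  finally show ?thesis .
qed

lemma C_Suc: "IT.C 0 (Suc n) (\<lambda>_. undefined) = IT.C 0 n (\<lambda>_. undefined) \<bind> IT.eP n"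
  by simp

lemma C_measurable_cong: "sets (IT.C 0 n (\<lambda>_. undefined)) = sets (PiM {0..<n} (\<lambda>_. \<nu>))"
  using IT.sets_C[of "\<lambda>_. undefined" 0 n] by (simp add: space_PiM)

text \<open>
  The projective limit restricted to the first \<open>n + 1\<close> coordinates is obtained from the first \<open>n\<close>
  coordinates by one step of the kernel.
\<close>

lemma nn_integral_chain_step:
  assumes F [measurable]: "F \<in> borel_measurable (PiM {0..<Suc n} (\<lambda>_. \<nu>))"
  shows "(\<integral>\<^sup>+X. F (restrict X {0..<Suc n}) \<partial>chain) =
    (\<integral>\<^sup>+X. \<integral>\<^sup>+y. F (fun_upd (restrict X {0..<n}) n y) \<partial>chain_step \<pi> R n (restrict X {0..<n}) \<partial>chain)"
proof -
  let ?C = "IT.C 0 n (\<lambda>_. undefined)"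
  have spC: "space ?C = space (PiM {0..<n} (\<lambda>_. \<nu>))"
    by (rule sets_eq_imp_space_eq[OF C_measurable_cong])
  have "(\<integral>\<^sup>+X. F (restrict X {0..<Suc n}) \<partial>chain) = (\<integral>\<^sup>+X. F X \<partial>IT.C 0 (Suc n) (\<lambda>_. undefined))"
    unfolding distr_chain_restrict[symmetric] by (rule nn_integral_distr[symmetric]) measurable
  also have "\<dots> = (\<integral>\<^sup>+X. \<integral>\<^sup>+X'. F X' \<partial>IT.eP n X \<partial>?C)"
    unfolding C_Suc
    by (rule nn_integral_bind[OF F])
       (subst measurable_cong_sets[OF C_measurable_cong refl], rule IT.measurable_eP)
  also have "\<dots> = (\<integral>\<^sup>+X. \<integral>\<^sup>+y. F (fun_upd X n y) \<partial>chain_step \<pi> R n X \<partial>?C)"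
    by (rule nn_integral_cong) (simp add: spC IT.nn_integral_eP)
  also have "\<dots> = (\<integral>\<^sup>+X. \<integral>\<^sup>+y. F (fun_upd (restrict X {0..<n}) n y) \<partial>chain_step \<pi> R n (restrict X {0..<n}) \<partial>chain)"
  proof -
    have "(\<lambda>X. \<integral>\<^sup>+X'. F X' \<partial>IT.eP n X) \<in> borel_measurable (PiM {0..<n} (\<lambda>_. \<nu>))" by measurable
    then have [measurable]: "(\<lambda>X. \<integral>\<^sup>+y. F (fun_upd X n y) \<partial>chain_step \<pi> R n X) \<in> borel_measurable (PiM {0..<n} (\<lambda>_. \<nu>))"
      by (rule measurable_cong[THEN iffD1, rotated]) (rule IT.nn_integral_eP, auto)
    show ?thesis
      unfolding distr_chain_restrict[symmetric] by (rule nn_integral_distr) measurable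
  qed
  finally show ?thesis .
qed

lemma integral_chain_step:
  assumes F [measurable]: "F \<in> borel_measurable (PiM {0..<Suc n} (\<lambda>_. \<nu>))"
    and int: "integrable chain (\<lambda>X. F (restrict X {0..<Suc n}) :: real)"
  shows "(\<integral>X. F (restrict X {0..<Suc n}) \<partial>chain) =
    (\<integral>X. \<integral>y. F (fun_upd (restrict X {0..<n}) n y) \<partial>chain_step \<pi> R n (restrict X {0..<n}) \<partial>chain)"
proof -
  let ?C = "IT.C 0 n (\<lambda>_. undefined)"
  have spC: "space ?C = space (PiM {0..<n} (\<lambda>_. \<nu>))"
    by (rule sets_eq_imp_space_eq[OF C_measurable_cong])
  have ne: "space ?C \<noteq> {}" unfolding spC by simp
  have eP: "IT.eP n \<in> ?C \<rightarrow>\<^sub>M subprob_algebra (PiM {0..<Suc n} (\<lambda>_. \<nu>))"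
    by (subst measurable_cong_sets[OF C_measurable_cong refl], rule IT.measurable_eP)
  have eP_int: "(\<integral>X'. F X' \<partial>IT.eP n X) = (\<integral>y. F (fun_upd X n y) \<partial>chain_step \<pi> R n X)"
    if "X \<in> space (PiM {0..<n} (\<lambda>_. \<nu>))" for X
    unfolding IT.eP_def using that
    by (intro integral_distr measurable_fun_upd[where J="{0..<n}"]) (auto simp: measurable_ident_sets[OF IT.sets_P])
  have int': "integrable (IT.C 0 (Suc n) (\<lambda>_. undefined)) F"
    unfolding distr_chain_restrict[symmetric] using int by (subst integrable_distr_eq) auto
  have "(\<integral>X. F (restrict X {0..<Suc n}) \<partial>chain) = (\<integral>X. F X \<partial>IT.C 0 (Suc n) (\<lambda>_. undefined))"
    unfolding distr_chain_restrict[symmetric] by (rule integral_distr[symmetric]) measurable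
  also have "\<dots> = (\<integral>X. \<integral>X'. F X' \<partial>IT.eP n X \<partial>?C)"
    using integrable_bind_real(3)[OF eP _ ne, of F] int' unfolding C_Suc by blast
  also have "\<dots> = (\<integral>X. \<integral>y. F (fun_upd X n y) \<partial>chain_step \<pi> R n X \<partial>?C)"
    by (rule Bochner_Integration.integral_cong) (simp_all add: spC eP_int)
  also have "\<dots> = (\<integral>X. \<integral>y. F (fun_upd (restrict X {0..<n}) n y) \<partial>chain_step \<pi> R n (restrict X {0..<n}) \<partial>chain)"
  proof -
    have "(\<lambda>X. \<integral>X'. F X' \<partial>IT.eP n X) \<in> borel_measurable (PiM {0..<n} (\<lambda>_. \<nu>))" by measurable
    then have [measurable]: "(\<lambda>X. \<integral>y. F (fun_upd X n y) \<partial>chain_step \<pi> R n X) \<in> borel_measurable (PiM {0..<n} (\<lambda>_. \<nu>))"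
      by (rule measurable_cong[THEN iffD1, rotated]) (rule eP_int)
    show ?thesis
      unfolding distr_chain_restrict[symmetric] by (rule integral_distr) measurable
  qed
  finally show ?thesis .
qed

lemma distr_chain_component: "distr chain \<nu> (\<lambda>X. X n) = \<pi>"
proof (induction n)
  case 0
  show ?case
  proof (rule measure_eqI)
    fix A assume "A \<in> sets (distr chain \<nu> (\<lambda>X. X 0))"
    then have A [measurable]: "A \<in> sets \<nu>" by simp
    have "emeasure (distr chain \<nu> (\<lambda>X. X 0)) A =
        (\<integral>\<^sup>+x. indicator A x \<partial>distr chain \<nu> (\<lambda>X. X 0))"
      by simp
    also have "\<dots> = (\<integral>\<^sup>+X. indicator A (X 0) \<partial>chain)"
      by (rule nn_integral_distr[OF component_measurable, of "indicator A"]) measurable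
    also have "\<dots> = (\<integral>\<^sup>+X. indicator A (restrict X {0..<Suc 0} 0) \<partial>chain)" by simp
    also have "\<dots> = (\<integral>\<^sup>+X. \<integral>\<^sup>+y. indicator A y \<partial>\<pi> \<partial>chain)"
      by (subst nn_integral_chain_step[where F="\<lambda>X. indicator A (X 0)"])
         (measurable, simp_all add: chain_step_def)
    also have "\<dots> = emeasure \<pi> A" by (simp add: chain.emeasure_space_1)
    finally show "emeasure (distr chain \<nu> (\<lambda>X. X 0)) A = emeasure \<pi> A" .
  qed simp
next
  case (Suc n)
  show ?case
  proof (rule measure_eqI)
    fix A assume "A \<in> sets (distr chain \<nu> (\<lambda>X. X (Suc n)))"
    then have A [measurable]: "A \<in> sets \<nu>" by simp
    have "emeasure (distr chain \<nu> (\<lambda>X. X (Suc n))) A =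
        (\<integral>\<^sup>+x. indicator A x \<partial>distr chain \<nu> (\<lambda>X. X (Suc n)))"
      by simp
    also have "\<dots> = (\<integral>\<^sup>+X. indicator A (X (Suc n)) \<partial>chain)"
      by (rule nn_integral_distr[OF component_measurable, of "indicator A"]) measurable
    also have "\<dots> = (\<integral>\<^sup>+X. indicator A (restrict X {0..<Suc (Suc n)} (Suc n)) \<partial>chain)" by simp
    also have "\<dots> = (\<integral>\<^sup>+X. \<integral>\<^sup>+y. indicator A y \<partial>R (X n) \<partial>chain)"
      by (subst nn_integral_chain_step[where F="\<lambda>X. indicator A (X (Suc n))"])
         (measurable, simp_all add: chain_step_def)
    also have "\<dots> = (\<integral>\<^sup>+X. emeasure (R (X n)) A \<partial>chain)"
      by (rule nn_integral_cong) (simp add: component_in_space sets_R)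
    also have "\<dots> = (\<integral>\<^sup>+x. emeasure (R x) A \<partial>distr chain \<nu> (\<lambda>X. X n))"
      by (rule nn_integral_distr[OF component_measurable, symmetric]) measurable
    also have "\<dots> = (\<integral>\<^sup>+x. emeasure (R x) A \<partial>\<pi>)"
      unfolding Suc.IH ..
    also have "\<dots> = emeasure (\<pi> \<bind> R) A"
      using not_empty by (intro emeasure_bind[symmetric, where N=\<nu>]) auto
    finally show "emeasure (distr chain \<nu> (\<lambda>X. X (Suc n))) A = emeasure \<pi> A"
      by (simp add: bind_pi_R)
  qed simp
qed

lemma distr_chain_pair: "distr chain (\<nu> \<Otimes>\<^sub>M \<nu>) (\<lambda>X. (X n, X (Suc n))) = joint"
proof (rule measure_eqI)
  fix A assume "A \<in> sets (distr chain (\<nu> \<Otimes>\<^sub>M \<nu>) (\<lambda>X. (X n, X (Suc n))))"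
  then have A [measurable]: "A \<in> sets (\<nu> \<Otimes>\<^sub>M \<nu>)" by simp
  have "emeasure (distr chain (\<nu> \<Otimes>\<^sub>M \<nu>) (\<lambda>X. (X n, X (Suc n)))) A =
      (\<integral>\<^sup>+z. indicator A z \<partial>distr chain (\<nu> \<Otimes>\<^sub>M \<nu>) (\<lambda>X. (X n, X (Suc n))))"
    by simp
  also have "\<dots> = (\<integral>\<^sup>+X. indicator A (X n, X (Suc n)) \<partial>chain)"
    by (rule nn_integral_distr[OF pair_measurable]) measurable
  also have "\<dots> = (\<integral>\<^sup>+X. indicator A (restrict X {0..<Suc (Suc n)} n, restrict X {0..<Suc (Suc n)} (Suc n)) \<partial>chain)"
    by simp
  also have "\<dots> = (\<integral>\<^sup>+X. \<integral>\<^sup>+y. indicator A (X n, y) \<partial>R (X n) \<partial>chain)"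
    by (subst nn_integral_chain_step[where F="\<lambda>X. indicator A (X n, X (Suc n))"])
       (measurable, simp_all add: chain_step_def)
  also have "\<dots> = (\<integral>\<^sup>+x. \<integral>\<^sup>+y. indicator A (x, y) \<partial>R x \<partial>\<pi>)"
  proof -
    have [measurable]: "(\<lambda>x. \<integral>\<^sup>+y. indicator A (x, y) \<partial>R x) \<in> borel_measurable \<nu>"
      by (rule nn_integral_measurable_subprob_algebra2[OF _ R_measurable]) (simp add: split_beta')
    have "(\<integral>\<^sup>+X. \<integral>\<^sup>+y. indicator A (X n, y) \<partial>R (X n) \<partial>chain) =
        (\<integral>\<^sup>+x. \<integral>\<^sup>+y. indicator A (x, y) \<partial>R x \<partial>distr chain \<nu> (\<lambda>X. X n))"
      by (rule nn_integral_distr[OF component_measurable, of "\<lambda>x. \<integral>\<^sup>+y. indicator A (x, y) \<partial>R x", symmetric]) measurable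
    then show ?thesis unfolding distr_chain_component .
  qed
  also have "\<dots> = (\<integral>\<^sup>+z. indicator A z \<partial>joint)" by (rule nn_integral_joint[symmetric]) simp
  also have "\<dots> = emeasure joint A" by simp
  finally show "emeasure (distr chain (\<nu> \<Otimes>\<^sub>M \<nu>) (\<lambda>X. (X n, X (Suc n)))) A = emeasure joint A" .
qed simp

lemma integral_chain_component:
  "h \<in> borel_measurable \<nu> \<Longrightarrow> (\<integral>X. (h (X n) :: real) \<partial>chain) = (\<integral>x. h x \<partial>\<pi>)"
  using integral_distr[of "\<lambda>X. X n" chain \<nu> h] by (simp add: distr_chain_component)

lemma integrable_chain_component:
  "integrable \<pi> (h :: 'a \<Rightarrow> real) \<Longrightarrow> integrable chain (\<lambda>X. h (X n))"
  using integrable_distr_eq[of "\<lambda>X. X n" chain \<nu> h] integrable_measurable_nu[of h]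
  by (simp add: distr_chain_component)

lemma L2_chain_component: "L2 \<pi> h \<Longrightarrow> L2 chain (\<lambda>X. h (X n))"
  using L2_distr_iff[of "\<lambda>X. X n" chain \<nu> h] L2_measurable_nu[of h]
  by (simp add: distr_chain_component)

lemma norm2_chain_component: "h \<in> borel_measurable \<nu> \<Longrightarrow> norm2 chain (\<lambda>X. h (X n)) = norm2 \<pi> h"
  using norm2_distr[of "\<lambda>X. X n" chain \<nu> h] by (simp add: distr_chain_component)

lemma AE_chain_component:
  assumes "AE x in \<pi>. P x" shows "AE X in chain. P (X n)"
  using AE_distrD[OF component_measurable, of P n] assms unfolding distr_chain_component by blast

lemma integral_chain_pair:
  "h \<in> borel_measurable (\<nu> \<Otimes>\<^sub>M \<nu>) \<Longrightarrow> (\<integral>X. (h (X n, X (Suc n)) :: real) \<partial>chain) = (\<integral>z. h z \<partial>joint)"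
  using integral_distr[of "\<lambda>X. (X n, X (Suc n))" chain "\<nu> \<Otimes>\<^sub>M \<nu>" h]
  by (simp add: distr_chain_pair)

text \<open>
  A random variable is a function of the whole path; that it depends on the states up to time \<open>n\<close>
  only is expressed by its invariance under restriction of the path.
\<close>

definition adapted :: "nat \<Rightarrow> ((nat \<Rightarrow> 'a) \<Rightarrow> real) \<Rightarrow> bool" where
  "adapted n G \<longleftrightarrow> G \<in> borel_measurable (PiM {0..<Suc n} (\<lambda>_. \<nu>)) \<and>
    (\<forall>X. G (restrict X {0..<Suc n}) = G X)"

lemma adapted_measurable: "adapted n G \<Longrightarrow> G \<in> borel_measurable chain"
  using measurable_compose[OF restrict_measurable[of "Suc n"], of G borel] by (simp add: adapted_def)

lemma markov_property:
  assumes G: "adapted n G" and h [measurable]: "h \<in> borel_measurable \<nu>"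
    and int: "integrable chain (\<lambda>X. G X * h (X (Suc n)))"
  shows "(\<integral>X. G X * h (X (Suc n)) \<partial>chain) = (\<integral>X. G X * op h (X n) \<partial>chain)"
proof -
  define F where "F X = G (restrict X {0..<Suc n}) * h (X (Suc n))" for X
  have [measurable]: "G \<in> borel_measurable (PiM {0..<Suc n} (\<lambda>_. \<nu>))" using G by (simp add: adapted_def)
  have Gr: "G (restrict X {0..<Suc n}) = G X" for X using G by (simp add: adapted_def)
  have "(\<lambda>X. restrict X {0..<Suc n}) \<in> PiM {0..<Suc (Suc n)} (\<lambda>_. \<nu>) \<rightarrow>\<^sub>M PiM {0..<Suc n} (\<lambda>_. \<nu>)"
    by (rule measurable_restrict_subset) auto
  note [measurable] = this
  have F: "F \<in> borel_measurable (PiM {0..<Suc (Suc n)} (\<lambda>_. \<nu>))"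
    unfolding F_def[abs_def] by measurable
  have FG: "F (restrict X {0..<Suc (Suc n)}) = G X * h (X (Suc n))" for X
    unfolding F_def Gr
    using Gr[of "restrict X {0..<Suc (Suc n)}"] Gr[of X]
    by (simp add: restrict_restrict Int_absorb1 Int_absorb2 min_def)
  have FU: "F (fun_upd (restrict X {0..<Suc n}) (Suc n) y) = G X * h y" for X y
  proof -
    have "restrict (fun_upd (restrict X {0..<Suc n}) (Suc n) y) {0..<Suc n} = restrict X {0..<Suc n}"
      by (auto simp: fun_eq_iff restrict_def)
    then show ?thesis by (simp add: F_def Gr)
  qed
  have "(\<integral>X. G X * h (X (Suc n)) \<partial>chain) = (\<integral>X. \<integral>y. G X * h y \<partial>R (X n) \<partial>chain)"
    using integral_chain_step[OF F] int unfolding FG FU by (simp add: chain_step_def)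
  then show ?thesis by (simp add: op_def)
qed

lemma adapted_component: "h \<in> borel_measurable \<nu> \<Longrightarrow> i \<le> n \<Longrightarrow> adapted n (\<lambda>X. h (X i))"
  unfolding adapted_def
  by (auto intro!: measurable_compose[OF measurable_component_singleton])

lemma adapted_const: "adapted n (\<lambda>_. c)"
  unfolding adapted_def by simp

lemma adapted_compose:
  assumes [measurable]: "adapted n G" "g \<in> borel_measurable borel" shows "adapted n (\<lambda>X. g (G X))"
  using assms unfolding adapted_def by (auto intro: measurable_compose)

lemma adapted_binary:
  assumes "adapted n G" "adapted n H"
  shows "adapted n (\<lambda>X. G X + H X)" "adapted n (\<lambda>X. G X - H X)" "adapted n (\<lambda>X. G X * H X)"
  using assms unfolding adapted_def by auto

lemma adapted_sum: "(\<And>i. i \<in> I \<Longrightarrow> adapted n (G i)) \<Longrightarrow> adapted n (\<lambda>X. \<Sum>i\<in>I. G i X)"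
  by (induction I rule: infinite_finite_induct) (auto intro: adapted_binary adapted_const)

end

section \<open>Martingale decomposition of path sums\<close>

context reversible_kernel
begin

definition path_sum :: "('a \<Rightarrow> real) \<Rightarrow> nat \<Rightarrow> (nat \<Rightarrow> 'a) \<Rightarrow> real" where
  "path_sum h n X = (\<Sum>i<n. h (X i))"

text \<open>
  The increment \<open>u (X (n + 1)) - E (u (X (n + 1)) | X n)\<close>.
\<close>

definition mart_step :: "('a \<Rightarrow> real) \<Rightarrow> 'a \<times> 'a \<Rightarrow> real" where
  "mart_step u z = u (snd z) - op u (fst z)"

definition mart :: "('a \<Rightarrow> real) \<Rightarrow> nat \<Rightarrow> (nat \<Rightarrow> 'a) \<Rightarrow> real" where
  "mart u n X = (\<Sum>i<n. mart_step u (X i, X (Suc i)))"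

definition mart_var :: "('a \<Rightarrow> real) \<Rightarrow> real" where
  "mart_var u = (norm2 \<pi> u)\<^sup>2 - (norm2 \<pi> (op u))\<^sup>2"

lemma mart_step_measurable [measurable]:
  assumes [measurable]: "u \<in> borel_measurable \<nu>"
  shows "mart_step u \<in> borel_measurable (\<nu> \<Otimes>\<^sub>M \<nu>)"
  unfolding mart_step_def[abs_def] by measurable

lemma path_sum_L2: "L2 \<pi> h \<Longrightarrow> L2 chain (path_sum h n)"
  unfolding path_sum_def[abs_def] by (intro L2_sum L2_chain_component)

lemma norm2_path_sum_le:
  assumes h: "L2 \<pi> h"
  shows "norm2 chain (path_sum h n) \<le> real n * norm2 \<pi> h"
proof -
  have "norm2 chain (path_sum h n) \<le> (\<Sum>i<n. norm2 chain (\<lambda>X. h (X i)))"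
    unfolding path_sum_def[abs_def] by (intro norm2_sum L2_chain_component h) simp
  also have "\<dots> = real n * norm2 \<pi> h"
    using norm2_chain_component[OF L2_measurable_nu[OF h]] by simp
  finally show ?thesis .
qed

lemma mart_step_L2_joint:
  assumes u: "L2 \<pi> u" shows "L2 joint (mart_step u)"
  unfolding mart_step_def[abs_def]
  by (intro L2_diff L2_joint_snd L2_joint_fst[where h="op u"] op_L2 u)

lemma mart_step_L2: "L2 \<pi> u \<Longrightarrow> L2 chain (\<lambda>X. mart_step u (X i, X (Suc i)))"
  unfolding mart_step_def
  by (auto intro!: L2_diff L2_chain_component op_L2)

lemma mart_L2: "L2 \<pi> u \<Longrightarrow> L2 chain (mart u n)"
  unfolding mart_def[abs_def] by (intro L2_sum mart_step_L2)

lemma mart_step_square: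
  assumes u: "L2 \<pi> u"
  shows "(\<integral>z. (mart_step u z)\<^sup>2 \<partial>joint) = mart_var u"
proof -
  have [measurable]: "u \<in> borel_measurable \<nu>" using u by measurable
  have "(\<integral>z. (mart_step u z)\<^sup>2 \<partial>joint) =
      (\<integral>z. (u (snd z))\<^sup>2 \<partial>joint) - 2 * (\<integral>z. u (snd z) * op u (fst z) \<partial>joint) + (\<integral>z. (op u (fst z))\<^sup>2 \<partial>joint)"
    unfolding mart_step_def
    by (rule integral_square_diff[OF L2_joint_snd[OF u] L2_joint_fst[OF op_L2[OF u]]])
  moreover have "(\<integral>z. (u (snd z))\<^sup>2 \<partial>joint) = (norm2 \<pi> u)\<^sup>2"
    using integral_distr[of snd joint \<nu> "\<lambda>x. (u x)\<^sup>2"] by (simp add: norm2_power2 distr_joint_snd)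
  moreover have "(\<integral>z. (op u (fst z))\<^sup>2 \<partial>joint) = (norm2 \<pi> (op u))\<^sup>2"
    using integral_distr[of fst joint \<nu> "\<lambda>x. (op u x)\<^sup>2"] by (simp add: norm2_power2 distr_joint_fst)
  moreover have "(\<integral>z. u (snd z) * op u (fst z) \<partial>joint) = (norm2 \<pi> (op u))\<^sup>2"
    using integral_joint_mult[OF op_L2[OF u] u] unfolding norm2_power2
    by (simp add: mult.commute power2_eq_square)
  ultimately show ?thesis by (simp add: mart_var_def)
qed

lemma mart_var_nonneg: "L2 \<pi> u \<Longrightarrow> 0 \<le> mart_var u"
  by (simp add: mart_step_square[symmetric])

lemma mart_step_square_chain:
  assumes u: "L2 \<pi> u"
  shows "(\<integral>X. (mart_step u (X i, X (Suc i)))\<^sup>2 \<partial>chain) = mart_var u"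
proof -
  have [measurable]: "u \<in> borel_measurable \<nu>" using u by measurable
  have "(\<lambda>z. (mart_step u z)\<^sup>2) \<in> borel_measurable (\<nu> \<Otimes>\<^sub>M \<nu>)" by measurable
  from integral_chain_pair[OF this] show ?thesis by (simp add: mart_step_square u)
qed

lemma adapted_mart:
  assumes u: "u \<in> borel_measurable \<nu>" shows "adapted n (mart u n)"
  unfolding mart_def[abs_def] mart_step_def fst_conv snd_conv using u
  by (intro adapted_sum adapted_binary adapted_component) auto

lemma integral_adapted_mart_step:
  assumes u: "L2 \<pi> u" and G: "adapted n G" and GL: "L2 chain G"
  shows "(\<integral>X. G X * mart_step u (X n, X (Suc n)) \<partial>chain) = 0"
proof -
  have [measurable]: "u \<in> borel_measurable \<nu>" using u by measurable
  have i: "integrable chain (\<lambda>X. G X * u (X (Suc n)))" "integrable chain (\<lambda>X. G X * op u (X n))"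
    by (intro L2_mult_integrable GL L2_chain_component u op_L2)+
  have "(\<integral>X. G X * mart_step u (X n, X (Suc n)) \<partial>chain) =
      (\<integral>X. G X * u (X (Suc n)) \<partial>chain) - (\<integral>X. G X * op u (X n) \<partial>chain)"
    using i by (simp add: mart_step_def right_diff_distrib)
  then show ?thesis using markov_property[OF G _ i(1)] by simp
qed

text \<open>
  The new increment is orthogonal to everything that depends on the earlier states.
\<close>

lemma mart_square:
  assumes u: "L2 \<pi> u"
  shows "(\<integral>X. (mart u n X)\<^sup>2 \<partial>chain) = real n * mart_var u"
proof (induction n)
  case 0 then show ?case by (simp add: mart_def)
next
  case (Suc n)
  have [measurable]: "u \<in> borel_measurable \<nu>" using u by measurable
  have "(\<integral>X. (mart u (Suc n) X)\<^sup>2 \<partial>chain) =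
      (\<integral>X. (mart u n X + mart_step u (X n, X (Suc n)))\<^sup>2 \<partial>chain)"
    by (simp add: mart_def)
  also have "\<dots> = real n * mart_var u + mart_var u"
    unfolding integral_square_add[OF mart_L2[OF u] mart_step_L2[OF u]] Suc.IH mart_step_square_chain[OF u]
    using integral_adapted_mart_step[OF u adapted_mart mart_L2[OF u]] by simp
  finally show ?case by (simp add: algebra_simps)
qed

lemma norm2_mart: "L2 \<pi> u \<Longrightarrow> norm2 chain (mart u n) = sqrt (real n) * sqrt (mart_var u)"
  by (simp add: norm2_def mart_square real_sqrt_mult)

lemma mart_var_le_dirichlet:
  assumes u: "L2 \<pi> u" shows "mart_var u \<le> 2 * dirichlet u"
proof -
  have "0 \<le> (\<integral>x. (u x - op u x)\<^sup>2 \<partial>\<pi>)" by simp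
  then show ?thesis
    unfolding integral_square_diff[OF u op_L2[OF u]] by (simp add: mart_var_def dirichlet_def norm2_power2)
qed

text \<open>
  Write \<open>g = (w - op w) + mu * w\<close> and replace \<open>w - op w\<close> at time \<open>i\<close> by
  \<open>w (X i) - w (X (i + 1))\<close> plus a martingale increment.
\<close>

lemma path_sum_mart_decomp:
  assumes w: "resolvent_eq g mu w"
  shows "AE X in chain. path_sum g n X = mart w n X + (w (X 0) - w (X n)) + mu * path_sum w n X"
proof -
  have "AE X in chain. \<forall>i. g (X i) = (1 + mu) * w (X i) - op w (X i)"
    unfolding AE_all_countable
    using AE_chain_component[OF w[unfolded resolvent_eq_def, THEN conjunct2]] by blast
  then show ?thesis
  proof eventually_elim
    case (elim X)
    show ?case
    proof (induction n)
      case (Suc n)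
      have "path_sum g (Suc n) X = path_sum g n X + ((1 + mu) * w (X n) - op w (X n))"
        using elim by (simp add: path_sum_def)
      then show ?case unfolding Suc.IH
        by (simp add: path_sum_def mart_def mart_step_def algebra_simps)
    qed (simp add: path_sum_def mart_def)
  qed
qed

text \<open>
  The choice \<open>mu = 1 / n\<close> balances the three terms of the decomposition: with \<open>c = \<langle>g, w\<rangle>\<close>, both
  \<open>n * mart_var w\<close> and \<open>\<parallel>w\<parallel>\<^sup>2\<close> are at most a multiple of \<open>n * c\<close>. The factor is \<open>5 = 2 + 2 + 1\<close>, for the martingale,
  the two boundary values and the path sum of \<open>mu * w\<close>.
\<close>

lemma norm2_path_sum_resolvent:
  assumes g: "L2 \<pi> g" and w: "resolvent_eq g mu w" and mu: "mu = 1 / real n" and n: "0 < n"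
  shows "norm2 chain (path_sum g n) \<le> 5 * sqrt (real n * (ip g w))"
proof -
  define c where "c = (ip g w)"
  have gm: "g \<in> borel_measurable \<nu>" using g by measurable
  note wL = resolvent_eq_L2[OF w]
  have wm [measurable]: "w \<in> borel_measurable \<nu>" using wL by measurable
  have mu0: "0 < mu" and nmu: "real n * mu = 1" using mu n by auto
  have c: "c = mu * (norm2 \<pi> w)\<^sup>2 + dirichlet w"
    unfolding c_def by (rule resolvent_eq_energy[OF gm w])
  have D: "0 \<le> dirichlet w" by (rule dirichlet_nonneg[OF wL])
  have D': "dirichlet w \<le> c" using c mu0 by simp
  have c0: "0 \<le> c" using D D' by simp
  have "mu * (norm2 \<pi> w)\<^sup>2 \<le> c" using c D by simp
  then have "real n * (mu * (norm2 \<pi> w)\<^sup>2) \<le> real n * c" by (intro mult_left_mono) auto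
  then have "(norm2 \<pi> w)\<^sup>2 \<le> real n * c" using nmu by (simp flip: mult.assoc)
  then have nw: "norm2 \<pi> w \<le> sqrt (real n * c)" by (rule real_le_rsqrt)
  have mw: "norm2 chain (mart w n) \<le> 2 * sqrt (real n * c)"
  proof -
    have "norm2 chain (mart w n) = sqrt (real n * mart_var w)"
      by (simp add: norm2_mart[OF wL] real_sqrt_mult)
    also have "\<dots> \<le> sqrt (2\<^sup>2 * (real n * c))"
      using mart_var_le_dirichlet[OF wL] D' c0 by (intro real_sqrt_le_mono) (auto simp: mult.left_commute intro!: mult_left_mono)
    also have "\<dots> = 2 * sqrt (real n * c)" by (simp only: real_sqrt_mult) simp
    finally show ?thesis .
  qed
  note L = mart_L2[OF wL] L2_diff[OF L2_chain_component[OF wL] L2_chain_component[OF wL]]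
    L2_cmult[OF path_sum_L2[OF wL]]
  have [measurable]: "path_sum g n \<in> borel_measurable chain" "mart w n \<in> borel_measurable chain"
     "path_sum w n \<in> borel_measurable chain"
    using path_sum_L2[OF g] mart_L2[OF wL] path_sum_L2[OF wL] by measurable
  have "norm2 chain (path_sum g n) = norm2 chain (\<lambda>X. mart w n X + (w (X 0) - w (X n)) + mu * path_sum w n X)"
    by (rule norm2_cong_AE[OF _ _ path_sum_mart_decomp[OF w]]) measurable
  also have "\<dots> \<le> norm2 chain (\<lambda>X. mart w n X + (w (X 0) - w (X n))) + norm2 chain (\<lambda>X. mu * path_sum w n X)"
    by (intro norm2_triangle L2_add L)
  also have "\<dots> \<le> norm2 chain (mart w n) + norm2 chain (\<lambda>X. w (X 0) - w (X n)) + norm2 chain (\<lambda>X. mu * path_sum w n X)"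
    by (intro add_right_mono norm2_triangle L)
  also have "norm2 chain (\<lambda>X. w (X 0) - w (X n)) \<le> norm2 \<pi> w + norm2 \<pi> w"
    using norm2_triangle_diff[OF L2_chain_component[OF wL, of 0] L2_chain_component[OF wL, of n]]
    by (simp add: norm2_chain_component)
  also have "norm2 chain (\<lambda>X. mu * path_sum w n X) \<le> norm2 \<pi> w"
  proof -
    have "norm2 chain (\<lambda>X. mu * path_sum w n X) = mu * norm2 chain (path_sum w n)"
      using mu0 by (simp add: norm2_cmult)
    also have "\<dots> \<le> mu * (real n * norm2 \<pi> w)"
      using mu0 norm2_path_sum_le[OF wL] by (intro mult_left_mono) auto
    also have "\<dots> = norm2 \<pi> w" using nmu by (simp flip: mult.assoc add: mult.commute)
    finally show ?thesis .
  qed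
  finally show ?thesis using nw mw unfolding c_def by simp
qed

end

section \<open>A martingale central limit theorem\<close>

lemma integrable_bounded_mult:
  fixes G :: "'b \<Rightarrow> complex" and F :: "'b \<Rightarrow> real"
  assumes F: "integrable M F" and [measurable]: "G \<in> borel_measurable M" and G: "\<And>x. cmod (G x) \<le> 1"
  shows "integrable M (\<lambda>x. G x * of_real (F x))"
    and "cmod (\<integral>x. G x * of_real (F x) \<partial>M) \<le> (\<integral>x. \<bar>F x\<bar> \<partial>M)"
proof -
  have [measurable]: "F \<in> borel_measurable M" using F by measurable
  have le: "cmod (G x * of_real (F x)) \<le> \<bar>F x\<bar>" for x
    using mult_right_mono[OF G, of "\<bar>F x\<bar>" x] by (simp add: norm_mult)
  show i: "integrable M (\<lambda>x. G x * of_real (F x))"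
    by (rule Bochner_Integration.integrable_bound[OF integrable_abs[OF F]]) (measurable, use le in auto)
  show "cmod (\<integral>x. G x * of_real (F x) \<partial>M) \<le> (\<integral>x. \<bar>F x\<bar> \<partial>M)"
    using F i le by (intro order_trans[OF integral_norm_bound] integral_mono) auto
qed

text \<open>
  The minimum of the second and third order Taylor bounds. Only second moments are available, so
  the cubic bound has to be cut off by a quadratic one.
\<close>

lemma iexp_approx_quadratic:
  "cmod (iexp x - (1 + \<i> * x - x\<^sup>2 / 2)) \<le> min (6 * x\<^sup>2) (\<bar>x\<bar> ^ 3) / 6"
proof -
  have eq: "(\<Sum>k\<le>2. (\<i> * of_real x) ^ k / fact k) = 1 + \<i> * x - x\<^sup>2 / 2"
    by (simp add: numeral_eq_Suc power_mult_distrib)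
  show ?thesis
    using iexp_approx1[of x 2] iexp_approx2[of x 2] unfolding eq by (simp add: eval_nat_numeral min_def)
qed

context reversible_kernel
begin

text \<open>
  Every integrable function is, up to a small error, its mean plus a coboundary. Along a path the
  coboundary telescopes, so this does the work of an ergodic theorem without requiring one.
\<close>

definition poisson_ergodic :: bool where
  "poisson_ergodic \<longleftrightarrow> (\<forall>g e. integrable \<pi> g \<longrightarrow> 0 < e \<longrightarrow>
    (\<exists>h. L2 \<pi> h \<and> (\<integral>x. \<bar>g x - (\<integral>y. g y \<partial>\<pi>) - (h x - op h x)\<bar> \<partial>\<pi>) \<le> e))"

definition mart_char :: "('a \<Rightarrow> real) \<Rightarrow> real \<Rightarrow> nat \<Rightarrow> (nat \<Rightarrow> 'a) \<Rightarrow> complex" where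
  "mart_char u s n X = iexp (s * mart u n X)"

text \<open>
  The conditional variance of the martingale increment given the present state.
\<close>

definition cond_var :: "('a \<Rightarrow> real) \<Rightarrow> 'a \<Rightarrow> real" where
  "cond_var u x = op (\<lambda>y. (u y)\<^sup>2) x - (op u x)\<^sup>2"

lemma norm_mart_char [simp]: "cmod (mart_char u s n X) = 1"
  by (simp add: mart_char_def)

lemma mart_char_measurable [measurable]:
  assumes u: "u \<in> borel_measurable \<nu>" shows "mart_char u s n \<in> borel_measurable chain"
  using adapted_measurable[OF adapted_mart[OF u, of n]] unfolding mart_char_def[abs_def] by measurable

text \<open>
  The real and imaginary parts of \<open>mart_char\<close> are bounded adapted weights, so identities between
  weighted expectations can be checked in real terms.
\<close>

lemma integral_mart_char_cong:
  assumes u: "u \<in> borel_measurable \<nu>" and F: "integrable chain F1" "integrable chain F2"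
    and eq: "\<And>G. adapted n G \<Longrightarrow> (\<And>X. \<bar>G X\<bar> \<le> 1) \<Longrightarrow>
      (\<integral>X. G X * F1 X \<partial>chain) = (\<integral>X. G X * F2 X \<partial>chain)"
  shows "(\<integral>X. mart_char u s n X * of_real (F1 X) \<partial>chain) = (\<integral>X. mart_char u s n X * of_real (F2 X) \<partial>chain)"
proof -
  note ad = adapted_mart[OF u, of n]
  have G: "adapted n (\<lambda>X. cos (s * mart u n X))" "adapted n (\<lambda>X. sin (s * mart u n X))"
    using adapted_compose[OF ad, of "\<lambda>x. cos (s * x)"] adapted_compose[OF ad, of "\<lambda>x. sin (s * x)"] by auto
  note i = integrable_bounded_mult(1)[OF F(1) mart_char_measurable[OF u, of s n]]
    integrable_bounded_mult(1)[OF F(2) mart_char_measurable[OF u, of s n]]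
  have "(\<integral>X. cos (s * mart u n X) * F1 X \<partial>chain) = (\<integral>X. cos (s * mart u n X) * F2 X \<partial>chain)"
    by (rule eq[OF G(1)]) simp
  moreover have "(\<integral>X. sin (s * mart u n X) * F1 X \<partial>chain) = (\<integral>X. sin (s * mart u n X) * F2 X \<partial>chain)"
    by (rule eq[OF G(2)]) simp
  ultimately show ?thesis
    using i by (simp add: complex_eq_iff integral_Re[symmetric] integral_Im[symmetric] mart_char_def Re_exp Im_exp
        del: integral_Re integral_Im)
qed

lemma cond_var_integrable: "L2 \<pi> u \<Longrightarrow> integrable \<pi> (cond_var u)"
  unfolding cond_var_def
  by (intro Bochner_Integration.integrable_diff op_integrable L2_square_integrable op_L2)

lemma cond_var_measurable [measurable]:
  assumes [measurable]: "u \<in> borel_measurable \<nu>" shows "cond_var u \<in> borel_measurable \<nu>"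
  unfolding cond_var_def[abs_def] by measurable

lemma integral_cond_var: "L2 \<pi> u \<Longrightarrow> (\<integral>x. cond_var u x \<partial>\<pi>) = mart_var u"
  unfolding cond_var_def mart_var_def norm2_power2
  using integral_op[OF L2_square_integrable, of u] op_integrable[OF L2_square_integrable, of u]
    L2_square_integrable[OF op_L2, of u]
  by simp

lemma integral_adapted_mart_step_square:
  assumes u: "L2 \<pi> u" and G: "adapted n G" and bd: "\<And>X. \<bar>G X\<bar> \<le> 1"
  shows "(\<integral>X. G X * (mart_step u (X n, X (Suc n)))\<^sup>2 \<partial>chain) = (\<integral>X. G X * cond_var u (X n) \<partial>chain)"
proof -
  have um [measurable]: "u \<in> borel_measurable \<nu>" using u by measurable
  have Gm [measurable]: "G \<in> borel_measurable chain" by (rule adapted_measurable[OF G])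
  have int: "integrable chain (\<lambda>X. G X * F X)" if "integrable chain F" for F
  proof (rule Bochner_Integration.integrable_bound[OF integrable_abs[OF that]])
    show "AE X in chain. norm (G X * F X) \<le> norm \<bar>F X\<bar>"
      using mult_right_mono[OF bd] by (auto simp: abs_mult)
  qed (use that in measurable)
  have u2: "integrable chain (\<lambda>X. (u (X (Suc n)))\<^sup>2)"
    by (rule L2_square_integrable[OF L2_chain_component[OF u]])
  have uo: "integrable chain (\<lambda>X. op u (X n) * u (X (Suc n)))"
    by (intro L2_mult_integrable L2_chain_component u op_L2)
  have oo: "integrable chain (\<lambda>X. op u (X n) * op u (X n))"
    by (intro L2_mult_integrable L2_chain_component u op_L2)
  have o2: "integrable chain (\<lambda>X. op (\<lambda>y. (u y)\<^sup>2) (X n))"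
    by (rule integrable_chain_component[OF op_integrable[OF L2_square_integrable[OF u]]])
  have "(\<integral>X. G X * (mart_step u (X n, X (Suc n)))\<^sup>2 \<partial>chain) =
     (\<integral>X. G X * (u (X (Suc n)))\<^sup>2 - 2 * (G X * (op u (X n) * u (X (Suc n)))) + G X * (op u (X n) * op u (X n)) \<partial>chain)"
    by (rule Bochner_Integration.integral_cong) (auto simp: mart_step_def power2_eq_square algebra_simps)
  also have "\<dots> = (\<integral>X. G X * (u (X (Suc n)))\<^sup>2 \<partial>chain) - 2 * (\<integral>X. (G X * op u (X n)) * u (X (Suc n)) \<partial>chain)
      + (\<integral>X. G X * (op u (X n) * op u (X n)) \<partial>chain)"
    using int[OF u2] int[OF uo] int[OF oo] by (simp add: mult.assoc)
  also have "(\<integral>X. G X * (u (X (Suc n)))\<^sup>2 \<partial>chain) = (\<integral>X. G X * op (\<lambda>y. (u y)\<^sup>2) (X n) \<partial>chain)"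
    using int[OF u2] by (intro markov_property[OF G]) auto
  also have "(\<integral>X. (G X * op u (X n)) * u (X (Suc n)) \<partial>chain) = (\<integral>X. (G X * op u (X n)) * op u (X n) \<partial>chain)"
    using int[OF uo] by (intro markov_property[OF adapted_binary(3)[OF G adapted_component]]) (auto simp: mult.assoc)
  also have "(\<integral>X. G X * op (\<lambda>y. (u y)\<^sup>2) (X n) \<partial>chain) - 2 * (\<integral>X. (G X * op u (X n)) * op u (X n) \<partial>chain)
      + (\<integral>X. G X * (op u (X n) * op u (X n)) \<partial>chain) =
     (\<integral>X. G X * op (\<lambda>y. (u y)\<^sup>2) (X n) - G X * (op u (X n) * op u (X n)) \<partial>chain)"
    using int[OF oo] int[OF o2] by (simp add: mult.assoc)
  also have "\<dots> = (\<integral>X. G X * cond_var u (X n) \<partial>chain)"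
    by (rule Bochner_Integration.integral_cong) (auto simp: cond_var_def power2_eq_square right_diff_distrib)
  finally show ?thesis .
qed

text \<open>
  Stationarity makes the Taylor error the same for all increments.
\<close>

definition lindeberg :: "('a \<Rightarrow> real) \<Rightarrow> real \<Rightarrow> real" where
  "lindeberg u s = (\<integral>z. min (6 * (mart_step u z)\<^sup>2) (\<bar>s\<bar> * \<bar>mart_step u z\<bar> ^ 3) \<partial>joint)"

lemma lindeberg_tendsto_0:
  assumes u: "L2 \<pi> u" and s: "s \<longlonglongrightarrow> 0"
  shows "(\<lambda>n. lindeberg u (s n)) \<longlonglongrightarrow> 0"
proof -
  have um [measurable]: "u \<in> borel_measurable \<nu>" using u by measurable
  have "(\<lambda>n. lindeberg u (s n)) \<longlonglongrightarrow> (\<integral>z. 0 \<partial>joint)"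
    unfolding lindeberg_def
  proof (rule integral_dominated_convergence[where w="\<lambda>z. 6 * (mart_step u z)\<^sup>2"])
    show "integrable joint (\<lambda>z. 6 * (mart_step u z)\<^sup>2)"
      using L2_square_integrable[OF mart_step_L2_joint[OF u]] by simp
    have "(\<lambda>n. min (6 * a\<^sup>2) (\<bar>s n\<bar> * \<bar>a\<bar> ^ 3)) \<longlonglongrightarrow> min (6 * a\<^sup>2) (\<bar>0\<bar> * \<bar>a\<bar> ^ 3)" for a :: real
      by (intro tendsto_intros s)
    moreover have "min (6 * a\<^sup>2) (\<bar>0\<bar> * \<bar>a\<bar> ^ 3) = 0" for a :: real by (simp add: min_def)
    ultimately show "AE z in joint. (\<lambda>n. min (6 * (mart_step u z)\<^sup>2) (\<bar>s n\<bar> * \<bar>mart_step u z\<bar> ^ 3)) \<longlonglongrightarrow> 0"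
      by (intro AE_I2) (simp only:)
    show "AE z in joint. norm (min (6 * (mart_step u z)\<^sup>2) (\<bar>s n\<bar> * \<bar>mart_step u z\<bar> ^ 3)) \<le> 6 * (mart_step u z)\<^sup>2" for n
      by (auto simp: min_def)
  qed measurable
  then show ?thesis by simp
qed

text \<open>
  Expand the factor of the last increment to second order. The linear term has conditional
  mean zero, and the quadratic one has conditional mean \<open>cond_var\<close>.
\<close>

lemma mart_char_taylor:
  assumes u: "L2 \<pi> u"
  shows "cmod ((\<integral>X. mart_char u s (Suc n) X \<partial>chain) - (\<integral>X. mart_char u s n X \<partial>chain)
      + of_real (s\<^sup>2 / 2) * (\<integral>X. mart_char u s n X * of_real (cond_var u (X n)) \<partial>chain)) \<le> s\<^sup>2 * (lindeberg u s / 6)"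
proof -
  have um [measurable]: "u \<in> borel_measurable \<nu>" using u by measurable
  let ?D = "\<lambda>X. mart_step u (X n, X (Suc n))"
  let ?Z = "mart_char u s n"
  let ?q = "\<lambda>z. min (6 * (mart_step u z)\<^sup>2) (\<bar>s\<bar> * \<bar>mart_step u z\<bar> ^ 3)"
  have D [measurable]: "?D \<in> borel_measurable chain" using mart_step_L2[OF u] by measurable
  have iD: "integrable chain ?D" by (rule chain.L2_integrable[OF mart_step_L2[OF u]])
  have iD2: "integrable chain (\<lambda>X. (?D X)\<^sup>2)" by (rule L2_square_integrable[OF mart_step_L2[OF u]])
  have ic: "integrable chain (\<lambda>X. cond_var u (X n))"
    by (rule integrable_chain_component[OF cond_var_integrable[OF u]])
  note iZ = integrable_bounded_mult(1)[OF _ mart_char_measurable[OF um], of _ s n]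
  have iZ1: "integrable chain (mart_char u s m)" for m
    by (rule chain.integrable_const_bound[of _ 1]) auto
  have E1: "(\<integral>X. ?Z X * of_real (?D X) \<partial>chain) = (\<integral>X. ?Z X * of_real 0 \<partial>chain)"
  proof (rule integral_mart_char_cong[OF um iD])
    fix G assume G: "adapted n G" "\<And>X. \<bar>G X\<bar> \<le> 1"
    show "(\<integral>X. G X * ?D X \<partial>chain) = (\<integral>X. G X * 0 \<partial>chain)"
      using integral_adapted_mart_step[OF u G(1) chain.L2_bounded[OF adapted_measurable[OF G(1)] G(2)]] by simp
  qed simp
  have E2: "(\<integral>X. ?Z X * of_real ((?D X)\<^sup>2) \<partial>chain) = (\<integral>X. ?Z X * of_real (cond_var u (X n)) \<partial>chain)"
    by (rule integral_mart_char_cong[OF um iD2 ic integral_adapted_mart_step_square[OF u]])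
  have Zs: "mart_char u s (Suc n) X = ?Z X * iexp (s * ?D X)" for X
    by (simp add: mart_char_def mart_def distrib_left exp_add[symmetric])
  let ?r = "\<lambda>X. mart_char u s (Suc n) X - (?Z X + \<i> * s * (?Z X * of_real (?D X)) - of_real (s\<^sup>2 / 2) * (?Z X * of_real ((?D X)\<^sup>2)))"
  have ir: "integrable chain ?r"
    by (intro Bochner_Integration.integrable_diff Bochner_Integration.integrable_add integrable_mult_right iZ1 iZ iD iD2) auto
  have "(\<integral>X. ?r X \<partial>chain) = (\<integral>X. mart_char u s (Suc n) X \<partial>chain) - ((\<integral>X. ?Z X \<partial>chain)
      + \<i> * s * (\<integral>X. ?Z X * of_real (?D X) \<partial>chain) - of_real (s\<^sup>2 / 2) * (\<integral>X. ?Z X * of_real ((?D X)\<^sup>2) \<partial>chain))"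
    using iZ1 iZ[OF iD] iZ[OF iD2] by simp
  then have eq: "(\<integral>X. mart_char u s (Suc n) X \<partial>chain) - (\<integral>X. mart_char u s n X \<partial>chain)
      + of_real (s\<^sup>2 / 2) * (\<integral>X. mart_char u s n X * of_real (cond_var u (X n)) \<partial>chain) = (\<integral>X. ?r X \<partial>chain)"
    unfolding E1 E2 by simp
  have rle: "cmod (?r X) \<le> s\<^sup>2 / 6 * ?q (X n, X (Suc n))" for X
  proof -
    have "?r X = ?Z X * (iexp (s * ?D X) - (1 + \<i> * (s * ?D X) - (s * ?D X)\<^sup>2 / 2))"
      unfolding Zs by (simp add: algebra_simps power2_eq_square)
    then have "cmod (?r X) = cmod (iexp (s * ?D X) - (1 + \<i> * (s * ?D X) - (s * ?D X)\<^sup>2 / 2))"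
      by (simp only: norm_mult norm_mart_char mult_1)
    also have "\<dots> \<le> min (6 * (s * ?D X)\<^sup>2) (\<bar>s * ?D X\<bar> ^ 3) / 6"
      using iexp_approx_quadratic[of "s * ?D X"] by simp
    also have "min (6 * (s * ?D X)\<^sup>2) (\<bar>s * ?D X\<bar> ^ 3) = s\<^sup>2 * ?q (X n, X (Suc n))"
    proof -
      have "\<bar>s\<bar> ^ 3 = s\<^sup>2 * \<bar>s\<bar>"
        using power_add[of "\<bar>s\<bar>" 2 1] by simp
      then have "\<bar>s * ?D X\<bar> ^ 3 = s\<^sup>2 * (\<bar>s\<bar> * \<bar>?D X\<bar> ^ 3)" "6 * (s * ?D X)\<^sup>2 = s\<^sup>2 * (6 * (?D X)\<^sup>2)"
        by (simp_all add: abs_mult power_mult_distrib)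
      then show ?thesis by (simp only: min_mult_distrib_left zero_le_power2 if_True)
    qed
    finally show ?thesis by simp
  qed
  have qm: "?q \<in> borel_measurable (\<nu> \<Otimes>\<^sub>M \<nu>)" by measurable
  have iq: "integrable chain (\<lambda>X. ?q (X n, X (Suc n)))"
    using measurable_compose[OF pair_measurable qm, of n] iD2
    by (intro Bochner_Integration.integrable_bound[OF integrable_mult_right[of 6, OF iD2]]) (auto simp: min_def)
  have "cmod (\<integral>X. ?r X \<partial>chain) \<le> (\<integral>X. s\<^sup>2 / 6 * ?q (X n, X (Suc n)) \<partial>chain)"
    using ir iq rle
    by (intro order_trans[OF integral_norm_bound] integral_mono integrable_norm integrable_mult_right) auto
  also have "\<dots> = s\<^sup>2 / 6 * (\<integral>z. ?q z \<partial>joint)"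
    unfolding integral_mult_right_zero using integral_chain_pair[OF qm, of n] by simp
  finally show ?thesis unfolding eq by (simp add: lindeberg_def)
qed

text \<open>
  The correction removes the coboundary part of the conditional variance: \<open>h - op h\<close> contributes
  the difference of consecutive values of the correction, up to smaller terms. With it the
  characteristic function satisfies a recursion with constant coefficient.
\<close>

definition corrected_char :: "('a \<Rightarrow> real) \<Rightarrow> ('a \<Rightarrow> real) \<Rightarrow> real \<Rightarrow> nat \<Rightarrow> complex" where
  "corrected_char u h s n = (\<integral>X. mart_char u s n X \<partial>chain)
     - of_real (s\<^sup>2 / 2) * (\<integral>X. mart_char u s n X * of_real (h (X n)) \<partial>chain)"

definition coboundary_defect :: "('a \<Rightarrow> real) \<Rightarrow> ('a \<Rightarrow> real) \<Rightarrow> real" where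
  "coboundary_defect u h = (\<integral>x. \<bar>cond_var u x - mart_var u - (h x - op h x)\<bar> \<partial>\<pi>)"

lemma norm_mart_char_integral_le:
  assumes u: "L2 \<pi> u" and h: "L2 \<pi> h"
  shows "cmod (\<integral>X. mart_char u s n X * of_real (h (X n)) \<partial>chain) \<le> norm2 \<pi> h"
proof -
  have um [measurable]: "u \<in> borel_measurable \<nu>" using u by measurable
  have "cmod (\<integral>X. mart_char u s n X * of_real (h (X n)) \<partial>chain) \<le> (\<integral>X. \<bar>h (X n)\<bar> \<partial>chain)"
    by (intro integrable_bounded_mult(2) chain.L2_integrable L2_chain_component h) auto
  also have "\<dots> \<le> norm2 chain (\<lambda>X. h (X n))"
    by (rule chain.integral_abs_le_norm2[OF L2_chain_component[OF h]])
  finally show ?thesis using norm2_chain_component[OF L2_measurable_nu[OF h]] by simp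
qed

lemma mart_char_coboundary:
  assumes u: "L2 \<pi> u" and h: "L2 \<pi> h"
  shows "cmod ((\<integral>X. mart_char u s (Suc n) X * of_real (h (X (Suc n))) \<partial>chain)
      - (\<integral>X. mart_char u s n X * of_real (op h (X n)) \<partial>chain)) \<le> \<bar>s\<bar> * (sqrt (mart_var u) * norm2 \<pi> h)"
proof -
  have um [measurable]: "u \<in> borel_measurable \<nu>" and hm [measurable]: "h \<in> borel_measurable \<nu>"
    using u h by measurable
  let ?D = "\<lambda>X. mart_step u (X n, X (Suc n))"
  have ih: "integrable chain (\<lambda>X. h (X (Suc n)))" "integrable chain (\<lambda>X. op h (X n))"
    by (intro chain.L2_integrable L2_chain_component h op_L2)+
  have E: "(\<integral>X. mart_char u s n X * of_real (op h (X n)) \<partial>chain) = (\<integral>X. mart_char u s n X * of_real (h (X (Suc n))) \<partial>chain)"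
  proof (rule integral_mart_char_cong[OF um ih(2,1)])
    fix G assume G: "adapted n G" "\<And>X. \<bar>G X\<bar> \<le> 1"
    have "integrable chain (\<lambda>X. G X * h (X (Suc n)))"
      by (intro L2_mult_integrable chain.L2_bounded[OF adapted_measurable[OF G(1)] G(2)] L2_chain_component h)
    then show "(\<integral>X. G X * op h (X n) \<partial>chain) = (\<integral>X. G X * h (X (Suc n)) \<partial>chain)"
      using markov_property[OF G(1) hm] by simp
  qed
  have i: "integrable chain (\<lambda>X. mart_char u s m X * of_real (h (X (Suc n))))" for m
    by (rule integrable_bounded_mult(1)[OF ih(1)]) auto
  have iD: "integrable chain (\<lambda>X. ?D X * h (X (Suc n)))"
    by (intro L2_mult_integrable mart_step_L2 L2_chain_component u h)
  have le: "cmod (mart_char u s (Suc n) X * of_real (h (X (Suc n))) - mart_char u s n X * of_real (h (X (Suc n))))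
      \<le> \<bar>s\<bar> * \<bar>?D X * h (X (Suc n))\<bar>" for X
  proof -
    have "mart_char u s (Suc n) X = mart_char u s n X * iexp (s * ?D X)"
      by (simp add: mart_char_def mart_def distrib_left exp_add[symmetric])
    then have "mart_char u s (Suc n) X * of_real (h (X (Suc n))) - mart_char u s n X * of_real (h (X (Suc n)))
       = mart_char u s n X * ((iexp (s * ?D X) - 1) * of_real (h (X (Suc n))))"
      by (simp add: algebra_simps)
    then have "cmod (mart_char u s (Suc n) X * of_real (h (X (Suc n))) - mart_char u s n X * of_real (h (X (Suc n))))
      = cmod (iexp (s * ?D X) - 1) * \<bar>h (X (Suc n))\<bar>"
      by (simp only: norm_mult norm_mart_char mult_1 norm_of_real)
    also have "\<dots> \<le> \<bar>s * ?D X\<bar> * \<bar>h (X (Suc n))\<bar>"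
      using iexp_approx1[of "s * ?D X" 0] by (intro mult_right_mono) auto
    finally show ?thesis by (simp add: abs_mult)
  qed
  have "cmod ((\<integral>X. mart_char u s (Suc n) X * of_real (h (X (Suc n))) \<partial>chain)
      - (\<integral>X. mart_char u s n X * of_real (op h (X n)) \<partial>chain)) =
    cmod (\<integral>X. mart_char u s (Suc n) X * of_real (h (X (Suc n))) - mart_char u s n X * of_real (h (X (Suc n))) \<partial>chain)"
    unfolding E using i by simp
  also have "\<dots> \<le> (\<integral>X. \<bar>s\<bar> * \<bar>?D X * h (X (Suc n))\<bar> \<partial>chain)"
    using i iD le
    by (intro order_trans[OF integral_norm_bound] integral_mono integrable_norm integrable_mult_right integrable_abs
        Bochner_Integration.integrable_diff) auto
  also have "\<dots> \<le> \<bar>s\<bar> * (norm2 chain ?D * norm2 chain (\<lambda>X. h (X (Suc n))))"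
    using integral_abs_mult_le_norm2[OF mart_step_L2[OF u, of n] L2_chain_component[OF h, of "Suc n"]]
    by (simp add: mult_left_mono)
  also have "norm2 chain ?D = sqrt (mart_var u)"
    using mart_step_square_chain[OF u] by (simp add: norm2_def)
  finally show ?thesis by (simp add: norm2_chain_component)
qed

text \<open>
  Insert \<open>cond_var u = mart_var u + (h - op h) + rho\<close> into the Taylor expansion. The four summands on
  the right come from the correction being multiplied by the coefficient, from replacing \<open>op h\<close> by
  \<open>h\<close> one step later, from \<open>rho\<close>, and from the Taylor error.
\<close>

lemma corrected_char_step:
  assumes u: "L2 \<pi> u" and h: "L2 \<pi> h"
  shows "cmod (corrected_char u h s (Suc n) - of_real (1 - s\<^sup>2 * mart_var u / 2) * corrected_char u h s n) \<le>
    s\<^sup>2 * (mart_var u * s\<^sup>2 / 4 * norm2 \<pi> h + \<bar>s\<bar> * (sqrt (mart_var u) * norm2 \<pi> h) / 2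
      + coboundary_defect u h / 2 + lindeberg u s / 6)"
proof -
  have um [measurable]: "u \<in> borel_measurable \<nu>" and hm [measurable]: "h \<in> borel_measurable \<nu>"
    using u h by measurable
  let ?Z = "mart_char u s"
  define v where "v = mart_var u"
  define rho where "rho = (\<lambda>x. cond_var u x - v - (h x - op h x))"
  define z0 z1 where "z0 = (\<integral>X. ?Z n X \<partial>chain)" and "z1 = (\<integral>X. ?Z (Suc n) X \<partial>chain)"
  define c where "c = (\<integral>X. ?Z n X * of_real (cond_var u (X n)) \<partial>chain)"
  define a0 a1 where "a0 = (\<integral>X. ?Z n X * of_real (h (X n)) \<partial>chain)"
    and "a1 = (\<integral>X. ?Z (Suc n) X * of_real (h (X (Suc n))) \<partial>chain)"
  define o0 where "o0 = (\<integral>X. ?Z n X * of_real (op h (X n)) \<partial>chain)"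
  define r where "r = (\<integral>X. ?Z n X * of_real (rho (X n)) \<partial>chain)"
  have ih: "integrable chain (\<lambda>X. h (X n))" "integrable chain (\<lambda>X. op h (X n))"
    by (intro chain.L2_integrable L2_chain_component h op_L2)+
  have ic: "integrable chain (\<lambda>X. cond_var u (X n))"
    by (rule integrable_chain_component[OF cond_var_integrable[OF u]])
  have irho: "integrable \<pi> rho"
    unfolding rho_def
    by (intro Bochner_Integration.integrable_diff cond_var_integrable[OF u] integrable_const
        L2_integrable[OF h] L2_integrable[OF op_L2[OF h]])
  note iZ = integrable_bounded_mult(1)[OF _ mart_char_measurable[OF um], of _ s n]
  have iZ1: "integrable chain (mart_char u s n)"
    by (rule chain.integrable_const_bound[of _ 1]) auto
  have r_eq: "r = c - v * z0 - (a0 - o0)"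
  proof -
    have "r = (\<integral>X. ?Z n X * of_real (cond_var u (X n)) - v * ?Z n X
        - (?Z n X * of_real (h (X n)) - ?Z n X * of_real (op h (X n))) \<partial>chain)"
      unfolding r_def rho_def
      by (rule Bochner_Integration.integral_cong) (auto simp: algebra_simps)
    then show ?thesis
      using iZ[OF ih(1)] iZ[OF ih(2)] iZ[OF ic] iZ1 by (simp add: c_def z0_def a0_def o0_def)
  qed
  have 1: "cmod (z1 - z0 + of_real (s\<^sup>2 / 2) * c) \<le> s\<^sup>2 * (lindeberg u s / 6)"
    unfolding z1_def z0_def c_def by (rule mart_char_taylor[OF u])
  have 2: "cmod (a1 - o0) \<le> \<bar>s\<bar> * (sqrt v * norm2 \<pi> h)"
    unfolding a1_def o0_def v_def by (rule mart_char_coboundary[OF u h])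
  have 3: "cmod r \<le> coboundary_defect u h"
  proof -
    have "cmod r \<le> (\<integral>X. \<bar>rho (X n)\<bar> \<partial>chain)"
      unfolding r_def by (rule integrable_bounded_mult(2)[OF integrable_chain_component[OF irho]]) auto
    also have "\<dots> = (\<integral>x. \<bar>rho x\<bar> \<partial>\<pi>)"
      using integrable_measurable_nu[OF irho] by (intro integral_chain_component) auto
    finally show ?thesis by (simp add: coboundary_defect_def rho_def v_def)
  qed
  have 4: "cmod a0 \<le> norm2 \<pi> h" unfolding a0_def by (rule norm_mart_char_integral_le[OF u h])
  have v0: "0 \<le> v" unfolding v_def by (rule mart_var_nonneg[OF u])
  have "corrected_char u h s (Suc n) - of_real (1 - s\<^sup>2 * v / 2) * corrected_char u h s n =
      (z1 - of_real (s\<^sup>2 / 2) * a1) - of_real (1 - s\<^sup>2 * v / 2) * (z0 - of_real (s\<^sup>2 / 2) * a0)"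
    by (simp add: corrected_char_def z0_def z1_def a0_def a1_def)
  also have "\<dots> = (z1 - z0 + of_real (s\<^sup>2 / 2) * c) - of_real (s\<^sup>2 / 2) * (a1 - o0) - of_real (s\<^sup>2 / 2) * r - of_real (s\<^sup>2 * v / 2 * (s\<^sup>2 / 2)) * a0"
    unfolding r_eq by (simp add: field_simps)
  finally have "cmod (corrected_char u h s (Suc n) - of_real (1 - s\<^sup>2 * v / 2) * corrected_char u h s n) =
      cmod ((z1 - z0 + of_real (s\<^sup>2 / 2) * c) - of_real (s\<^sup>2 / 2) * (a1 - o0) - of_real (s\<^sup>2 / 2) * r - of_real (s\<^sup>2 * v / 2 * (s\<^sup>2 / 2)) * a0)"
    by simp
  also have "\<dots> \<le> cmod (z1 - z0 + of_real (s\<^sup>2 / 2) * c) + cmod (of_real (s\<^sup>2 / 2) * (a1 - o0)) + cmod (of_real (s\<^sup>2 / 2) * r)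
      + cmod (of_real (s\<^sup>2 * v / 2 * (s\<^sup>2 / 2)) * a0)"
    by (intro order_trans[OF norm_triangle_ineq4] add_mono order_refl)
  also have "\<dots> = cmod (z1 - z0 + of_real (s\<^sup>2 / 2) * c) + s\<^sup>2 / 2 * cmod (a1 - o0) + s\<^sup>2 / 2 * cmod r + s\<^sup>2 * v / 2 * (s\<^sup>2 / 2) * cmod a0"
    using v0 by (simp add: norm_mult norm_divide norm_power)
  also have "\<dots> \<le> s\<^sup>2 * (lindeberg u s / 6) + s\<^sup>2 / 2 * (\<bar>s\<bar> * (sqrt v * norm2 \<pi> h)) + s\<^sup>2 / 2 * coboundary_defect u h
      + s\<^sup>2 * v / 2 * (s\<^sup>2 / 2) * norm2 \<pi> h"
    using v0 by (intro add_mono mult_left_mono 1 2 3 4) auto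
  finally show ?thesis by (simp add: v_def algebra_simps)
qed

lemma mart_char_error:
  fixes n :: nat
  assumes u: "L2 \<pi> u" and h: "L2 \<pi> h" and b: "\<bar>1 - s\<^sup>2 * mart_var u / 2\<bar> \<le> 1"
  shows "cmod ((\<integral>X. mart_char u s n X \<partial>chain) - of_real ((1 - s\<^sup>2 * mart_var u / 2) ^ n)) \<le>
    real n * (s\<^sup>2 * (mart_var u * s\<^sup>2 / 4 * norm2 \<pi> h + \<bar>s\<bar> * (sqrt (mart_var u) * norm2 \<pi> h) / 2
      + coboundary_defect u h / 2 + lindeberg u s / 6)) + s\<^sup>2 * norm2 \<pi> h"
proof -
  define b where "b = 1 - s\<^sup>2 * mart_var u / 2"
  define K where "K = s\<^sup>2 * (mart_var u * s\<^sup>2 / 4 * norm2 \<pi> h + \<bar>s\<bar> * (sqrt (mart_var u) * norm2 \<pi> h) / 2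
      + coboundary_defect u h / 2 + lindeberg u s / 6)"
  let ?Y = "corrected_char u h s"
  have b1: "\<bar>b\<bar> \<le> 1" using b by (simp add: b_def)
  have Y: "cmod (?Y m - of_real b ^ m * ?Y 0) \<le> real m * K" for m
  proof (induction m)
    case (Suc m)
    have "?Y (Suc m) - of_real b ^ Suc m * ?Y 0 = (?Y (Suc m) - of_real b * ?Y m) + of_real b * (?Y m - of_real b ^ m * ?Y 0)"
      by (simp add: algebra_simps)
    then have "cmod (?Y (Suc m) - of_real b ^ Suc m * ?Y 0) \<le> cmod (?Y (Suc m) - of_real b * ?Y m) + \<bar>b\<bar> * cmod (?Y m - of_real b ^ m * ?Y 0)"
      by (metis norm_triangle_ineq norm_mult norm_of_real)
    also have "cmod (?Y (Suc m) - of_real b * ?Y m) \<le> K"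
      unfolding b_def K_def by (rule corrected_char_step[OF u h])
    also have "\<bar>b\<bar> * cmod (?Y m - of_real b ^ m * ?Y 0) \<le> 1 * (real m * K)"
      using b1 Suc.IH by (intro mult_mono) auto
    finally show ?case by (simp add: algebra_simps)
  qed simp
  let ?A = "\<lambda>m. (\<integral>X. mart_char u s m X * of_real (h (X m)) \<partial>chain)"
  have A: "cmod (?A m) \<le> norm2 \<pi> h" for m by (rule norm_mart_char_integral_le[OF u h])
  have norm3: "cmod (x + y - z) \<le> cmod x + cmod y + cmod z" for x y z
    using norm_triangle_ineq4[of "x + y" z] norm_triangle_ineq[of x y] by linarith
  have Z0: "(\<integral>X. mart_char u s 0 X \<partial>chain) = 1"
    by (simp add: mart_char_def mart_def chain.prob_space)
  \<comment> \<open>Undoing the correction costs \<open>s\<^sup>2 / 2 * norm2 \<pi> h\<close> at time \<open>n\<close> and at time \<open>0\<close>.\<close>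
  have "(\<integral>X. mart_char u s n X \<partial>chain) - of_real (b ^ n) =
      (?Y n - of_real b ^ n * ?Y 0) + of_real (s\<^sup>2 / 2) * ?A n - of_real b ^ n * (of_real (s\<^sup>2 / 2) * ?A 0)"
    unfolding corrected_char_def Z0 by (simp add: algebra_simps)
  then have "cmod ((\<integral>X. mart_char u s n X \<partial>chain) - of_real (b ^ n)) \<le>
      cmod (?Y n - of_real b ^ n * ?Y 0) + cmod (of_real (s\<^sup>2 / 2) * ?A n) + cmod (of_real b ^ n * (of_real (s\<^sup>2 / 2) * ?A 0))"
    using norm3[of "?Y n - of_real b ^ n * ?Y 0" "of_real (s\<^sup>2 / 2) * ?A n" "of_real b ^ n * (of_real (s\<^sup>2 / 2) * ?A 0)"]
    by simp
  also have "\<dots> = cmod (?Y n - of_real b ^ n * ?Y 0) + s\<^sup>2 / 2 * cmod (?A n) + \<bar>b\<bar> ^ n * (s\<^sup>2 / 2 * cmod (?A 0))"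
    by (simp add: norm_mult norm_divide norm_power)
  also have "\<dots> \<le> real n * K + s\<^sup>2 / 2 * norm2 \<pi> h + 1 * (s\<^sup>2 / 2 * norm2 \<pi> h)"
    using b1 by (intro add_mono Y mult_left_mono mult_mono A power_le_one) auto
  finally show ?thesis unfolding b_def K_def by (simp add: mult.commute)
qed

text \<open>
  For \<open>s = t / sqrt n\<close> the accumulated error of \<open>n\<close> steps is \<open>t\<^sup>2\<close> times a quantity whose limit is
  half the coboundary defect, and this defect can be made arbitrarily small.
\<close>

lemma mart_CLT:
  assumes erg: "poisson_ergodic" and u: "L2 \<pi> u"
  shows "(\<lambda>n. \<integral>X. mart_char u (t / sqrt (real n)) n X \<partial>chain) \<longlonglongrightarrow> of_real (exp (- (mart_var u * t\<^sup>2) / 2))"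
proof -
  define v where "v = mart_var u"
  define s where "s n = t / sqrt (real n)" for n :: nat
  define b where "b n = 1 - (s n)\<^sup>2 * v / 2" for n
  have s2: "(s n)\<^sup>2 = t\<^sup>2 / real n" for n by (simp add: s_def power_divide)
  have "(\<lambda>n::nat. 1 / sqrt (real n)) \<longlonglongrightarrow> 0"
    by (intro tendsto_divide_0[OF tendsto_const] filterlim_at_top_imp_at_infinity
        filterlim_compose[OF sqrt_at_top filterlim_real_sequentially])
  from tendsto_mult_right_zero[OF this, of t] have s0: "s \<longlonglongrightarrow> 0" by (simp add: s_def[abs_def])
  have bt: "(\<lambda>n. b n ^ n) \<longlonglongrightarrow> exp (- (v * t\<^sup>2) / 2)"
  proof -
    have "b n ^ n = (1 + (- (v * t\<^sup>2) / 2) / real n) ^ n" for n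
      by (simp add: b_def s2 mult.commute)
    then show ?thesis using tendsto_exp_limit_sequentially[of "- (v * t\<^sup>2) / 2"] by simp
  qed
  have "b \<longlonglongrightarrow> 1 - 0\<^sup>2 * v / 2" unfolding b_def[abs_def] by (intro tendsto_intros s0) auto
  then have "\<forall>\<^sub>F n in sequentially. b n > -1" by (rule order_tendstoD(1)) simp
  then have bb: "\<forall>\<^sub>F n in sequentially. \<bar>b n\<bar> \<le> 1"
  proof eventually_elim
    case (elim n)
    have "0 \<le> (s n)\<^sup>2 * v" using mart_var_nonneg[OF u] by (simp add: v_def)
    then show ?case using elim by (simp add: b_def)
  qed
  let ?\<phi> = "\<lambda>n. \<integral>X. mart_char u (s n) n X \<partial>chain"
  have "(\<lambda>n. ?\<phi> n - of_real (b n ^ n)) \<longlonglongrightarrow> 0"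
  proof (rule tendstoI)
    fix e :: real assume e: "0 < e"
    \<comment> \<open>The defect enters multiplied by \<open>t\<^sup>2\<close>; the added \<open>1\<close> covers \<open>t = 0\<close>.\<close>
    define d where "d = e / (t\<^sup>2 + 1)"
    have t1: "0 < t\<^sup>2 + 1" by (simp add: add_nonneg_pos)
    have d: "0 < d" using e t1 by (simp add: d_def)
    obtain h where h: "L2 \<pi> h" and def: "coboundary_defect u h \<le> d"
      using erg[unfolded poisson_ergodic_def, rule_format, OF cond_var_integrable[OF u] d]
      unfolding integral_cond_var[OF u] coboundary_defect_def by blast
    let ?H = "norm2 \<pi> h"
    define B where "B n = t\<^sup>2 * (v * (s n)\<^sup>2 / 4 * ?H + \<bar>s n\<bar> * (sqrt v * ?H) / 2 + d / 2 + lindeberg u (s n) / 6)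
        + (s n)\<^sup>2 * ?H" for n
    have "B \<longlonglongrightarrow> t\<^sup>2 * (v * 0\<^sup>2 / 4 * ?H + \<bar>0\<bar> * (sqrt v * ?H) / 2 + d / 2 + 0 / 6) + 0\<^sup>2 * ?H"
      unfolding B_def[abs_def] by (intro tendsto_intros s0 lindeberg_tendsto_0[OF u]) auto
    moreover have "t\<^sup>2 * (v * 0\<^sup>2 / 4 * ?H + \<bar>0\<bar> * (sqrt v * ?H) / 2 + d / 2 + 0 / 6) + 0\<^sup>2 * ?H < e"
    proof -
      have "t\<^sup>2 * d < (t\<^sup>2 + 1) * d" using d by simp
      also have "\<dots> = e" using t1 by (simp add: d_def)
      finally have "t\<^sup>2 * d < e" .
      then show ?thesis using e by simp
    qed
    ultimately have "\<forall>\<^sub>F n in sequentially. B n < e" by (rule order_tendstoD(2))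
    then show "\<forall>\<^sub>F n in sequentially. dist (?\<phi> n - of_real (b n ^ n)) 0 < e"
      using bb eventually_gt_at_top[of 0]
    proof eventually_elim
      case (elim n)
      have "cmod (?\<phi> n - of_real (b n ^ n)) \<le> real n * ((s n)\<^sup>2 * (v * (s n)\<^sup>2 / 4 * ?H
          + \<bar>s n\<bar> * (sqrt v * ?H) / 2 + coboundary_defect u h / 2 + lindeberg u (s n) / 6)) + (s n)\<^sup>2 * ?H"
        using mart_char_error[OF u h, of "s n" n] elim(2) unfolding b_def v_def by blast
      also have "\<dots> = t\<^sup>2 * (v * (s n)\<^sup>2 / 4 * ?H
          + \<bar>s n\<bar> * (sqrt v * ?H) / 2 + coboundary_defect u h / 2 + lindeberg u (s n) / 6) + (s n)\<^sup>2 * ?H"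
      proof -
        have "real n * (s n)\<^sup>2 = t\<^sup>2" using elim(3) by (simp add: s2)
        then show ?thesis by (simp flip: mult.assoc)
      qed
      also have "\<dots> \<le> B n"
        unfolding B_def using def by (intro add_mono mult_left_mono order_refl) auto
      finally show ?case using elim(1) by simp
    qed
  qed
  then have "(\<lambda>n. ?\<phi> n - of_real (b n ^ n) + of_real (b n ^ n)) \<longlonglongrightarrow> 0 + of_real (exp (- (v * t\<^sup>2) / 2))"
    by (intro tendsto_add tendsto_of_real bt)
  then show ?thesis by (simp add: s_def v_def)
qed

end

section \<open>The Kipnis-Varadhan central limit theorem\<close>

lemma norm_iexp_diff_le: "cmod (iexp a - iexp b) \<le> \<bar>a - b\<bar>"
proof -
  have "iexp a - iexp b = iexp b * (iexp (a - b) - 1)"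
    by (simp add: algebra_simps exp_add[symmetric])
  then have "cmod (iexp a - iexp b) = cmod (iexp (a - b) - 1)"
    by (simp add: norm_mult del: of_real_diff)
  also have "\<dots> \<le> \<bar>a - b\<bar>" using iexp_approx1[of "a - b" 0] by simp
  finally show ?thesis .
qed

context reversible_kernel
begin

text \<open>
  The remainder is a boundary term plus the path sum of \<open>lam * u\<close>, whose corrector at level
  \<open>1 / n\<close> is known explicitly. After division by \<open>sqrt n\<close> only the last summand survives, and it is small with
  \<open>\<Phi> - resolvent_form f lam\<close>.
\<close>

lemma norm2_path_sum_diff_mart:
  assumes f: "L2 \<pi> f" and lam: "0 < lam" and n: "1 / real n < lam" "0 < n"
    and \<Phi>: "\<And>mu. 0 < mu \<Longrightarrow> resolvent_form f mu \<le> \<Phi>"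
  shows "norm2 chain (\<lambda>X. path_sum f n X - mart (resolvent f lam) n X) \<le>
    2 * norm2 \<pi> (resolvent f lam) + 5 * (lam / (lam - 1 / real n) * (sqrt (real n) * sqrt (\<Phi> - resolvent_form f lam)))"
proof -
  define mu where "mu = 1 / real n"
  define u where "u = resolvent f lam"
  define v where "v = resolvent f mu"
  have mu: "0 < mu" "mu < lam" using n by (auto simp: mu_def)
  have u: "resolvent_eq f lam u" unfolding u_def by (rule resolvent_eq_resolvent[OF f lam])
  have v: "resolvent_eq f mu v" unfolding v_def by (rule resolvent_eq_resolvent[OF f mu(1)])
  have fm [measurable]: "f \<in> borel_measurable \<nu>" using f by measurable
  note uL = resolvent_eq_L2[OF u]
  have um [measurable]: "u \<in> borel_measurable \<nu>" using uL by measurable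
  define w where "w = (\<lambda>x. lam / (lam - mu) * (v x - u x))"
  define q where "q = lam / (lam - mu)"
  have q: "0 < q" using mu lam by (simp add: q_def)
  have w: "resolvent_eq (\<lambda>x. lam * u x) mu w"
    unfolding w_def by (rule resolvent_eq_scaled_resolvent[OF u v]) (use mu in auto)
  have c: "(\<integral>x. (lam * u x) * w x \<partial>\<pi>) \<le> q\<^sup>2 * (\<Phi> - resolvent_form f lam)"
  proof -
    have "(\<integral>x. (lam * u x) * w x \<partial>\<pi>) =
        q\<^sup>2 * ((ip f v) - (ip f u) - (lam - mu) * (norm2 \<pi> u)\<^sup>2)"
      unfolding w_def q_def by (rule resolvent_form_scaled[OF fm u v]) (use mu in auto)
    also have "\<dots> \<le> q\<^sup>2 * (\<Phi> - resolvent_form f lam)"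
    proof (rule mult_left_mono)
      have "(ip f v) \<le> \<Phi>" using \<Phi>[OF mu(1)] by (simp add: v_def resolvent_form_def)
      moreover have "0 \<le> (lam - mu) * (norm2 \<pi> u)\<^sup>2" using mu by simp
      ultimately show "(ip f v) - (ip f u) - (lam - mu) * (norm2 \<pi> u)\<^sup>2
          \<le> \<Phi> - resolvent_form f lam"
        unfolding resolvent_form_def u_def[symmetric] by linarith
    qed simp
    finally show ?thesis .
  qed
  have lu: "L2 \<pi> (\<lambda>x. lam * u x)" by (rule L2_cmult[OF uL])
  have bound: "norm2 chain (path_sum (\<lambda>x. lam * u x) n) \<le> 5 * (q * (sqrt (real n) * sqrt (\<Phi> - resolvent_form f lam)))"
  proof -
    have "norm2 chain (path_sum (\<lambda>x. lam * u x) n) \<le> 5 * sqrt (real n * (\<integral>x. (lam * u x) * w x \<partial>\<pi>))"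
      by (rule norm2_path_sum_resolvent[OF lu w mu_def n(2)])
    also have "\<dots> \<le> 5 * sqrt (q\<^sup>2 * (real n * (\<Phi> - resolvent_form f lam)))"
      using mult_left_mono[OF c, of "real n"] by (auto simp: mult.left_commute)
    also have "\<dots> = 5 * (q * (sqrt (real n) * sqrt (\<Phi> - resolvent_form f lam)))"
      unfolding real_sqrt_mult using q by simp
    finally show ?thesis .
  qed
  have [measurable]: "path_sum f n \<in> borel_measurable chain" "mart u n \<in> borel_measurable chain"
     "path_sum (\<lambda>x. lam * u x) n \<in> borel_measurable chain"
    using path_sum_L2[OF f] mart_L2[OF uL] path_sum_L2[OF lu] by measurable
  have "norm2 chain (\<lambda>X. path_sum f n X - mart u n X) =
      norm2 chain (\<lambda>X. (u (X 0) - u (X n)) + path_sum (\<lambda>x. lam * u x) n X)"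
  proof (rule norm2_cong_AE)
    show "AE X in chain. path_sum f n X - mart u n X = (u (X 0) - u (X n)) + path_sum (\<lambda>x. lam * u x) n X"
      using path_sum_mart_decomp[OF u, of n] by eventually_elim (simp add: path_sum_def sum_distrib_left)
  qed measurable
  also have "\<dots> \<le> norm2 chain (\<lambda>X. u (X 0) - u (X n)) + norm2 chain (path_sum (\<lambda>x. lam * u x) n)"
    by (intro norm2_triangle L2_diff L2_chain_component path_sum_L2 uL lu)
  also have "norm2 chain (\<lambda>X. u (X 0) - u (X n)) \<le> norm2 \<pi> u + norm2 \<pi> u"
    using norm2_triangle_diff[OF L2_chain_component[OF uL, of 0] L2_chain_component[OF uL, of n]]
    by (simp add: norm2_chain_component)
  finally show ?thesis using bound by (simp add: u_def q_def mu_def)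
qed

lemma resolvent_norm2_le:
  assumes f: "L2 \<pi> f" and lam: "0 < lam" and \<Phi>: "\<And>mu. 0 < mu \<Longrightarrow> resolvent_form f mu \<le> \<Phi>"
  shows "lam * (norm2 \<pi> (resolvent f lam))\<^sup>2 \<le> 2 * (\<Phi> - resolvent_form f lam)"
proof -
  have "(lam - lam / 2) * (norm2 \<pi> (resolvent f lam))\<^sup>2 \<le> resolvent_form f (lam / 2) - resolvent_form f lam"
    unfolding resolvent_form_def
    using lam by (intro resolvent_form_mono_strong L2_measurable_nu[OF f] resolvent_eq_resolvent[OF f]) auto
  then show ?thesis using \<Phi>[of "lam / 2"] lam by simp
qed

text \<open>
  Substitute \<open>op u = (1 + lam) * u - f\<close> into the definition of \<open>mart_var\<close>.
\<close>

lemma mart_var_resolvent: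
  assumes f: "L2 \<pi> f" and lam: "0 < lam"
  shows "mart_var (resolvent f lam) = 2 * (1 + lam) * resolvent_form f lam - (norm2 \<pi> f)\<^sup>2
    - (2 + lam) * (lam * (norm2 \<pi> (resolvent f lam))\<^sup>2)"
proof -
  define u where "u = resolvent f lam"
  have u: "resolvent_eq f lam u" unfolding u_def by (rule resolvent_eq_resolvent[OF f lam])
  note uL = resolvent_eq_L2[OF u]
  have [measurable]: "u \<in> borel_measurable \<nu>" "f \<in> borel_measurable \<nu>" using uL f by measurable
  have "(norm2 \<pi> (op u))\<^sup>2 = (\<integral>x. ((1 + lam) * u x - f x)\<^sup>2 \<partial>\<pi>)"
    unfolding norm2_power2
  proof (rule integral_cong_AE)
    show "AE x in \<pi>. (op u x)\<^sup>2 = ((1 + lam) * u x - f x)\<^sup>2"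
      using u[unfolded resolvent_eq_def, THEN conjunct2] by eventually_elim simp
  qed measurable
  also have "\<dots> = (1 + lam)\<^sup>2 * (norm2 \<pi> u)\<^sup>2 - 2 * ((1 + lam) * (ip f u)) + (norm2 \<pi> f)\<^sup>2"
    unfolding integral_square_diff[OF L2_cmult[OF uL] f] norm2_power2
    by (simp add: power_mult_distrib mult.assoc mult.commute[of "u _"])
  finally show ?thesis
    unfolding mart_var_def u_def[symmetric] resolvent_form_def by (simp add: power2_eq_square algebra_simps)
qed

lemma mart_var_resolvent_tendsto:
  assumes f: "L2 \<pi> f" and lim: "(resolvent_form f \<longlongrightarrow> \<Phi>) (at_right 0)"
    and \<Phi>: "\<And>mu. 0 < mu \<Longrightarrow> resolvent_form f mu \<le> \<Phi>"
  shows "((\<lambda>lam. mart_var (resolvent f lam)) \<longlongrightarrow> 2 * \<Phi> - (norm2 \<pi> f)\<^sup>2) (at_right 0)"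
proof -
  have pos: "\<forall>\<^sub>F lam :: real in at_right 0. 0 < lam" by (rule eventually_at_right_less)
  have id: "((\<lambda>lam::real. lam) \<longlongrightarrow> 0) (at_right 0)" by (rule tendsto_ident_at)
  have small: "((\<lambda>lam. lam * (norm2 \<pi> (resolvent f lam))\<^sup>2) \<longlongrightarrow> 0) (at_right 0)"
  proof (rule tendsto_sandwich[of "\<lambda>_. 0" _ _ "\<lambda>lam. 2 * (\<Phi> - resolvent_form f lam)"])
    show "\<forall>\<^sub>F lam in at_right 0. 0 \<le> lam * (norm2 \<pi> (resolvent f lam))\<^sup>2"
      using pos by eventually_elim simp
    show "\<forall>\<^sub>F lam in at_right 0. lam * (norm2 \<pi> (resolvent f lam))\<^sup>2 \<le> 2 * (\<Phi> - resolvent_form f lam)"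
      using pos by eventually_elim (rule resolvent_norm2_le[OF f _ \<Phi>])
    have "((\<lambda>lam. 2 * (\<Phi> - resolvent_form f lam)) \<longlongrightarrow> 2 * (\<Phi> - \<Phi>)) (at_right 0)"
      by (intro tendsto_intros lim)
    then show "((\<lambda>lam. 2 * (\<Phi> - resolvent_form f lam)) \<longlongrightarrow> 0) (at_right 0)" by simp
  qed simp
  have "((\<lambda>lam. 2 * (1 + lam) * resolvent_form f lam - (norm2 \<pi> f)\<^sup>2
    - (2 + lam) * (lam * (norm2 \<pi> (resolvent f lam))\<^sup>2)) \<longlongrightarrow> 2 * (1 + 0) * \<Phi> - (norm2 \<pi> f)\<^sup>2 - (2 + 0) * 0) (at_right 0)"
    by (intro tendsto_intros lim small id)
  moreover have "\<forall>\<^sub>F lam in at_right 0. 2 * (1 + lam) * resolvent_form f lam - (norm2 \<pi> f)\<^sup>2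
    - (2 + lam) * (lam * (norm2 \<pi> (resolvent f lam))\<^sup>2) = mart_var (resolvent f lam)"
    using pos by eventually_elim (simp add: mart_var_resolvent[OF f])
  ultimately show ?thesis by (auto elim: Lim_transform_eventually)
qed

text \<open>
  Two limits in succession: \<open>n\<close> to infinity for fixed \<open>lam\<close>, where the martingale CLT applies, and
  then \<open>lam\<close> to \<open>0\<close>, where the error of the martingale approximation vanishes and the martingale
  variances converge.
\<close>

lemma path_sum_char_tendsto:
  assumes erg: "poisson_ergodic" and f: "L2 \<pi> f" and lim: "(resolvent_form f \<longlongrightarrow> \<Phi>) (at_right 0)"
    and \<Phi>: "\<And>mu. 0 < mu \<Longrightarrow> resolvent_form f mu \<le> \<Phi>"
  shows "(\<lambda>n. \<integral>X. iexp (t / sqrt (real n) * path_sum f n X) \<partial>chain)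
    \<longlonglongrightarrow> of_real (exp (- ((2 * \<Phi> - (norm2 \<pi> f)\<^sup>2) * t\<^sup>2) / 2))"
    (is "?\<phi> \<longlonglongrightarrow> of_real ?E")
proof (rule tendstoI)
  fix e :: real assume e: "0 < e"
  define F where "F v = exp (- (v * t\<^sup>2) / 2)" for v
  \<comment> \<open>The limiting error for fixed \<open>lam\<close>; it is made smaller than \<open>e\<close> first.\<close>
  define d where "d lam = 5 * \<bar>t\<bar> * sqrt (\<Phi> - resolvent_form f lam)
      + \<bar>F (mart_var (resolvent f lam)) - F (2 * \<Phi> - (norm2 \<pi> f)\<^sup>2)\<bar>" for lam
  have "(d \<longlongrightarrow> 5 * \<bar>t\<bar> * sqrt (\<Phi> - \<Phi>) + \<bar>F (2 * \<Phi> - (norm2 \<pi> f)\<^sup>2) - F (2 * \<Phi> - (norm2 \<pi> f)\<^sup>2)\<bar>) (at_right 0)"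
    unfolding d_def[abs_def] F_def
    by (intro tendsto_intros lim mart_var_resolvent_tendsto[OF f lim \<Phi>]) auto
  then have "\<forall>\<^sub>F lam in at_right 0. d lam < e" using e by (intro order_tendstoD(2)) auto
  then have "\<forall>\<^sub>F lam in at_right 0. d lam < e \<and> 0 < lam"
    using eventually_at_right_less[of 0] by eventually_elim simp
  then obtain lam where lam: "d lam < e" "0 < lam"
    using eventually_happens'[OF trivial_limit_at_right_real] by blast
  define u where "u = resolvent f lam"
  have uL: "L2 \<pi> u" unfolding u_def by (rule resolvent_L2[OF f lam(2)])
  have [measurable]: "u \<in> borel_measurable \<nu>" using uL by measurable
  have [measurable]: "path_sum f n \<in> borel_measurable chain" "mart u n \<in> borel_measurable chain" for n
    using path_sum_L2[OF f] mart_L2[OF uL] by measurable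
  define m where "m n = (\<integral>X. mart_char u (t / sqrt (real n)) n X \<partial>chain)" for n
  define q where "q n = lam / (lam - 1 / real n)" for n :: nat
  define rn where "rn n = 1 / sqrt (real n)" for n :: nat
  define B where "B n = \<bar>t\<bar> * (2 * norm2 \<pi> u * rn n + 5 * (q n * sqrt (\<Phi> - resolvent_form f lam)))
     + cmod (m n - of_real (F (mart_var u))) + \<bar>F (mart_var u) - F (2 * \<Phi> - (norm2 \<pi> f)\<^sup>2)\<bar>" for n
  have mlim: "m \<longlonglongrightarrow> of_real (F (mart_var u))"
    unfolding m_def[abs_def] F_def by (rule mart_CLT[OF erg uL])
  have rlim: "rn \<longlonglongrightarrow> 0"
    unfolding rn_def[abs_def]
    by (intro tendsto_divide_0[OF tendsto_const] filterlim_at_top_imp_at_infinity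
        filterlim_compose[OF sqrt_at_top filterlim_real_sequentially])
  have ilim: "(\<lambda>n. 1 / real n) \<longlonglongrightarrow> 0" by (rule lim_1_over_n)
  have qlim: "q \<longlonglongrightarrow> lam / (lam - 0)"
    unfolding q_def[abs_def] by (intro tendsto_intros ilim) (use lam in auto)
  have "B \<longlonglongrightarrow> \<bar>t\<bar> * (2 * norm2 \<pi> u * 0 + 5 * (lam / (lam - 0) * sqrt (\<Phi> - resolvent_form f lam)))
     + cmod (of_real (F (mart_var u)) - of_real (F (mart_var u))) + \<bar>F (mart_var u) - F (2 * \<Phi> - (norm2 \<pi> f)\<^sup>2)\<bar>"
    unfolding B_def[abs_def] by (intro tendsto_intros mlim rlim qlim)
  moreover have "\<bar>t\<bar> * (2 * norm2 \<pi> u * 0 + 5 * (lam / (lam - 0) * sqrt (\<Phi> - resolvent_form f lam)))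
     + cmod (of_real (F (mart_var u)) - of_real (F (mart_var u))) + \<bar>F (mart_var u) - F (2 * \<Phi> - (norm2 \<pi> f)\<^sup>2)\<bar> = d lam"
    using lam(2) by (simp add: d_def u_def)
  ultimately have "\<forall>\<^sub>F n in sequentially. B n < e" using lam(1) by (intro order_tendstoD(2)) auto
  moreover have "\<forall>\<^sub>F n in sequentially. 1 / real n < lam" using order_tendstoD(2)[OF ilim lam(2)] .
  ultimately show "\<forall>\<^sub>F n in sequentially. dist (?\<phi> n) (of_real ?E) < e"
    using eventually_gt_at_top[of 0]
  proof eventually_elim
    case (elim n)
    let ?s = "t / sqrt (real n)"
    let ?diff = "\<lambda>X. path_sum f n X - mart u n X"
    have dL: "L2 chain ?diff" by (intro L2_diff path_sum_L2 mart_L2 f uL)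
    have i: "integrable chain (\<lambda>X. iexp (?s * path_sum f n X))" "integrable chain (mart_char u ?s n)"
      by (rule chain.integrable_const_bound[of _ 1]; simp)+
    have "cmod (?\<phi> n - m n) = cmod (\<integral>X. iexp (?s * path_sum f n X) - mart_char u ?s n X \<partial>chain)"
      using i by (simp add: m_def)
    also have "\<dots> \<le> (\<integral>X. \<bar>?s\<bar> * \<bar>?diff X\<bar> \<partial>chain)"
    proof (rule order_trans[OF integral_norm_bound], rule integral_mono)
      show "integrable chain (\<lambda>X. norm (iexp (?s * path_sum f n X) - mart_char u ?s n X))"
        using i by (intro integrable_norm Bochner_Integration.integrable_diff)
      show "integrable chain (\<lambda>X. \<bar>?s\<bar> * \<bar>?diff X\<bar>)"
        by (intro integrable_mult_right integrable_abs chain.L2_integrable dL)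
      show "norm (iexp (?s * path_sum f n X) - mart_char u ?s n X) \<le> \<bar>?s\<bar> * \<bar>?diff X\<bar>" for X
        unfolding mart_char_def
        using norm_iexp_diff_le[of "?s * path_sum f n X" "?s * mart u n X"]
        unfolding right_diff_distrib[symmetric] abs_mult .
    qed
    also have "\<dots> \<le> \<bar>?s\<bar> * norm2 chain ?diff"
      unfolding integral_mult_right_zero by (intro mult_left_mono chain.integral_abs_le_norm2 dL) simp
    also have "\<dots> \<le> \<bar>?s\<bar> * (2 * norm2 \<pi> u + 5 * (q n * (sqrt (real n) * sqrt (\<Phi> - resolvent_form f lam))))"
      unfolding u_def q_def by (intro mult_left_mono norm2_path_sum_diff_mart f lam \<Phi> elim) simp_all
    also have "\<dots> = \<bar>t\<bar> * (2 * norm2 \<pi> u * rn n + 5 * (q n * sqrt (\<Phi> - resolvent_form f lam)))"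
      using elim(3) by (simp add: rn_def field_simps)
    finally have 1: "cmod (?\<phi> n - m n) \<le> \<bar>t\<bar> * (2 * norm2 \<pi> u * rn n + 5 * (q n * sqrt (\<Phi> - resolvent_form f lam)))" .
    have "cmod (?\<phi> n - of_real ?E) \<le> cmod (?\<phi> n - m n) + cmod (m n - of_real (F (mart_var u))) + cmod (of_real (F (mart_var u)) - of_real ?E)"
      using norm_triangle_ineq[of "?\<phi> n - m n" "m n - of_real (F (mart_var u))"]
        norm_triangle_ineq[of "?\<phi> n - of_real (F (mart_var u))" "of_real (F (mart_var u)) - of_real ?E"] by simp
    also have "cmod (of_real (F (mart_var u)) - of_real ?E) = \<bar>F (mart_var u) - F (2 * \<Phi> - (norm2 \<pi> f)\<^sup>2)\<bar>"
      unfolding F_def of_real_diff[symmetric] norm_of_real ..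
    finally have "cmod (?\<phi> n - of_real ?E) \<le> B n" using 1 by (simp add: B_def)
    then show ?case using elim(1) by (simp add: dist_norm)
  qed
qed

definition centered :: "('a \<Rightarrow> real) \<Rightarrow> 'a \<Rightarrow> real" where
  "centered f x = f x - (\<integral>y. f y \<partial>\<pi>)"

lemma centered_L2: "L2 \<pi> f \<Longrightarrow> L2 \<pi> (centered f)"
  unfolding centered_def[abs_def] by (intro L2_diff L2_const)

lemma path_avg_centered:
  assumes n: "0 < n"
  shows "path_avg f n X - (\<integral>x. f x \<partial>\<pi>) = path_sum (centered f) n X / real n"
  using n by (simp add: path_avg_def path_sum_def centered_def sum_subtractf field_simps)

theorem kipnis_varadhan:
  assumes erg: "poisson_ergodic" and f: "L2 \<pi> f"
    and lim: "(resolvent_form (centered f) \<longlongrightarrow> \<Phi>) (at_right 0)"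
    and \<Phi>: "\<And>mu. 0 < mu \<Longrightarrow> resolvent_form (centered f) mu \<le> \<Phi>"
  shows "CLT_with \<nu> \<pi> R f (2 * \<Phi> - (norm2 \<pi> (centered f))\<^sup>2)"
proof -
  let ?v = "2 * \<Phi> - (norm2 \<pi> (centered f))\<^sup>2"
  let ?T = "\<lambda>n X. sqrt (real n) * (path_avg f n X - (\<integral>x. f x \<partial>\<pi>))"
  note cf = centered_L2[OF f]
  have fm [measurable]: "f \<in> borel_measurable \<nu>" using f by measurable
  have v: "0 \<le> ?v"
  proof (rule tendsto_lowerbound[OF mart_var_resolvent_tendsto[OF cf lim \<Phi>]])
    show "\<forall>\<^sub>F lam in at_right 0. 0 \<le> mart_var (resolvent (centered f) lam)"
      using eventually_at_right_less[of 0] by eventually_elim (intro mart_var_nonneg resolvent_L2 cf)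
  qed simp_all
  have [measurable]: "?T n \<in> borel_measurable chain" for n
    unfolding path_avg_def by measurable
  have "weak_conv_m (\<lambda>n. distr chain borel (?T n)) (centered_normal ?v)"
  proof (rule levy_continuity)
    show "real_distribution (distr chain borel (?T n))" for n
      by (rule chain.real_distribution_distr) measurable
    show "real_distribution (centered_normal ?v)" by (rule real_distribution_centered_normal)
    fix t
    have eq: "char (distr chain borel (?T n)) t = (\<integral>X. iexp (t / sqrt (real n) * path_sum (centered f) n X) \<partial>chain)"
      if n: "0 < n" for n
    proof -
      have "t * ?T n X = t / sqrt (real n) * path_sum (centered f) n X" for X
        unfolding path_avg_centered[OF n] using n real_sqrt_mult_self[of "real n"] by (simp add: field_simps)
      then show ?thesis unfolding char_def by (subst integral_distr) simp_all
    qed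
    have "\<forall>\<^sub>F n in sequentially. (\<integral>X. iexp (t / sqrt (real n) * path_sum (centered f) n X) \<partial>chain) = char (distr chain borel (?T n)) t"
      by (intro eventually_mono[OF eventually_gt_at_top[of 0]]) (rule eq[symmetric])
    with path_sum_char_tendsto[OF erg cf lim \<Phi>, of t]
    show "(\<lambda>n. char (distr chain borel (?T n)) t) \<longlonglongrightarrow> char (centered_normal ?v) t"
      unfolding char_centered_normal[OF v] by (rule Lim_transform_eventually)
  qed
  then show ?thesis using v by (simp add: CLT_with_def)
qed

end

section \<open>Ergodicity\<close>

context reversible_kernel
begin

text \<open>
  The case of indicator functions, with the error measured in the stronger quadratic norm: in this
  form the property can be transferred between kernels.
\<close>

definition indicator_ergodic :: bool where
  "indicator_ergodic \<longleftrightarrow> (\<forall>A\<in>sets \<nu>. \<forall>e>0.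
    \<exists>h. L2 \<pi> h \<and> norm2 \<pi> (\<lambda>x. (indicator A x - measure \<pi> A) - (h x - op h x)) \<le> e)"

lemma indicator_L2: "A \<in> sets \<nu> \<Longrightarrow> L2 \<pi> (indicator A)"
  by (rule L2_bounded[where c=1]) (auto simp: indicator_def)

text \<open>
  The functions that can be approximated form a linear space which is closed under limits in mean,
  so indicators suffice.
\<close>

lemma poisson_ergodic_if_indicator_ergodic:
  assumes erg: "indicator_ergodic"
  shows "poisson_ergodic"
proof -
  define defect where "defect g h = (\<integral>x. \<bar>g x - (\<integral>y. g y \<partial>\<pi>) - (h x - op h x)\<bar> \<partial>\<pi>)" for g h
  have int: "integrable \<pi> (\<lambda>x. g x - (\<integral>y. g y \<partial>\<pi>) - (h x - op h x))"
    if "integrable \<pi> g" "L2 \<pi> h" for g h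
    using that L2_integrable[OF that(2)] L2_integrable[OF op_L2[OF that(2)]] by simp
  have "\<forall>e>0. \<exists>h. L2 \<pi> h \<and> defect g h \<le> e" if "integrable \<pi> g" for g
    using that
  proof (induction rule: integrable_induct)
    case (base A c)
    then have A: "A \<in> sets \<nu>" by simp
    show ?case
    proof (intro allI impI)
      fix e :: real assume e: "0 < e"
      then have "0 < e / (\<bar>c\<bar> + 1)" by (simp add: add_nonneg_pos)
      then obtain h where h: "L2 \<pi> h"
        "norm2 \<pi> (\<lambda>x. (indicator A x - measure \<pi> A) - (h x - op h x)) \<le> e / (\<bar>c\<bar> + 1)"
        using erg A unfolding indicator_ergodic_def by blast
      let ?k = "\<lambda>x. (indicator A x - measure \<pi> A) - (h x - op h x)"
      have kL: "L2 \<pi> ?k" by (intro L2_diff indicator_L2 A L2_const h op_L2)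
      have "defect (\<lambda>x. indicator A x *\<^sub>R c) (\<lambda>x. c * h x) = (\<integral>x. \<bar>c\<bar> * \<bar>?k x\<bar> \<partial>\<pi>)"
        unfolding defect_def
        by (rule Bochner_Integration.integral_cong)
           (simp_all add: A op_cmult abs_mult[symmetric] algebra_simps)
      also have "\<dots> \<le> \<bar>c\<bar> * (e / (\<bar>c\<bar> + 1))"
        using order_trans[OF integral_abs_le_norm2[OF kL] h(2)] unfolding integral_mult_right_zero
        by (intro mult_left_mono) auto
      also have "\<dots> \<le> e" using e by (simp add: field_simps)
      finally show "\<exists>h. L2 \<pi> h \<and> defect (\<lambda>x. indicator A x *\<^sub>R c) h \<le> e"
        using L2_cmult[OF h(1)] by blast
    qed
  next
    case (add g1 g2)
    show ?case
    proof (intro allI impI)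
      fix e :: real assume e: "0 < e"
      then obtain h1 h2 where h: "L2 \<pi> h1" "defect g1 h1 \<le> e / 2" "L2 \<pi> h2" "defect g2 h2 \<le> e / 2"
        using add.IH by (meson half_gt_zero)
      note L = L2_integrable[OF h(1)] L2_integrable[OF h(3)]
      note i1 = int[OF add.hyps(1) h(1)] and i2 = int[OF add.hyps(2) h(3)]
      have "defect (\<lambda>x. g1 x + g2 x) (\<lambda>x. h1 x + h2 x) \<le>
          (\<integral>x. \<bar>g1 x - (\<integral>y. g1 y \<partial>\<pi>) - (h1 x - op h1 x)\<bar> + \<bar>g2 x - (\<integral>y. g2 y \<partial>\<pi>) - (h2 x - op h2 x)\<bar> \<partial>\<pi>)"
        unfolding defect_def
      proof (rule integral_mono_AE)
        show "integrable \<pi> (\<lambda>x. \<bar>(g1 x + g2 x) - (\<integral>y. g1 y + g2 y \<partial>\<pi>) - ((h1 x + h2 x) - op (\<lambda>x. h1 x + h2 x) x)\<bar>)"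
          using add h by (intro integrable_abs int L2_add) auto
        show "AE x in \<pi>. \<bar>(g1 x + g2 x) - (\<integral>y. g1 y + g2 y \<partial>\<pi>) - ((h1 x + h2 x) - op (\<lambda>x. h1 x + h2 x) x)\<bar> \<le>
          \<bar>g1 x - (\<integral>y. g1 y \<partial>\<pi>) - (h1 x - op h1 x)\<bar> + \<bar>g2 x - (\<integral>y. g2 y \<partial>\<pi>) - (h2 x - op h2 x)\<bar>"
          using op_add_AE[OF L] by eventually_elim (simp add: add.hyps)
      qed (intro Bochner_Integration.integrable_add integrable_abs i1 i2)
      also have "\<dots> = defect g1 h1 + defect g2 h2" unfolding defect_def using i1 i2 by simp
      also have "\<dots> \<le> e" using h by simp
      finally show "\<exists>h. L2 \<pi> h \<and> defect (\<lambda>x. g1 x + g2 x) h \<le> e"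
        using L2_add[OF h(1,3)] by blast
    qed
  next
    case (lim g s)
    show ?case
    proof (intro allI impI)
      fix e :: real assume e: "0 < e"
      have gm [measurable]: "g \<in> borel_measurable \<pi>" "s i \<in> borel_measurable \<pi>" for i
        using lim.hyps by auto
      have "(\<lambda>i. \<integral>x. \<bar>s i x - g x\<bar> \<partial>\<pi>) \<longlonglongrightarrow> (\<integral>x. 0 \<partial>\<pi>)"
      proof (rule integral_dominated_convergence[where w="\<lambda>x. 3 * \<bar>g x\<bar>"])
        show "integrable \<pi> (\<lambda>x. 3 * \<bar>g x\<bar>)" using lim.hyps by simp
        show "AE x in \<pi>. (\<lambda>i. \<bar>s i x - g x\<bar>) \<longlonglongrightarrow> 0"
          using lim.hyps(2) by (intro AE_I2 tendsto_rabs_zero) (simp add: LIM_zero)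
        show "AE x in \<pi>. norm \<bar>s i x - g x\<bar> \<le> 3 * \<bar>g x\<bar>" for i
        proof (rule AE_I2)
          fix x assume "x \<in> space \<pi>"
          from lim.hyps(3)[OF this, of i] show "norm \<bar>s i x - g x\<bar> \<le> 3 * \<bar>g x\<bar>" by simp
        qed
      qed measurable
      then have "\<forall>\<^sub>F i in sequentially. (\<integral>x. \<bar>s i x - g x\<bar> \<partial>\<pi>) < e / 4"
        using e by (intro order_tendstoD(2)) auto
      then obtain i where i: "(\<integral>x. \<bar>s i x - g x\<bar> \<partial>\<pi>) < e / 4"
        by (auto dest: eventually_happens)
      obtain h where h: "L2 \<pi> h" "defect (s i) h \<le> e / 2" using lim.IH e by (meson half_gt_zero)
      have si: "integrable \<pi> (s i)" "integrable \<pi> g" using lim.hyps by auto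
      let ?D = "(\<integral>y. s i y \<partial>\<pi>) - (\<integral>y. g y \<partial>\<pi>)"
      have D: "\<bar>?D\<bar> \<le> e / 4"
      proof -
        have "?D = (\<integral>y. s i y - g y \<partial>\<pi>)" using si by simp
        then have "\<bar>?D\<bar> \<le> (\<integral>y. \<bar>s i y - g y\<bar> \<partial>\<pi>)" by (simp add: integral_abs_bound)
        then show ?thesis using i by simp
      qed
      have "defect g h \<le> (\<integral>x. \<bar>s i x - (\<integral>y. s i y \<partial>\<pi>) - (h x - op h x)\<bar> + (\<bar>s i x - g x\<bar> + \<bar>?D\<bar>) \<partial>\<pi>)"
        unfolding defect_def
        using si h int[OF si(1) h(1)] int[OF si(2) h(1)] L2_integrable[OF h(1)] L2_integrable[OF op_L2[OF h(1)]]
        by (intro integral_mono Bochner_Integration.integrable_add integrable_abs Bochner_Integration.integrable_diff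
              integrable_const) (auto simp del: integrable_diff)
      also have "\<dots> = defect (s i) h + ((\<integral>x. \<bar>s i x - g x\<bar> \<partial>\<pi>) + \<bar>?D\<bar>)"
        unfolding defect_def using si int[OF si(1) h(1)] by (simp add: prob_space[simplified])
      also have "\<dots> \<le> e" using h i D by simp
      finally show "\<exists>h. L2 \<pi> h \<and> defect g h \<le> e" using h by blast
    qed
  qed
  then show ?thesis unfolding poisson_ergodic_def defect_def by blast
qed

lemma kernel_pow_kernel: "kernel_pow \<nu> R n \<in> \<nu> \<rightarrow>\<^sub>M prob_algebra \<nu>"
  by (induction n) (auto intro: measurable_bind_prob_space R_kernel)

lemma measure_kernel_pow:
  assumes A: "A \<in> sets \<nu>" and x: "x \<in> space \<nu>"
  shows "measure (kernel_pow \<nu> R n x) A = (op ^^ n) (indicator A) x"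
  using x
proof (induction n arbitrary: x)
  case 0 then show ?case using A by (simp add: measure_return)
next
  case (Suc n)
  interpret Rx: prob_space "R x" by (rule prob_space_R[OF Suc.prems])
  have spR: "space (R x) = space \<nu>" using sets_eq_imp_space_eq[OF sets_R[OF Suc.prems]] .
  have "measure (R x \<bind> kernel_pow \<nu> R n) A = (\<integral>y. measure (kernel_pow \<nu> R n y) A \<partial>R x)"
    using measurable_prob_algebraD[OF kernel_pow_kernel[of n]] A sets_R[OF Suc.prems]
    by (intro Rx.measure_bind[where N=\<nu>]) (simp_all cong: measurable_cong_sets)
  also have "\<dots> = op ((op ^^ n) (indicator A)) x"
    unfolding op_def[of _ x] by (rule Bochner_Integration.integral_cong) (simp_all add: spR Suc.IH)
  finally show ?case by simp
qed

lemma abs_measure_diff_le_tv_dist: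
  assumes "prob_space M" "prob_space N" "A \<in> sets \<nu>"
  shows "\<bar>measure M A - measure N A\<bar> \<le> tv_dist \<nu> M N"
  unfolding tv_dist_def
proof (rule cSUP_upper[OF assms(3)])
  have "\<bar>measure M B - measure N B\<bar> \<le> 1" for B
    using prob_space.prob_le_1[OF assms(1), of B] prob_space.prob_le_1[OF assms(2), of B]
      measure_nonneg[of M B] measure_nonneg[of N B] by linarith
  then show "bdd_above ((\<lambda>A. \<bar>measure M A - measure N A\<bar>) ` sets \<nu>)" by (auto intro!: bdd_aboveI)
qed

text \<open>
  The sum of \<open>R ^ k 1\<^sub>A\<close> over \<open>k < n\<close> has coboundary \<open>1\<^sub>A - R ^ n 1\<^sub>A\<close>, and \<open>R ^ n 1\<^sub>A\<close> tends to \<open>\<pi> A\<close> in norm by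
  dominated convergence.
\<close>

lemma indicator_ergodic_if_ergodic_kernel:
  assumes "ergodic_kernel \<nu> \<pi> R"
  shows "indicator_ergodic"
  unfolding indicator_ergodic_def
proof (intro ballI allI impI)
  fix A and e :: real assume A [measurable]: "A \<in> sets \<nu>" and e: "0 < e"
  let ?a = "measure \<pi> A"
  let ?P = "\<lambda>n. (op ^^ n) (indicator A)"
  have PL: "L2 \<pi> (?P n)" for n by (rule iterates_L2(1)[OF indicator_L2[OF A]])
  have [measurable]: "?P n \<in> borel_measurable \<nu>" for n using PL[of n] by measurable
  have conv: "AE x in \<pi>. (\<lambda>n. ?P n x) \<longlonglongrightarrow> ?a"
    using assms[unfolded ergodic_kernel_def] AE_space
  proof eventually_elim
    case (elim x)
    have "prob_space (kernel_pow \<nu> R n x)" for n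
      using measurable_space[OF kernel_pow_kernel] elim(2) by (simp add: space_prob_algebra)
    then have "norm (?P n x - ?a) \<le> tv_dist \<nu> (kernel_pow \<nu> R n x) \<pi>" for n
      using abs_measure_diff_le_tv_dist[OF _ prob_space_axioms A, of "kernel_pow \<nu> R n x"] elim(2)
      by (simp add: measure_kernel_pow[OF A])
    then have "(\<lambda>n. ?P n x - ?a) \<longlonglongrightarrow> 0"
      by (intro Lim_null_comparison[OF _ elim(1)]) auto
    then show ?case by (simp add: LIM_zero_iff)
  qed
  have le1: "\<bar>?P n x - ?a\<bar> \<le> 1" if "x \<in> space \<nu>" for n x
  proof -
    have "prob_space (kernel_pow \<nu> R n x)"
      using measurable_space[OF kernel_pow_kernel] that by (simp add: space_prob_algebra)
    then have "0 \<le> ?P n x" "?P n x \<le> 1"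
      unfolding measure_kernel_pow[OF A that, symmetric] by (auto intro: prob_space.prob_le_1)
    moreover have "?a \<le> 1" "0 \<le> ?a" by auto
    ultimately show ?thesis by linarith
  qed
  have "(\<lambda>n. \<integral>x. (?P n x - ?a)\<^sup>2 \<partial>\<pi>) \<longlonglongrightarrow> (\<integral>x. 0 \<partial>\<pi>)"
  proof (rule integral_dominated_convergence[where w="\<lambda>_. 1"])
    show "AE x in \<pi>. (\<lambda>n. (?P n x - ?a)\<^sup>2) \<longlonglongrightarrow> 0"
      using conv
    proof eventually_elim
      case (elim x)
      then have "(\<lambda>n. (?P n x - ?a)\<^sup>2) \<longlonglongrightarrow> (?a - ?a)\<^sup>2" by (intro tendsto_intros)
      then show ?case by simp
    qed
    show "AE x in \<pi>. norm ((?P n x - ?a)\<^sup>2) \<le> 1" for n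
      using le1 by (intro AE_I2) (simp add: abs_square_le_1)
  qed measurable
  then have "\<forall>\<^sub>F n in sequentially. (\<integral>x. (?P n x - ?a)\<^sup>2 \<partial>\<pi>) < e\<^sup>2"
    using e by (intro order_tendstoD(2)) auto
  then obtain n where n: "(\<integral>x. (?P n x - ?a)\<^sup>2 \<partial>\<pi>) < e\<^sup>2" by (auto dest: eventually_happens)
  define h where "h = (\<lambda>x. \<Sum>k<n. ?P k x)"
  have hL: "L2 \<pi> h" unfolding h_def by (intro L2_sum PL)
  have [measurable]: "h \<in> borel_measurable \<nu>" using hL by measurable
  have "AE x in \<pi>. \<forall>k. integrable (R x) (?P k)"
    unfolding AE_all_countable using AE_R_integrable[OF L2_integrable[OF PL]] by blast
  then have eq: "AE x in \<pi>. (indicator A x - ?a) - (h x - op h x) = ?P n x - ?a"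
  proof eventually_elim
    case (elim x)
    have "op h x = (\<Sum>k<n. ?P (Suc k) x)"
      unfolding h_def using elim by (simp add: op_def)
    then have "h x - op h x = ?P 0 x - ?P n x"
      using sum_lessThan_telescope'[of "\<lambda>k. ?P k x" n]
      unfolding h_def sum_subtractf by simp
    then show ?case by simp
  qed
  have "norm2 \<pi> (\<lambda>x. (indicator A x - ?a) - (h x - op h x)) = norm2 \<pi> (\<lambda>x. ?P n x - ?a)"
    by (rule norm2_cong_AE[OF _ _ eq]) measurable
  also have "\<dots> \<le> e"
    unfolding norm2_def using n e by (intro real_le_lsqrt) auto
  finally show "\<exists>h. L2 \<pi> h \<and> norm2 \<pi> (\<lambda>x. (indicator A x - ?a) - (h x - op h x)) \<le> e"
    using hL by blast
qed

end

text \<open>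
  Let \<open>g\<close> be the centred indicator. The candidate for \<open>R\<close> is its resolvent \<open>u\<close>, with error \<open>w = lam * u\<close>.
  The energy identity shows that \<open>\<parallel>w\<parallel>\<^sup>2 \<le> \<langle>g, w\<rangle>\<close> and that the \<open>R\<close>-energy of \<open>w\<close> is of order \<open>lam\<close>. Then
  its \<open>P\<close>-energy is of order \<open>lam\<close> too, so \<open>w\<close> is almost \<open>P\<close>-invariant and hence almost orthogonal to
  every \<open>P\<close>-coboundary. Since \<open>g\<close> is close to a \<open>P\<close>-coboundary, \<open>\<langle>g, w\<rangle>\<close> is small.
\<close>

lemma indicator_ergodic_transfer:
  assumes P: "reversible_kernel \<nu> \<pi> P" and R: "reversible_kernel \<nu> \<pi> R"
    and erg: "reversible_kernel.indicator_ergodic \<nu> \<pi> P" and C: "0 \<le> C"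
    and le: "\<And>h. L2 \<pi> h \<Longrightarrow> reversible_kernel.dirichlet \<pi> P h \<le> C * reversible_kernel.dirichlet \<pi> R h"
  shows "reversible_kernel.indicator_ergodic \<nu> \<pi> R"
proof -
  interpret P: reversible_kernel \<nu> \<pi> P by fact
  interpret R: reversible_kernel \<nu> \<pi> R by fact
  show ?thesis
    unfolding R.indicator_ergodic_def
  proof (intro ballI allI impI)
    fix A and e :: real assume A [measurable]: "A \<in> sets \<nu>" and e: "0 < e"
    define g where "g x = indicator A x - measure \<pi> A" for x
    have gL: "L2 \<pi> g" unfolding g_def[abs_def] by (intro L2_diff P.indicator_L2 A P.L2_const)
    have gm [measurable]: "g \<in> borel_measurable \<nu>" by (rule P.L2_measurable_nu[OF gL])
    have "0 < e\<^sup>2 / (2 * (norm2 \<pi> g + 1))" using e by (simp add: add_nonneg_pos)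
    then obtain h where h: "L2 \<pi> h" and h_small:
        "norm2 \<pi> (\<lambda>x. g x - (h x - P.op h x)) \<le> e\<^sup>2 / (2 * (norm2 \<pi> g + 1))"
      using erg A unfolding P.indicator_ergodic_def g_def by blast
    let ?k = "\<lambda>x. h x - P.op h x"
    have kL: "L2 \<pi> ?k" by (intro L2_diff h P.op_L2)
    \<comment> \<open>Half of the allowed error is reserved for the coboundary, half for the approximation of \<open>g\<close>.\<close>
    define B where "B lam = norm2 \<pi> h * sqrt (2 * C * lam * (norm2 \<pi> g)\<^sup>2)" for lam
    have "(B \<longlongrightarrow> norm2 \<pi> h * sqrt (2 * C * 0 * (norm2 \<pi> g)\<^sup>2)) (at_right 0)"
      unfolding B_def[abs_def] by (intro tendsto_intros)
    then have "\<forall>\<^sub>F lam in at_right 0. B lam < e\<^sup>2 / 2" using e by (intro order_tendstoD(2)) auto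
    then have "\<forall>\<^sub>F lam in at_right 0. B lam < e\<^sup>2 / 2 \<and> 0 < lam"
      using eventually_at_right_less[of 0] by eventually_elim simp
    then obtain lam where lam: "B lam < e\<^sup>2 / 2" "0 < lam"
      using eventually_happens'[OF trivial_limit_at_right_real] by blast
    define u where "u = R.resolvent g lam"
    have u: "R.resolvent_eq g lam u" unfolding u_def by (rule R.resolvent_eq_resolvent[OF gL lam(2)])
    note uL = R.resolvent_eq_L2[OF u]
    define w where "w x = lam * u x" for x
    have wL: "L2 \<pi> w" unfolding w_def[abs_def] by (rule L2_cmult[OF uL])
    have um [measurable]: "u \<in> borel_measurable \<nu>" "w \<in> borel_measurable \<nu>"
      using P.L2_measurable_nu[OF uL] P.L2_measurable_nu[OF wL] .
    have energy: "lam * (\<integral>x. g x * w x \<partial>\<pi>) = lam * (norm2 \<pi> w)\<^sup>2 + R.dirichlet w"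
    proof -
      have "R.dirichlet w = lam\<^sup>2 * R.dirichlet u"
        unfolding w_def[abs_def] by (rule R.dirichlet_cmult)
      moreover have "(\<integral>x. g x * w x \<partial>\<pi>) = lam * (\<integral>x. g x * u x \<partial>\<pi>)"
        by (simp add: w_def mult.left_commute)
      moreover have "(norm2 \<pi> w)\<^sup>2 = lam\<^sup>2 * (norm2 \<pi> u)\<^sup>2"
        by (simp add: w_def[abs_def] norm2_cmult power_mult_distrib)
      ultimately show ?thesis
        using R.resolvent_eq_energy[OF gm u] by (simp add: power2_eq_square algebra_simps)
    qed
    have Dw: "0 \<le> R.dirichlet w" by (rule R.dirichlet_nonneg[OF wL])
    have "lam * (norm2 \<pi> w)\<^sup>2 \<le> lam * (\<integral>x. g x * w x \<partial>\<pi>)" using energy Dw by simp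
    then have w_gw: "(norm2 \<pi> w)\<^sup>2 \<le> (\<integral>x. g x * w x \<partial>\<pi>)" using lam by simp
    have gw: "(\<integral>x. g x * w x \<partial>\<pi>) \<le> norm2 \<pi> g * norm2 \<pi> w"
      using L2_Cauchy_Schwarz[OF gL wL] by simp
    have wg: "norm2 \<pi> w \<le> norm2 \<pi> g"
    proof (cases "norm2 \<pi> w = 0")
      case False
      then have "0 < norm2 \<pi> w" using norm2_nonneg[of \<pi> w] by linarith
      moreover have "norm2 \<pi> w * norm2 \<pi> w \<le> norm2 \<pi> g * norm2 \<pi> w"
        using w_gw gw by (simp add: power2_eq_square)
      ultimately show ?thesis by simp
    qed simp
    have "R.dirichlet w \<le> lam * (\<integral>x. g x * w x \<partial>\<pi>)" using energy lam by simp
    also have "\<dots> \<le> lam * (norm2 \<pi> g)\<^sup>2"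
    proof (rule mult_left_mono)
      show "(\<integral>x. g x * w x \<partial>\<pi>) \<le> (norm2 \<pi> g)\<^sup>2"
        using order_trans[OF gw mult_left_mono[OF wg]] by (simp add: power2_eq_square)
    qed (use lam in simp)
    finally have "C * R.dirichlet w \<le> C * (lam * (norm2 \<pi> g)\<^sup>2)" by (rule mult_left_mono[OF _ C])
    then have "(norm2 \<pi> (\<lambda>x. w x - P.op w x))\<^sup>2 \<le> 2 * C * lam * (norm2 \<pi> g)\<^sup>2"
      using P.norm2_diff_op_le[OF wL] le[OF wL] by simp
    then have wPw: "norm2 \<pi> (\<lambda>x. w x - P.op w x) \<le> sqrt (2 * C * lam * (norm2 \<pi> g)\<^sup>2)"
      by (rule real_le_rsqrt)
    have "(\<integral>x. g x * w x \<partial>\<pi>) = (\<integral>x. h x * (w x - P.op w x) \<partial>\<pi>) + (\<integral>x. (g x - ?k x) * w x \<partial>\<pi>)"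
      using P.op_symmetric[OF h wL] L2_mult_integrable[OF h wL] L2_mult_integrable[OF h P.op_L2[OF wL]]
        L2_mult_integrable[OF gL wL] L2_mult_integrable[OF P.op_L2[OF h] wL]
      by (simp add: left_diff_distrib right_diff_distrib)
    also have "(\<integral>x. h x * (w x - P.op w x) \<partial>\<pi>) \<le> B lam"
      using L2_Cauchy_Schwarz[OF h L2_diff[OF wL P.op_L2[OF wL]]]
        mult_left_mono[OF wPw norm2_nonneg[of \<pi> h]] by (simp add: B_def)
    also have "(\<integral>x. (g x - ?k x) * w x \<partial>\<pi>) \<le> e\<^sup>2 / (2 * (norm2 \<pi> g + 1)) * norm2 \<pi> g"
      using L2_Cauchy_Schwarz[OF L2_diff[OF gL kL] wL] mult_mono[OF h_small wg] by simp
    also have "\<dots> \<le> e\<^sup>2 / 2"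
    proof -
      have "e\<^sup>2 / (2 * (norm2 \<pi> g + 1)) * norm2 \<pi> g = e\<^sup>2 / 2 * (norm2 \<pi> g / (norm2 \<pi> g + 1))" by simp
      also have "\<dots> \<le> e\<^sup>2 / 2 * 1" by (intro mult_left_mono) (auto simp: divide_le_eq add_nonneg_pos)
      finally show ?thesis by simp
    qed
    finally have "(\<integral>x. g x * w x \<partial>\<pi>) \<le> e\<^sup>2" using lam(1) by simp
    with w_gw have "(norm2 \<pi> w)\<^sup>2 \<le> e\<^sup>2" by linarith
    then have we: "norm2 \<pi> w \<le> e" using e by (auto intro: power2_le_imp_le)
    have "norm2 \<pi> (\<lambda>x. g x - (u x - R.op u x)) = norm2 \<pi> w"
    proof (rule norm2_cong_AE)
      show "AE x in \<pi>. g x - (u x - R.op u x) = w x"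
        using u[unfolded R.resolvent_eq_def, THEN conjunct2]
        by eventually_elim (simp add: w_def algebra_simps)
    qed measurable
    with we show "\<exists>h. L2 \<pi> h \<and> norm2 \<pi> (\<lambda>x. (indicator A x - measure \<pi> A) - (h x - R.op h x)) \<le> e"
      using uL unfolding g_def by auto
  qed
qed

section \<open>Bounded variances bound the resolvent form\<close>

lemma geometric_weight_diff_sums:
  fixes b :: "nat \<Rightarrow> real"
  assumes "summable (\<lambda>n. r ^ n * b n)"
  shows "(\<lambda>n. r ^ n * (b n - (case n of 0 \<Rightarrow> 0 | Suc m \<Rightarrow> b m))) sums ((1 - r) * (\<Sum>n. r ^ n * b n))"
proof -
  let ?p = "\<lambda>n. r ^ n * (case n of 0 \<Rightarrow> 0 | Suc m \<Rightarrow> b m)"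
  have "(\<lambda>n. ?p (Suc n)) sums (r * (\<Sum>n. r ^ n * b n))"
    using sums_mult[OF summable_sums[OF assms], of r] by (simp add: mult.assoc)
  then have "?p sums (r * (\<Sum>n. r ^ n * b n))"
    by (subst (asm) sums_Suc_iff) simp
  from sums_diff[OF summable_sums[OF assms] this] show ?thesis
    by (simp add: right_diff_distrib left_diff_distrib)
qed

text \<open>
  Read \<open>c\<close> as the autocovariances, \<open>V n\<close> as the variance of the path sum of length \<open>n\<close> and \<open>d 0\<close> as the
  resolvent form. With \<open>r = 1 / (1 + lam)\<close>, summing by parts twice gives
  \<open>2 * (\<Sum>n. r ^ n * c n) - c 0 = (1 - r)\<^sup>2 * (\<Sum>n. r ^ n * V (n + 1))\<close>, which is at most \<open>C\<close> since
  \<open>(\<Sum>n. r ^ n * (n + 1)) = 1 / (1 - r)\<^sup>2\<close>. The recursion for \<open>d\<close> telescopes to \<open>d 0 = r * (\<Sum>n. r ^ n * c n)\<close>.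
\<close>

lemma abel_bound:
  fixes c d V :: "nat \<Rightarrow> real"
  assumes lam: "0 < lam" and c: "\<And>m. c m = (1 + lam) * d m - d (Suc m)" and d: "\<And>m. \<bar>d m\<bar> \<le> K"
    and V0: "V 0 = 0" and V: "\<And>n. V (Suc n) = V n + 2 * (\<Sum>k\<le>n. c k) - c 0"
    and bd: "\<And>n. 0 \<le> V n" "\<And>n. V n \<le> C * real n" and c0: "0 \<le> c 0"
  shows "d 0 \<le> (C + c 0) / 2"
proof -
  define r where "r = 1 / (1 + lam)"
  have r: "0 < r" "r < 1" "r * (1 + lam) = 1" using lam by (auto simp: r_def)
  have C0: "0 \<le> C" using bd[of 1] by simp
  define s where "s n = V (Suc n) - V n" for n
  \<comment> \<open>First and second differences of \<open>V\<close>; the case at \<open>0\<close> uses \<open>V 0 = 0\<close>.\<close>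
  have V_s: "V (Suc n) - (case n of 0 \<Rightarrow> 0 | Suc m \<Rightarrow> V (Suc m)) = s n" for n
    by (cases n) (auto simp: s_def V0)
  have s_c: "s n - (case n of 0 \<Rightarrow> 0 | Suc m \<Rightarrow> s m) = 2 * c n - (if n = 0 then c 0 else 0)" for n
    by (cases n) (auto simp: s_def V)
  have geo: "(\<lambda>n. r ^ n * (C * real (Suc n))) sums (C / (1 - r)\<^sup>2)"
    using sums_mult[OF geometric_deriv_sums[of r], of C] r by (simp add: ac_simps)
  have bdS: "V (Suc n) \<le> C * (1 + real n)" for n using bd(2)[of "Suc n"] by simp
  have sV: "summable (\<lambda>n. r ^ n * V (Suc n))"
    using r bd bdS by (intro summable_comparison_test'[OF sums_summable[OF geo]]) (auto simp: abs_mult intro!: mult_left_mono)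
  define W where "W = (\<Sum>n. r ^ n * V (Suc n))"
  have W: "W \<le> C / (1 - r)\<^sup>2"
    unfolding W_def sums_unique[OF geo]
    using r bdS by (intro suminf_le sV sums_summable[OF geo] mult_left_mono) auto
  have S1: "(\<lambda>n. r ^ n * s n) sums ((1 - r) * W)"
    using geometric_weight_diff_sums[of r "\<lambda>n. V (Suc n)", OF sV] by (simp add: V_s W_def)
  have S2: "(\<lambda>n. r ^ n * (2 * c n - (if n = 0 then c 0 else 0))) sums ((1 - r) * ((1 - r) * W))"
    using geometric_weight_diff_sums[OF sums_summable[OF S1]] unfolding s_c sums_unique[OF S1, symmetric] .
  have "(\<lambda>n. r ^ n * d n) \<longlonglongrightarrow> 0"
  proof (rule Lim_null_comparison)
    show "\<forall>\<^sub>F n in sequentially. norm (r ^ n * d n) \<le> r ^ n * K"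
      using r d by (auto simp: abs_mult intro!: mult_left_mono)
    show "(\<lambda>n. r ^ n * K) \<longlonglongrightarrow> 0"
      using r by (intro tendsto_mult_left_zero LIMSEQ_power_zero) auto
  qed
  then have "(\<lambda>n. r ^ n * d n / r) \<longlonglongrightarrow> 0 / r" by (intro tendsto_divide tendsto_const) (use r in auto)
  from telescope_sums'[OF this] have "(\<lambda>n. r ^ n * d n / r - r ^ Suc n * d (Suc n) / r) sums (d 0 / r)" by simp
  moreover have "r ^ n * d n / r - r ^ Suc n * d (Suc n) / r = r ^ n * c n" for n
  proof -
    have "d n / r = (1 + lam) * d n" by (simp add: r_def mult.commute)
    then have "r ^ n * c n = r ^ n * (d n / r - d (Suc n))" by (simp add: c)
    also have "\<dots> = r ^ n * d n / r - r ^ Suc n * d (Suc n) / r"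
      using r(1) by (simp add: right_diff_distrib)
    finally show ?thesis by simp
  qed
  ultimately have "(\<lambda>n. r ^ n * c n) sums (d 0 / r)" by simp
  from sums_diff[OF sums_mult[OF this, of 2] sums_single[of 0 "\<lambda>_. c 0"]]
  have "(\<lambda>n. r ^ n * (2 * c n - (if n = 0 then c 0 else 0))) sums (2 * (d 0 / r) - c 0)"
    by (rule sums_cong[THEN iffD1, rotated]) (auto simp: algebra_simps)
  from sums_unique2[OF this S2] have "2 * (d 0 / r) - c 0 = (1 - r)\<^sup>2 * W" by (simp add: power2_eq_square)
  also have "\<dots> \<le> (1 - r)\<^sup>2 * (C / (1 - r)\<^sup>2)" by (intro mult_left_mono W) simp
  also have "\<dots> = C" using r by simp
  finally have fin: "2 * (d 0 / r) - c 0 \<le> C" .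
  define x where "x = d 0 / r"
  have "x \<le> (C + c 0) / 2" using fin unfolding x_def[symmetric] by simp
  then have "r * x \<le> r * ((C + c 0) / 2)" using r by (intro mult_left_mono) auto
  then have "d 0 \<le> r * ((C + c 0) / 2)" using r by (simp add: x_def)
  also have "\<dots> \<le> 1 * ((C + c 0) / 2)" using r C0 c0 by (intro mult_right_mono) auto
  finally show ?thesis by simp
qed

context reversible_kernel
begin

lemma integral_chain_covariance:
  assumes g: "L2 \<pi> g" and h: "L2 \<pi> h"
  shows "(\<integral>X. g (X i) * h (X (i + k)) \<partial>chain) = (ip g ((op ^^ k) h))"
  using h
proof (induction k arbitrary: h)
  case 0
  have [measurable]: "g \<in> borel_measurable \<nu>" "h \<in> borel_measurable \<nu>" using g 0 by measurable
  show ?case using integral_chain_component[of "\<lambda>x. g x * h x" i] by simp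
next
  case (Suc k)
  have gm: "g \<in> borel_measurable \<nu>" "h \<in> borel_measurable \<nu>" using g Suc.prems by measurable
  have "(\<integral>X. g (X i) * h (X (Suc (i + k))) \<partial>chain) = (\<integral>X. g (X i) * op h (X (i + k)) \<partial>chain)"
    by (intro markov_property adapted_component gm L2_mult_integrable L2_chain_component g Suc.prems) simp
  also have "\<dots> = (\<integral>x. g x * (op ^^ k) (op h) x \<partial>\<pi>)" by (rule Suc.IH[OF op_L2[OF Suc.prems]])
  finally show ?case by (simp add: funpow_swap1)
qed

lemma path_sum_square_Suc:
  assumes g: "L2 \<pi> g"
  defines "V \<equiv> \<lambda>n. \<integral>X. (path_sum g n X)\<^sup>2 \<partial>chain" and "c \<equiv> \<lambda>k. \<integral>x. g x * (op ^^ k) g x \<partial>\<pi>"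
  shows "V (Suc n) = V n + 2 * (\<Sum>k\<le>n. c k) - c 0"
proof -
  have gm [measurable]: "g \<in> borel_measurable \<nu>" using g by measurable
  have "V (Suc n) = (\<integral>X. (path_sum g n X + g (X n))\<^sup>2 \<partial>chain)"
    by (simp add: V_def path_sum_def)
  also have "\<dots> = V n + 2 * (\<integral>X. path_sum g n X * g (X n) \<partial>chain) + (\<integral>X. (g (X n))\<^sup>2 \<partial>chain)"
    unfolding V_def by (rule integral_square_add[OF path_sum_L2[OF g] L2_chain_component[OF g]])
  also have "(\<integral>X. (g (X n))\<^sup>2 \<partial>chain) = c 0"
    using integral_chain_covariance[OF g g, of n 0] by (simp add: c_def power2_eq_square)
  also have "(\<integral>X. path_sum g n X * g (X n) \<partial>chain) = (\<Sum>i<n. \<integral>X. g (X i) * g (X n) \<partial>chain)"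
    unfolding path_sum_def sum_distrib_right
    by (rule Bochner_Integration.integral_sum) (intro L2_mult_integrable L2_chain_component g)
  also have "\<dots> = (\<Sum>i<n. c (n - i))"
  proof (rule sum.cong[OF refl])
    fix i assume "i \<in> {..<n}"
    then show "(\<integral>X. g (X i) * g (X n) \<partial>chain) = c (n - i)"
      using integral_chain_covariance[OF g g, of i "n - i"] by (simp add: c_def)
  qed
  also have "\<dots> = (\<Sum>k<n. c (Suc k))"
    by (rule sum.reindex_bij_witness[of _ "\<lambda>k. n - Suc k" "\<lambda>i. n - Suc i"]) (auto simp: Suc_diff_Suc)
  also have "\<dots> = (\<Sum>k\<le>n. c k) - c 0"
    by (simp add: lessThan_Suc_atMost[symmetric] sum.lessThan_Suc_shift del: sum.lessThan_Suc)
  finally show ?thesis by simp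
qed

text \<open>
  Here \<open>d k\<close> is the correlation of the resolvent with \<open>R ^ k g\<close>; pairing the resolvent equation with
  \<open>R ^ k g\<close> gives the recursion between \<open>c\<close> and \<open>d\<close>.
\<close>

lemma resolvent_form_bounded:
  assumes g: "L2 \<pi> g" and bd: "\<And>n. (\<integral>X. (path_sum g n X)\<^sup>2 \<partial>chain) \<le> C * real n" and lam: "0 < lam"
  shows "resolvent_form g lam \<le> (C + (norm2 \<pi> g)\<^sup>2) / 2"
proof -
  have gm [measurable]: "g \<in> borel_measurable \<nu>" using g by measurable
  define u where "u = resolvent g lam"
  have u: "resolvent_eq g lam u" unfolding u_def by (rule resolvent_eq_resolvent[OF g lam])
  note uL = resolvent_eq_L2[OF u]
  define c where "c k = (ip g ((op ^^ k) g))" for k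
  define d where "d k = (ip u ((op ^^ k) g))" for k
  note it = iterates_L2[OF g]
  have "d 0 \<le> (C + c 0) / 2"
  proof (rule abel_bound[OF lam])
    show "c m = (1 + lam) * d m - d (Suc m)" for m
      unfolding c_def d_def
      using resolvent_eq_integral[OF gm u it(1)] op_symmetric[OF uL it(1)] by simp
    show "\<bar>d m\<bar> \<le> norm2 \<pi> u * norm2 \<pi> g" for m
      unfolding d_def
      by (rule order_trans[OF L2_Cauchy_Schwarz[OF uL it(1)]]) (intro mult_left_mono it norm2_nonneg)
    show "(\<integral>X. (path_sum g (Suc n) X)\<^sup>2 \<partial>chain) = (\<integral>X. (path_sum g n X)\<^sup>2 \<partial>chain) + 2 * (\<Sum>k\<le>n. c k) - c 0" for n
      unfolding c_def by (rule path_sum_square_Suc[OF g])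
    show "0 \<le> c 0" by (simp add: c_def)
  qed (use bd in \<open>auto simp: path_sum_def\<close>)
  moreover have "c 0 = (norm2 \<pi> g)\<^sup>2" unfolding norm2_power2 by (simp add: c_def power2_eq_square)
  ultimately show ?thesis by (simp add: d_def resolvent_form_def u_def mult.commute)
qed

lemma resolvent_form_bounded_if_has_Var:
  assumes f: "L2 \<pi> f" and v: "has_Var \<nu> \<pi> R f v"
  shows "\<exists>C. \<forall>lam>0. resolvent_form (centered f) lam \<le> C"
proof -
  let ?g = "centered f"
  note cf = centered_L2[OF f]
  have fm [measurable]: "f \<in> borel_measurable \<nu>" using f by measurable
  have V: "real n * var_path_avg \<nu> \<pi> R f n = (\<integral>X. (path_sum ?g n X)\<^sup>2 \<partial>chain) / real n" if n: "0 < n" for n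
  proof -
    have "(\<integral>X. path_avg f n X \<partial>chain) = (\<integral>x. f x \<partial>\<pi>)"
      unfolding path_avg_def
      using n integrable_chain_component[OF L2_integrable[OF f]] by (simp add: integral_chain_component)
    then have "var_path_avg \<nu> \<pi> R f n = (\<integral>X. (path_sum ?g n X / real n)\<^sup>2 \<partial>chain)"
      by (simp add: var_path_avg_def path_avg_centered[OF n])
    then show ?thesis using n by (simp add: power_divide power2_eq_square)
  qed
  obtain C where C: "\<And>n. \<bar>real n * var_path_avg \<nu> \<pi> R f n\<bar> \<le> C"
    using convergent_imp_Bseq[OF convergentI[OF v[unfolded has_Var_def]]] by (auto simp: Bseq_def)
  have "(\<integral>X. (path_sum ?g n X)\<^sup>2 \<partial>chain) \<le> C * real n" for n
  proof (cases "n = 0")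
    case False
    then show ?thesis using C[of n] V[of n] by (simp add: field_simps)
  qed (simp add: path_sum_def)
  from resolvent_form_bounded[OF cf this] show ?thesis by blast
qed

end

section \<open>Kernels with a symmetric jump density\<close>

lemma nn_integral_density_plus_atom:
  assumes sets: "sets M = sets N" and x: "x \<in> space N" and w [measurable]: "w \<in> borel_measurable N"
    and M: "\<And>B. B \<in> sets N \<Longrightarrow> emeasure M B = (\<integral>\<^sup>+y. w y * indicator B y \<partial>N) + r * indicator B x"
    and F: "F \<in> borel_measurable N"
  shows "(\<integral>\<^sup>+y. F y \<partial>M) = (\<integral>\<^sup>+y. w y * F y \<partial>N) + r * F x"
  using F
proof (induction F rule: borel_measurable_induct)
  have sp: "space M = space N" by (rule sets_eq_imp_space_eq[OF sets])
  have mM: "g \<in> borel_measurable M" if "g \<in> borel_measurable N" for g :: "_ \<Rightarrow> ennreal"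
    using that sets by (simp cong: measurable_cong_sets)
  {
    case (cong f g)
    have "(\<integral>\<^sup>+y. f y \<partial>M) = (\<integral>\<^sup>+y. g y \<partial>M)" "(\<integral>\<^sup>+y. w y * f y \<partial>N) = (\<integral>\<^sup>+y. w y * g y \<partial>N)"
      using cong(3) by (auto intro!: nn_integral_cong simp: sp)
    then show ?case using cong(3)[OF x] cong(4) by simp
  next
    case (set A)
    then show ?case using M[OF set] sets by simp
  next
    case (mult u c)
    then show ?case
      by (simp add: nn_integral_cmult mM distrib_left mult.left_commute[of _ c])
  next
    case (add u v)
    then show ?case
      by (simp add: nn_integral_add mM distrib_left ac_simps)
  next
    case (seq U)
    note [measurable] = seq.hyps(1)
    have inc: "incseq (\<lambda>i. w y * U i y)" for y
      using seq.hyps(3) by (auto simp: incseq_def le_fun_def intro!: mult_left_mono)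
    have "(\<integral>\<^sup>+y. (SUP i. U i) y \<partial>M) = (SUP i. \<integral>\<^sup>+y. U i y \<partial>M)"
      unfolding SUP_apply by (intro nn_integral_monotone_convergence_SUP seq mM)
    also have "\<dots> = (SUP i. (\<integral>\<^sup>+y. w y * U i y \<partial>N) + r * U i x)"
      using seq by simp
    also have "\<dots> = (SUP i. \<integral>\<^sup>+y. w y * U i y \<partial>N) + (SUP i. r * U i x)"
      using seq.hyps(3)
      by (intro ennreal_SUP_add) (auto simp: incseq_def le_fun_def intro!: mult_left_mono nn_integral_mono)
    also have "(SUP i. \<integral>\<^sup>+y. w y * U i y \<partial>N) = (\<integral>\<^sup>+y. (SUP i. w y * U i y) \<partial>N)"
      using inc by (intro nn_integral_monotone_convergence_SUP[symmetric]) (auto simp: incseq_def le_fun_def)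
    finally show ?case by (simp add: SUP_mult_left_ennreal image_comp)
  }
qed

text \<open>
  The state stays where it is with the mass left over, \<open>r x\<close>. The density is taken with respect to \<open>\<pi>\<close>
  and not with respect to the dominating measure \<open>\<nu>\<close>: the latter may fail to be \<open>\<sigma>\<close>-finite, whereas
  Fubini's theorem holds for \<open>\<pi>\<close>.
\<close>

definition has_jump_density ::
    "'a measure \<Rightarrow> 'a measure \<Rightarrow> ('a \<Rightarrow> 'a measure) \<Rightarrow> ('a \<Rightarrow> 'a \<Rightarrow> ennreal) \<Rightarrow> bool" where
  "has_jump_density \<nu> \<pi> R w \<longleftrightarrow>
    (\<lambda>(x, y). w x y) \<in> borel_measurable (\<nu> \<Otimes>\<^sub>M \<nu>) \<and>
    (\<forall>x\<in>space \<nu>. \<forall>y\<in>space \<nu>. w x y = w y x) \<and>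
    (\<exists>r\<in>borel_measurable \<nu>. AE x in \<pi>. \<forall>B\<in>sets \<nu>.
      emeasure (R x) B = (\<integral>\<^sup>+y. w x y * indicator B y \<partial>\<pi>) + r x * indicator B x)"

lemma reversible_if_jump_density:
  assumes pi: "\<pi> \<in> space (prob_algebra \<nu>)" and R: "R \<in> \<nu> \<rightarrow>\<^sub>M prob_algebra \<nu>"
    and w: "has_jump_density \<nu> \<pi> R w"
  shows "reversible_kernel \<nu> \<pi> R"
proof
  show "\<pi> \<in> space (prob_algebra \<nu>)" "R \<in> \<nu> \<rightarrow>\<^sub>M prob_algebra \<nu>" by fact+
  have s [measurable_cong]: "sets \<pi> = sets \<nu>" and pr: "prob_space \<pi>" using pi by (auto simp: space_prob_algebra)
  have sp: "space \<pi> = space \<nu>" by (rule sets_eq_imp_space_eq[OF s])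
  interpret prob_space \<pi> by (rule pr)
  interpret pp: pair_prob_space \<pi> \<pi> ..
  obtain r where [measurable]: "r \<in> borel_measurable \<nu>" and r: "AE x in \<pi>. \<forall>B\<in>sets \<nu>.
      emeasure (R x) B = (\<integral>\<^sup>+y. w x y * indicator B y \<partial>\<pi>) + r x * indicator B x"
    using w by (auto simp: has_jump_density_def)
  have wm: "(\<lambda>(x, y). w x y) \<in> borel_measurable (\<pi> \<Otimes>\<^sub>M \<pi>)"
    using w by (simp add: has_jump_density_def s cong: measurable_cong_sets sets_pair_measure_cong)
  note [measurable] = wm
  have sym: "w x y = w y x" if "x \<in> space \<nu>" "y \<in> space \<nu>" for x y
    using w that by (simp add: has_jump_density_def)
  have split: "(\<integral>\<^sup>+x. indicator A x * emeasure (R x) B \<partial>\<pi>) =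
      (\<integral>\<^sup>+x. \<integral>\<^sup>+y. indicator A x * (w x y * indicator B y) \<partial>\<pi> \<partial>\<pi>) + (\<integral>\<^sup>+x. r x * (indicator A x * indicator B x) \<partial>\<pi>)"
    if [measurable]: "A \<in> sets \<nu>" "B \<in> sets \<nu>" for A B
  proof -
    have "(\<integral>\<^sup>+x. indicator A x * emeasure (R x) B \<partial>\<pi>) =
        (\<integral>\<^sup>+x. (\<integral>\<^sup>+y. indicator A x * (w x y * indicator B y) \<partial>\<pi>) + r x * (indicator A x * indicator B x) \<partial>\<pi>)"
    proof (rule nn_integral_cong_AE)
      show "AE x in \<pi>. indicator A x * emeasure (R x) B =
          (\<integral>\<^sup>+y. indicator A x * (w x y * indicator B y) \<partial>\<pi>) + r x * (indicator A x * indicator B x)"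
        using r AE_space
      proof eventually_elim
        case (elim x)
        then have [measurable]: "x \<in> space \<pi>" by simp
        have "(\<integral>\<^sup>+y. indicator A x * (w x y * indicator B y) \<partial>\<pi>) = indicator A x * (\<integral>\<^sup>+y. w x y * indicator B y \<partial>\<pi>)"
          by (rule nn_integral_cmult) measurable
        then show ?case using elim(1)[rule_format, OF that(2)] by (simp add: distrib_left ac_simps)
      qed
    qed
    also have "\<dots> = (\<integral>\<^sup>+x. \<integral>\<^sup>+y. indicator A x * (w x y * indicator B y) \<partial>\<pi> \<partial>\<pi>) + (\<integral>\<^sup>+x. r x * (indicator A x * indicator B x) \<partial>\<pi>)"
      by (rule nn_integral_add) measurable
    finally show ?thesis .
  qed
  fix A B assume [measurable]: "A \<in> sets \<nu>" "B \<in> sets \<nu>"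
  have "(\<integral>\<^sup>+x. \<integral>\<^sup>+y. indicator A x * (w x y * indicator B y) \<partial>\<pi> \<partial>\<pi>) =
      (\<integral>\<^sup>+y. \<integral>\<^sup>+x. indicator A x * (w x y * indicator B y) \<partial>\<pi> \<partial>\<pi>)"
    by (rule pp.Fubini') measurable
  also have "\<dots> = (\<integral>\<^sup>+x. \<integral>\<^sup>+y. indicator B x * (w x y * indicator A y) \<partial>\<pi> \<partial>\<pi>)"
    by (intro nn_integral_cong) (simp add: sym sp ac_simps)
  finally show "(\<integral>\<^sup>+x. indicator A x * emeasure (R x) B \<partial>\<pi>) = (\<integral>\<^sup>+x. indicator B x * emeasure (R x) A \<partial>\<pi>)"
    by (simp add: split ac_simps)
qed

text \<open>
  The atom at \<open>x\<close> does not contribute because the integrand vanishes on the diagonal.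
\<close>

lemma dirichlet_jump_density:
  assumes R: "reversible_kernel \<nu> \<pi> R" and w: "has_jump_density \<nu> \<pi> R w" and h: "L2 \<pi> h"
  shows "ennreal (2 * reversible_kernel.dirichlet \<pi> R h) = (\<integral>\<^sup>+x. \<integral>\<^sup>+y. w x y * ennreal ((h x - h y)\<^sup>2) \<partial>\<pi> \<partial>\<pi>)"
proof -
  interpret reversible_kernel \<nu> \<pi> R by fact
  have hm [measurable]: "h \<in> borel_measurable \<nu>" using h by measurable
  obtain r where [measurable]: "r \<in> borel_measurable \<nu>" and r: "AE x in \<pi>. \<forall>B\<in>sets \<nu>.
      emeasure (R x) B = (\<integral>\<^sup>+y. w x y * indicator B y \<partial>\<pi>) + r x * indicator B x"
    using w by (auto simp: has_jump_density_def)
  have wm [measurable]: "(\<lambda>(x, y). w x y) \<in> borel_measurable (\<nu> \<Otimes>\<^sub>M \<nu>)"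
    using w by (simp add: has_jump_density_def)
  have "ennreal (2 * dirichlet h) = (\<integral>\<^sup>+z. ennreal ((h (fst z) - h (snd z))\<^sup>2) \<partial>joint)"
  proof -
    have "2 * dirichlet h = (\<integral>z. (h (fst z) - h (snd z))\<^sup>2 \<partial>joint)"
      using dirichlet_eq_joint(2)[OF h] by simp
    then show ?thesis using nn_integral_eq_integral[OF dirichlet_eq_joint(1)[OF h]] by simp
  qed
  also have "\<dots> = (\<integral>\<^sup>+x. \<integral>\<^sup>+y. ennreal ((h x - h y)\<^sup>2) \<partial>R x \<partial>\<pi>)"
    by (subst nn_integral_joint) auto
  also have "\<dots> = (\<integral>\<^sup>+x. \<integral>\<^sup>+y. w x y * ennreal ((h x - h y)\<^sup>2) \<partial>\<pi> \<partial>\<pi>)"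
  proof (rule nn_integral_cong_AE)
    show "AE x in \<pi>. (\<integral>\<^sup>+y. ennreal ((h x - h y)\<^sup>2) \<partial>R x) = (\<integral>\<^sup>+y. w x y * ennreal ((h x - h y)\<^sup>2) \<partial>\<pi>)"
      using r AE_space
    proof eventually_elim
      case (elim x)
      then have [measurable]: "x \<in> space \<nu>" by simp
      have "(\<integral>\<^sup>+y. ennreal ((h x - h y)\<^sup>2) \<partial>R x) =
          (\<integral>\<^sup>+y. w x y * ennreal ((h x - h y)\<^sup>2) \<partial>\<pi>) + r x * ennreal ((h x - h x)\<^sup>2)"
        by (rule nn_integral_density_plus_atom[where F="\<lambda>y. ennreal ((h x - h y)\<^sup>2)"])
           (use elim in \<open>auto simp: sets_R\<close>)
      then show ?case by simp
    qed
  qed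
  finally show ?thesis .
qed

lemma dirichlet_le_if_jump_density_le:
  assumes A: "reversible_kernel \<nu> \<pi> A" "has_jump_density \<nu> \<pi> A a"
    and B: "reversible_kernel \<nu> \<pi> B" "has_jump_density \<nu> \<pi> B b"
    and c: "0 \<le> c" and le: "\<And>x y. x \<in> space \<nu> \<Longrightarrow> y \<in> space \<nu> \<Longrightarrow> a x y \<le> ennreal c * b x y"
    and h: "L2 \<pi> h"
  shows "reversible_kernel.dirichlet \<pi> A h \<le> c * reversible_kernel.dirichlet \<pi> B h"
proof -
  interpret A: reversible_kernel \<nu> \<pi> A by fact
  interpret B: reversible_kernel \<nu> \<pi> B by fact
  have [measurable]: "h \<in> borel_measurable \<nu>" using h by (rule A.L2_measurable_nu)
  have bm [measurable]: "(\<lambda>(x, y). b x y) \<in> borel_measurable (\<nu> \<Otimes>\<^sub>M \<nu>)"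
    using B(2) by (simp add: has_jump_density_def)
  have "ennreal (2 * A.dirichlet h) = (\<integral>\<^sup>+x. \<integral>\<^sup>+y. a x y * ennreal ((h x - h y)\<^sup>2) \<partial>\<pi> \<partial>\<pi>)"
    by (rule dirichlet_jump_density[OF A h])
  also have "\<dots> \<le> (\<integral>\<^sup>+x. \<integral>\<^sup>+y. ennreal c * (b x y * ennreal ((h x - h y)\<^sup>2)) \<partial>\<pi> \<partial>\<pi>)"
    unfolding mult.assoc[symmetric]
    by (intro nn_integral_mono mult_right_mono le) auto
  also have "\<dots> = ennreal c * (\<integral>\<^sup>+x. \<integral>\<^sup>+y. b x y * ennreal ((h x - h y)\<^sup>2) \<partial>\<pi> \<partial>\<pi>)"
  proof -
    have "(\<integral>\<^sup>+x. \<integral>\<^sup>+y. ennreal c * (b x y * ennreal ((h x - h y)\<^sup>2)) \<partial>\<pi> \<partial>\<pi>) =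
        (\<integral>\<^sup>+x. ennreal c * (\<integral>\<^sup>+y. b x y * ennreal ((h x - h y)\<^sup>2) \<partial>\<pi>) \<partial>\<pi>)"
      by (intro nn_integral_cong nn_integral_cmult) measurable
    also have "\<dots> = ennreal c * (\<integral>\<^sup>+x. \<integral>\<^sup>+y. b x y * ennreal ((h x - h y)\<^sup>2) \<partial>\<pi> \<partial>\<pi>)"
      by (rule nn_integral_cmult) measurable
    finally show ?thesis .
  qed
  also have "\<dots> = ennreal (c * (2 * B.dirichlet h))"
    using dirichlet_jump_density[OF B h] c by (simp add: ennreal_mult B.dirichlet_nonneg h)
  finally show ?thesis
    using c B.dirichlet_nonneg[OF h] by (simp add: ennreal_le_iff)
qed

section \<open>Lazy and accept-reject kernels\<close>

lemma lazy_kernel_kernel: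
  assumes e: "0 \<le> \<epsilon>" "\<epsilon> \<le> 1" and R: "R \<in> \<nu> \<rightarrow>\<^sub>M prob_algebra \<nu>"
  shows "lazy_kernel \<nu> \<epsilon> R \<in> \<nu> \<rightarrow>\<^sub>M prob_algebra \<nu>"
proof -
  have [measurable]: "R \<in> \<nu> \<rightarrow>\<^sub>M subprob_algebra \<nu>" by (rule measurable_prob_algebraD[OF R])
  have Rx: "sets (R x) = sets \<nu>" "prob_space (R x)" if "x \<in> space \<nu>" for x
    using measurable_space[OF R that] by (auto simp: space_prob_algebra)
  have sets: "sets (lazy_kernel \<nu> \<epsilon> R x) = sets \<nu>" if "x \<in> space \<nu>" for x
    unfolding lazy_kernel_def using Rx[OF that] by (intro sets_bind) auto
  have prob: "prob_space (lazy_kernel \<nu> \<epsilon> R x)" if x: "x \<in> space \<nu>" for x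
  proof
    have "emeasure (R x) (space \<nu>) = 1"
      using prob_space.emeasure_space_1[OF Rx(2)[OF x]] sets_eq_imp_space_eq[OF Rx(1)[OF x]] by simp
    then have "emeasure (lazy_kernel \<nu> \<epsilon> R x) (space \<nu>) = ennreal \<epsilon> + ennreal (1 - \<epsilon>)"
      using emeasure_lazy_kernel[OF e R x sets.top] x by simp
    also have "\<dots> = 1" using e by (simp flip: ennreal_plus)
    finally show "emeasure (lazy_kernel \<nu> \<epsilon> R x) (space (lazy_kernel \<nu> \<epsilon> R x)) = 1"
      using sets_eq_imp_space_eq[OF sets[OF x]] by simp
  qed
  have "lazy_kernel \<nu> \<epsilon> R \<in> \<nu> \<rightarrow>\<^sub>M subprob_algebra \<nu>"
  proof (rule measurable_subprob_algebra)
    fix A assume A [measurable]: "A \<in> sets \<nu>"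
    have "(\<lambda>x. ennreal \<epsilon> * indicator A x + ennreal (1 - \<epsilon>) * emeasure (R x) A) \<in> borel_measurable \<nu>"
      by measurable
    then show "(\<lambda>x. emeasure (lazy_kernel \<nu> \<epsilon> R x) A) \<in> borel_measurable \<nu>"
      by (subst measurable_cong[OF emeasure_lazy_kernel[OF e R _ A]])
  qed (simp_all add: sets prob_space_imp_subprob_space prob)
  then show ?thesis by (intro measurable_prob_algebraI prob)
qed

lemma has_jump_density_lazy:
  assumes e: "0 \<le> \<epsilon>" "\<epsilon> \<le> 1" and R: "R \<in> \<nu> \<rightarrow>\<^sub>M prob_algebra \<nu>" and pi: "sets \<pi> = sets \<nu>"
    and w: "has_jump_density \<nu> \<pi> R w"
  shows "has_jump_density \<nu> \<pi> (lazy_kernel \<nu> \<epsilon> R) (\<lambda>x y. ennreal (1 - \<epsilon>) * w x y)"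
proof -
  note [measurable_cong] = pi
  obtain r where rm [measurable]: "r \<in> borel_measurable \<nu>" and r: "AE x in \<pi>. \<forall>B\<in>sets \<nu>.
      emeasure (R x) B = (\<integral>\<^sup>+y. w x y * indicator B y \<partial>\<pi>) + r x * indicator B x"
    using w by (auto simp: has_jump_density_def)
  have wm [measurable]: "(\<lambda>(x, y). w x y) \<in> borel_measurable (\<nu> \<Otimes>\<^sub>M \<nu>)"
    using w by (simp add: has_jump_density_def)
  have "AE x in \<pi>. \<forall>B\<in>sets \<nu>. emeasure (lazy_kernel \<nu> \<epsilon> R x) B =
      (\<integral>\<^sup>+y. ennreal (1 - \<epsilon>) * w x y * indicator B y \<partial>\<pi>) + (ennreal \<epsilon> + ennreal (1 - \<epsilon>) * r x) * indicator B x"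
    using r AE_space
  proof eventually_elim
    case (elim x)
    then have x [measurable]: "x \<in> space \<nu>" using sets_eq_imp_space_eq[OF pi] by simp
    show ?case
    proof
      fix B assume B [measurable]: "B \<in> sets \<nu>"
      have "(\<integral>\<^sup>+y. ennreal (1 - \<epsilon>) * w x y * indicator B y \<partial>\<pi>) =
          ennreal (1 - \<epsilon>) * (\<integral>\<^sup>+y. w x y * indicator B y \<partial>\<pi>)"
        unfolding mult.assoc by (rule nn_integral_cmult) measurable
      then show "emeasure (lazy_kernel \<nu> \<epsilon> R x) B = (\<integral>\<^sup>+y. ennreal (1 - \<epsilon>) * w x y * indicator B y \<partial>\<pi>)
          + (ennreal \<epsilon> + ennreal (1 - \<epsilon>) * r x) * indicator B x"
        using elim(1)[rule_format, OF B] emeasure_lazy_kernel[OF e R x B]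
        by (simp add: distrib_left distrib_right ac_simps)
    qed
  qed
  moreover have "(\<lambda>x. ennreal \<epsilon> + ennreal (1 - \<epsilon>) * r x) \<in> borel_measurable \<nu>" by measurable
  ultimately have "\<exists>r\<in>borel_measurable \<nu>. AE x in \<pi>. \<forall>B\<in>sets \<nu>. emeasure (lazy_kernel \<nu> \<epsilon> R x) B =
      (\<integral>\<^sup>+y. ennreal (1 - \<epsilon>) * w x y * indicator B y \<partial>\<pi>) + r x * indicator B x"
    by (intro bexI[of _ "\<lambda>x. ennreal \<epsilon> + ennreal (1 - \<epsilon>) * r x"])
  moreover have "(\<lambda>(x, y). ennreal (1 - \<epsilon>) * w x y) \<in> borel_measurable (\<nu> \<Otimes>\<^sub>M \<nu>)" by measurable
  moreover have "\<forall>x\<in>space \<nu>. \<forall>y\<in>space \<nu>. ennreal (1 - \<epsilon>) * w x y = ennreal (1 - \<epsilon>) * w y x"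
    using w by (simp add: has_jump_density_def)
  ultimately show ?thesis unfolding has_jump_density_def by blast
qed

lemma accept_kernel_kernel:
  assumes Q: "Q \<in> \<nu> \<rightarrow>\<^sub>M prob_algebra \<nu>"
    and \<alpha>: "(\<lambda>(x, y). \<alpha> x y) \<in> borel_measurable (\<nu> \<Otimes>\<^sub>M \<nu>)"
    and \<alpha>01: "\<And>x y. x \<in> space \<nu> \<Longrightarrow> y \<in> space \<nu> \<Longrightarrow> 0 \<le> \<alpha> x y \<and> \<alpha> x y \<le> 1"
  shows "accept_kernel \<nu> \<alpha> Q \<in> \<nu> \<rightarrow>\<^sub>M prob_algebra \<nu>"
    and "(\<lambda>x. \<integral>\<^sup>+y. ennreal (1 - \<alpha> x y) \<partial>Q x) \<in> borel_measurable \<nu>"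
proof -
  note \<alpha> [measurable]
  have Qm [measurable]: "Q \<in> \<nu> \<rightarrow>\<^sub>M subprob_algebra \<nu>" by (rule measurable_prob_algebraD[OF Q])
  have Qx: "sets (Q x) = sets \<nu>" "prob_space (Q x)" if "x \<in> space \<nu>" for x
    using measurable_space[OF Q that] by (auto simp: space_prob_algebra)
  have spQ: "space (Q x) = space \<nu>" if "x \<in> space \<nu>" for x by (rule sets_eq_imp_space_eq[OF Qx(1)[OF that]])
  have \<alpha>x: "\<alpha> x \<in> borel_measurable \<nu>" if "x \<in> space \<nu>" for x
    using measurable_Pair2[OF \<alpha> that] by simp
  note em = emeasure_accept_kernel[OF Q _ _ \<alpha>x \<alpha>01]
  have sets: "sets (accept_kernel \<nu> \<alpha> Q x) = sets \<nu>" if "x \<in> space \<nu>" for x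
    unfolding accept_kernel_def using that by (intro sets_bind) (auto simp: spQ)
  have prob: "prob_space (accept_kernel \<nu> \<alpha> Q x)" if x: "x \<in> space \<nu>" for x
  proof
    have [measurable]: "\<alpha> x \<in> borel_measurable (Q x)" using \<alpha>x[OF x] Qx(1)[OF x] by (simp cong: measurable_cong_sets)
    have "emeasure (accept_kernel \<nu> \<alpha> Q x) (space \<nu>) =
        (\<integral>\<^sup>+y. ennreal (\<alpha> x y) * indicator (space \<nu>) y \<partial>Q x) + (\<integral>\<^sup>+y. ennreal (1 - \<alpha> x y) \<partial>Q x)"
      using em[of x "space \<nu>"] x by simp
    also have "(\<integral>\<^sup>+y. ennreal (\<alpha> x y) * indicator (space \<nu>) y \<partial>Q x) = (\<integral>\<^sup>+y. ennreal (\<alpha> x y) \<partial>Q x)"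
      by (rule nn_integral_cong) (simp add: spQ x)
    also have "\<dots> + (\<integral>\<^sup>+y. ennreal (1 - \<alpha> x y) \<partial>Q x) = (\<integral>\<^sup>+y. ennreal (\<alpha> x y) + ennreal (1 - \<alpha> x y) \<partial>Q x)"
      by (rule nn_integral_add[symmetric]) measurable
    also have "\<dots> = (\<integral>\<^sup>+y. 1 \<partial>Q x)"
      using \<alpha>01[OF x] by (intro nn_integral_cong) (simp add: spQ x flip: ennreal_plus)
    also have "\<dots> = 1" using prob_space.emeasure_space_1[OF Qx(2)[OF x]] by simp
    finally show "emeasure (accept_kernel \<nu> \<alpha> Q x) (space (accept_kernel \<nu> \<alpha> Q x)) = 1"
      using sets_eq_imp_space_eq[OF sets[OF x]] by simp
  qed
  show r: "(\<lambda>x. \<integral>\<^sup>+y. ennreal (1 - \<alpha> x y) \<partial>Q x) \<in> borel_measurable \<nu>"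
    by (rule nn_integral_measurable_subprob_algebra2[OF _ Qm]) measurable
  note [measurable] = r
  have "accept_kernel \<nu> \<alpha> Q \<in> \<nu> \<rightarrow>\<^sub>M subprob_algebra \<nu>"
  proof (rule measurable_subprob_algebra)
    fix A assume A [measurable]: "A \<in> sets \<nu>"
    have [measurable]: "(\<lambda>x. \<integral>\<^sup>+y. ennreal (\<alpha> x y) * indicator A y \<partial>Q x) \<in> borel_measurable \<nu>"
      by (rule nn_integral_measurable_subprob_algebra2[OF _ Qm]) measurable
    have "(\<lambda>x. (\<integral>\<^sup>+y. ennreal (\<alpha> x y) * indicator A y \<partial>Q x) + (\<integral>\<^sup>+y. ennreal (1 - \<alpha> x y) \<partial>Q x) * indicator A x)
        \<in> borel_measurable \<nu>" by measurable
    then show "(\<lambda>x. emeasure (accept_kernel \<nu> \<alpha> Q x) A) \<in> borel_measurable \<nu>"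
      by (rule measurable_cong[THEN iffD1, rotated]) (rule em[OF _ A, symmetric])
  qed (simp_all add: sets prob_space_imp_subprob_space prob)
  then show "accept_kernel \<nu> \<alpha> Q \<in> \<nu> \<rightarrow>\<^sub>M prob_algebra \<nu>" by (intro measurable_prob_algebraI prob)
qed

text \<open>
  The density of accepted moves is \<open>q x y * \<alpha> x y\<close> with respect to \<open>\<nu>\<close>, and division by \<open>p y\<close> changes the
  reference measure to \<open>\<pi>\<close>. Setting it to \<open>0\<close> where \<open>p\<close> vanishes makes it symmetric everywhere.
\<close>

definition accept_density :: "('a \<Rightarrow> real) \<Rightarrow> ('a \<Rightarrow> 'a \<Rightarrow> real) \<Rightarrow> ('a \<Rightarrow> 'a \<Rightarrow> real) \<Rightarrow> 'a \<Rightarrow> 'a \<Rightarrow> ennreal" where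
  "accept_density p q \<alpha> x y = (if p x = 0 \<or> p y = 0 then 0 else ennreal (q x y * \<alpha> x y / p y))"

lemma accept_density_mono:
  assumes "0 \<le> p y" "0 \<le> q x y" "\<alpha> x y \<le> c * \<beta> x y" "0 \<le> c"
  shows "accept_density p q \<alpha> x y \<le> ennreal c * accept_density p q \<beta> x y"
proof -
  have "q x y * \<alpha> x y / p y \<le> c * (q x y * \<beta> x y / p y)"
    using mult_left_mono[OF assms(3,2)] assms(1) by (simp add: divide_right_mono mult.left_commute)
  then show ?thesis
    using assms by (simp add: accept_density_def ennreal_leI flip: ennreal_mult')
qed

text \<open>
  By the balance condition a state with \<open>p x > 0\<close> almost surely never accepts a move to a state with
  \<open>p y = 0\<close>, so the accepted moves are absolutely continuous with respect to \<open>\<pi>\<close>.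
\<close>

lemma has_jump_density_accept_kernel:
  assumes p [measurable]: "p \<in> borel_measurable \<nu>" and p0: "\<And>x. x \<in> space \<nu> \<Longrightarrow> 0 \<le> p x"
    and pi: "\<pi> = density \<nu> (\<lambda>x. ennreal (p x))"
    and q: "(\<lambda>(x, y). q x y) \<in> borel_measurable (\<nu> \<Otimes>\<^sub>M \<nu>)"
    and q0: "\<And>x y. x \<in> space \<nu> \<Longrightarrow> y \<in> space \<nu> \<Longrightarrow> 0 \<le> q x y"
    and Q: "Q \<in> \<nu> \<rightarrow>\<^sub>M prob_algebra \<nu>" "\<And>x. x \<in> space \<nu> \<Longrightarrow> Q x = density \<nu> (\<lambda>y. ennreal (q x y))"
    and \<alpha>: "(\<lambda>(x, y). \<alpha> x y) \<in> borel_measurable (\<nu> \<Otimes>\<^sub>M \<nu>)"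
    and \<alpha>01: "\<And>x y. x \<in> space \<nu> \<Longrightarrow> y \<in> space \<nu> \<Longrightarrow> 0 \<le> \<alpha> x y \<and> \<alpha> x y \<le> 1"
    and sym: "\<And>x y. x \<in> space \<nu> \<Longrightarrow> y \<in> space \<nu> \<Longrightarrow> p x * q x y * \<alpha> x y = p y * q y x * \<alpha> y x"
  shows "has_jump_density \<nu> \<pi> (accept_kernel \<nu> \<alpha> Q) (accept_density p q \<alpha>)"
  unfolding has_jump_density_def
proof (intro conjI ballI bexI)
  note q [measurable] \<alpha> [measurable]
  show wm: "(\<lambda>(x, y). accept_density p q \<alpha> x y) \<in> borel_measurable (\<nu> \<Otimes>\<^sub>M \<nu>)"
    unfolding accept_density_def by measurable
  show "accept_density p q \<alpha> x y = accept_density p q \<alpha> y x" if "x \<in> space \<nu>" "y \<in> space \<nu>" for x y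
  proof (cases "p x = 0 \<or> p y = 0")
    case False
    then have "q x y * \<alpha> x y / p y = q y x * \<alpha> y x / p x"
      using sym[OF that] by (simp add: frac_eq_eq ac_simps)
    then show ?thesis by (auto simp: accept_density_def)
  qed (auto simp: accept_density_def)
  show "(\<lambda>x. \<integral>\<^sup>+y. ennreal (1 - \<alpha> x y) \<partial>Q x) \<in> borel_measurable \<nu>"
    by (rule accept_kernel_kernel(2)[OF Q(1) \<alpha> \<alpha>01])
  have "AE x in \<pi>. 0 < p x"
    unfolding pi by (subst AE_density) auto
  then show "AE x in \<pi>. \<forall>B\<in>sets \<nu>. emeasure (accept_kernel \<nu> \<alpha> Q x) B =
      (\<integral>\<^sup>+y. accept_density p q \<alpha> x y * indicator B y \<partial>\<pi>) + (\<integral>\<^sup>+y. ennreal (1 - \<alpha> x y) \<partial>Q x) * indicator B x"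
    using AE_space
  proof eventually_elim
    case (elim x)
    then have x [measurable]: "x \<in> space \<nu>" by (simp add: pi)
    have [measurable]: "\<alpha> x \<in> borel_measurable \<nu>" "q x \<in> borel_measurable \<nu>"
        "accept_density p q \<alpha> x \<in> borel_measurable \<nu>"
      using measurable_Pair2[OF \<alpha> x] measurable_Pair2[OF q x] measurable_Pair2[OF wm x] by simp_all
    show ?case
    proof
      fix B assume B [measurable]: "B \<in> sets \<nu>"
      have "(\<integral>\<^sup>+y. ennreal (\<alpha> x y) * indicator B y \<partial>Q x) = (\<integral>\<^sup>+y. ennreal (q x y) * (ennreal (\<alpha> x y) * indicator B y) \<partial>\<nu>)"
        unfolding Q(2)[OF x] by (rule nn_integral_density) measurable
      also have "\<dots> = (\<integral>\<^sup>+y. ennreal (p y) * (accept_density p q \<alpha> x y * indicator B y) \<partial>\<nu>)"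
      proof (rule nn_integral_cong)
        fix y assume y: "y \<in> space \<nu>"
        have "ennreal (q x y) * ennreal (\<alpha> x y) = ennreal (p y) * accept_density p q \<alpha> x y"
        proof (cases "p y = 0")
          case True
          then have "p x * q x y * \<alpha> x y = 0" using sym[OF x y] by simp
          then show ?thesis using elim(1) True by (auto simp: accept_density_def)
        next
          case False
          then have "0 < p y" using p0[OF y] by simp
          then show ?thesis
            using elim(1) q0[OF x y] \<alpha>01[OF x y] by (simp add: accept_density_def flip: ennreal_mult)
        qed
        then show "ennreal (q x y) * (ennreal (\<alpha> x y) * indicator B y) =
            ennreal (p y) * (accept_density p q \<alpha> x y * indicator B y)"
          by (simp flip: mult.assoc)
      qed
      also have "\<dots> = (\<integral>\<^sup>+y. accept_density p q \<alpha> x y * indicator B y \<partial>\<pi>)"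
        unfolding pi by (rule nn_integral_density[symmetric]) measurable
      finally have E: "(\<integral>\<^sup>+y. ennreal (\<alpha> x y) * indicator B y \<partial>Q x) =
          (\<integral>\<^sup>+y. accept_density p q \<alpha> x y * indicator B y \<partial>\<pi>)" .
      show "emeasure (accept_kernel \<nu> \<alpha> Q x) B =
          (\<integral>\<^sup>+y. accept_density p q \<alpha> x y * indicator B y \<partial>\<pi>) + (\<integral>\<^sup>+y. ennreal (1 - \<alpha> x y) \<partial>Q x) * indicator B x"
        unfolding E[symmetric]
        by (rule emeasure_accept_kernel[where \<alpha>=\<alpha>, OF Q(1) x B _ \<alpha>01[OF x]]) measurable
    qed
  qed
qed

section \<open>The Metropolis-Hastings and Barker acceptance rules\<close>

lemma mh_accept_bounds:
  assumes "0 \<le> p x * q x y" "0 \<le> p y * q y x"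
  shows "0 \<le> mh_accept p q x y" "mh_accept p q x y \<le> 1"
  using assms by (auto simp: mh_accept_def)

lemma barker_accept_bounds:
  assumes "0 \<le> p x * q x y" "0 \<le> p y * q y x"
  shows "0 \<le> barker_accept p q x y" "barker_accept p q x y \<le> 1"
  using assms by (auto simp: barker_accept_def divide_le_eq_1)

lemma mh_accept_flow:
  assumes "0 \<le> p x * q x y" "0 \<le> p y * q y x"
  shows "p x * q x y * mh_accept p q x y = min (p x * q x y) (p y * q y x)"
proof -
  have "a * (if a = 0 then 1 else min 1 (b / a)) = min a b" if "0 \<le> a" "0 \<le> b" for a b :: real
    using that by (cases "a = 0") (auto simp: min_mult_distrib_left)
  from this[OF assms] show ?thesis by (simp only: mh_accept_def)
qed

lemma mh_accept_balance:
  assumes "0 \<le> p x * q x y" "0 \<le> p y * q y x"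
  shows "p x * q x y * mh_accept p q x y = p y * q y x * mh_accept p q y x"
  using assms by (simp add: mh_accept_flow min.commute)

lemma barker_accept_balance:
  assumes "0 \<le> p x * q x y" "0 \<le> p y * q y x"
  shows "p x * q x y * barker_accept p q x y = p y * q y x * barker_accept p q y x"
proof -
  have "a * (if b + a = 0 then 1 else b / (b + a)) = b * (if a + b = 0 then 1 else a / (a + b))"
    if "0 \<le> a" "0 \<le> b" for a b :: real
    using that by (auto simp: add.commute add_nonneg_eq_0_iff)
  from this[OF assms] show ?thesis by (simp only: barker_accept_def)
qed

text \<open>
  This and the next lemma are the two halves of \<open>b / (a + b) \<le> min 1 (b / a) \<le> 2 * b / (a + b)\<close>, with
  \<open>a = p x * q x y\<close> and \<open>b = p y * q y x\<close>.
\<close>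

lemma barker_le_mh:
  assumes "0 \<le> p x * q x y" "0 \<le> p y * q y x"
  shows "barker_accept p q x y \<le> mh_accept p q x y"
proof (cases "p x * q x y = 0")
  case False
  then have a: "0 < p x * q x y" using assms by linarith
  then have "(p y * q y x) / (p y * q y x + p x * q x y) \<le> (p y * q y x) / (p x * q x y)"
    using assms by (intro divide_left_mono) (auto intro!: mult_pos_pos add_nonneg_pos)
  then show ?thesis
    using barker_accept_bounds(2)[OF assms] False a assms by (auto simp: mh_accept_def barker_accept_def)
qed (use barker_accept_bounds[OF assms] in \<open>auto simp: mh_accept_def\<close>)

lemma mh_le_twice_barker:
  assumes "0 \<le> p x * q x y" "0 \<le> p y * q y x"
  shows "mh_accept p q x y \<le> 2 * barker_accept p q x y"
proof (cases "p x * q x y = 0")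
  case True
  then show ?thesis by (auto simp: mh_accept_def barker_accept_def)
next
  case False
  have "min 1 (b / a) \<le> 2 * (b / (b + a))" if "0 < a" "0 \<le> b" for a b :: real
  proof (cases "a \<le> b")
    case True
    then show ?thesis using that by (simp add: min_def le_divide_eq)
  next
    case False
    have "b * (b + a) \<le> b * (2 * a)" using False that by (intro mult_left_mono) auto
    then have "b / a * (b + a) \<le> 2 * b" using that by (simp add: field_simps)
    then have "b / a \<le> 2 * b / (b + a)" using that by (subst le_divide_eq) auto
    then show ?thesis by simp
  qed
  moreover have "p y * q y x + p x * q x y \<noteq> 0" "0 < p x * q x y" using False assms by linarith+
  ultimately show ?thesis
    using False assms(2) unfolding mh_accept_def barker_accept_def by simp
qed

section \<open>Asymptotic variances of the three algorithms\<close>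

theorem theorem4:
  fixes \<nu> \<pi> :: "'a measure" and p :: "'a \<Rightarrow> real"
    and Q :: "'a \<Rightarrow> 'a measure" and q :: "'a \<Rightarrow> 'a \<Rightarrow> real"
    and f :: "'a \<Rightarrow> real"
  assumes p_measurable: "p \<in> borel_measurable \<nu>"
    and p_nonneg: "\<And>x. x \<in> space \<nu> \<Longrightarrow> 0 \<le> p x"
    and target: "prob_space \<pi>" "\<pi> = density \<nu> (\<lambda>x. ennreal (p x))"
    and q_measurable: "(\<lambda>(x, y). q x y) \<in> borel_measurable (\<nu> \<Otimes>\<^sub>M \<nu>)"
    and q_nonneg: "\<And>x y. x \<in> space \<nu> \<Longrightarrow> y \<in> space \<nu> \<Longrightarrow> 0 \<le> q x y"
    and proposal: "Q \<in> \<nu> \<rightarrow>\<^sub>M prob_algebra \<nu>"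
      "\<And>x. x \<in> space \<nu> \<Longrightarrow> Q x = density \<nu> (\<lambda>y. ennreal (q x y))"
    and irreducible: "irreducible_kernel \<nu> Q"
    and ergodic: "ergodic_kernel \<nu> \<pi> (mh_kernel \<nu> p q Q)"
    and f_L2: "f \<in> borel_measurable \<pi>" "integrable \<pi> (\<lambda>x. (f x)\<^sup>2)"
    and CLT_MH: "CLT_holds \<nu> \<pi> (mh_kernel \<nu> p q Q) f"
    and Var_MH: "has_Var \<nu> \<pi> (mh_kernel \<nu> p q Q) f (asymp_var \<nu> \<pi> (mh_kernel \<nu> p q Q) f)"
  shows "(\<forall>\<epsilon>\<in>{0<..<1}.
        CLT_holds \<nu> \<pi> (lazy_kernel \<nu> \<epsilon> (mh_kernel \<nu> p q Q)) f \<and>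
        asymp_var \<nu> \<pi> (lazy_kernel \<nu> \<epsilon> (mh_kernel \<nu> p q Q)) f =
          1 / (1 - \<epsilon>) * asymp_var \<nu> \<pi> (mh_kernel \<nu> p q Q) f + \<epsilon> / (1 - \<epsilon>) * stationary_var \<pi> f) \<and>
    CLT_holds \<nu> \<pi> (barker_kernel \<nu> p q Q) f \<and>
    asymp_var \<nu> \<pi> (mh_kernel \<nu> p q Q) f \<le> asymp_var \<nu> \<pi> (barker_kernel \<nu> p q Q) f \<and>
    asymp_var \<nu> \<pi> (barker_kernel \<nu> p q Q) f
      \<le> asymp_var \<nu> \<pi> (lazy_kernel \<nu> (1/2) (mh_kernel \<nu> p q Q)) f \<and>
    asymp_var \<nu> \<pi> (lazy_kernel \<nu> (1/2) (mh_kernel \<nu> p q Q)) f =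
      2 * asymp_var \<nu> \<pi> (mh_kernel \<nu> p q Q) f + stationary_var \<pi> f"
proof -
  let ?P = "mh_kernel \<nu> p q Q" and ?B = "barker_kernel \<nu> p q Q"
  let ?L = "\<lambda>\<epsilon>. lazy_kernel \<nu> \<epsilon> (mh_kernel \<nu> p q Q)"
  note [measurable] = p_measurable q_measurable
  have pi: "\<pi> \<in> space (prob_algebra \<nu>)" using target by (simp add: space_prob_algebra)
  have sets_pi: "sets \<pi> = sets \<nu>" using target by simp
  have pq: "0 \<le> p x * q x y" if "x \<in> space \<nu>" "y \<in> space \<nu>" for x y
    using that p_nonneg q_nonneg by simp
  have mh_bal: "p x * q x y * mh_accept p q x y = p y * q y x * mh_accept p q y x"
    and ba_bal: "p x * q x y * barker_accept p q x y = p y * q y x * barker_accept p q y x"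
    if "x \<in> space \<nu>" "y \<in> space \<nu>" for x y
    using mh_accept_balance[of p x q y] barker_accept_balance[of p x q y] pq[of x y] pq[of y x] that by blast+
  have qs: "(\<lambda>(x, y). q y x) \<in> borel_measurable (\<nu> \<Otimes>\<^sub>M \<nu>)"
    using measurable_compose[OF measurable_pair_swap' q_measurable] by (simp add: split_beta')
  note [measurable] = qs
  have mh_m: "(\<lambda>(x, y). mh_accept p q x y) \<in> borel_measurable (\<nu> \<Otimes>\<^sub>M \<nu>)"
    unfolding mh_accept_def by measurable
  have ba_m: "(\<lambda>(x, y). barker_accept p q x y) \<in> borel_measurable (\<nu> \<Otimes>\<^sub>M \<nu>)"
    unfolding barker_accept_def by measurable
  have mh01: "0 \<le> mh_accept p q x y \<and> mh_accept p q x y \<le> 1" if "x \<in> space \<nu>" "y \<in> space \<nu>" for x y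
    using mh_accept_bounds[of p x q y] pq[of x y] pq[of y x] that by blast
  have ba01: "0 \<le> barker_accept p q x y \<and> barker_accept p q x y \<le> 1" if "x \<in> space \<nu>" "y \<in> space \<nu>" for x y
    using barker_accept_bounds[of p x q y] pq[of x y] pq[of y x] that by blast
  let ?wP = "accept_density p q (mh_accept p q)" and ?wB = "accept_density p q (barker_accept p q)"
  have PK: "?P \<in> \<nu> \<rightarrow>\<^sub>M prob_algebra \<nu>"
    unfolding mh_kernel_def by (rule accept_kernel_kernel(1)[OF proposal(1) mh_m mh01])
  have BK: "?B \<in> \<nu> \<rightarrow>\<^sub>M prob_algebra \<nu>"
    unfolding barker_kernel_def by (rule accept_kernel_kernel(1)[OF proposal(1) ba_m ba01])
  have wP: "has_jump_density \<nu> \<pi> ?P ?wP"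
    unfolding mh_kernel_def
    by (rule has_jump_density_accept_kernel[OF p_measurable p_nonneg target(2) q_measurable q_nonneg proposal mh_m mh01
        mh_bal])
  have wB: "has_jump_density \<nu> \<pi> ?B ?wB"
    unfolding barker_kernel_def
    by (rule has_jump_density_accept_kernel[OF p_measurable p_nonneg target(2) q_measurable q_nonneg proposal ba_m ba01
        ba_bal])
  have P: "reversible_kernel \<nu> \<pi> ?P" by (rule reversible_if_jump_density[OF pi PK wP])
  have B: "reversible_kernel \<nu> \<pi> ?B" by (rule reversible_if_jump_density[OF pi BK wB])
  interpret P: reversible_kernel \<nu> \<pi> ?P by (rule P)
  interpret B: reversible_kernel \<nu> \<pi> ?B by (rule B)
  have LK: "?L \<epsilon> \<in> \<nu> \<rightarrow>\<^sub>M prob_algebra \<nu>" if "0 < \<epsilon>" "\<epsilon> < 1" for \<epsilon>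
    using that by (intro lazy_kernel_kernel PK) auto
  have wL: "has_jump_density \<nu> \<pi> (?L \<epsilon>) (\<lambda>x y. ennreal (1 - \<epsilon>) * ?wP x y)" if "0 < \<epsilon>" "\<epsilon> < 1" for \<epsilon>
    using that by (intro has_jump_density_lazy PK sets_pi wP) auto
  have L: "reversible_kernel \<nu> \<pi> (?L \<epsilon>)" if "0 < \<epsilon>" "\<epsilon> < 1" for \<epsilon>
    by (rule reversible_if_jump_density[OF pi LK[OF that] wL[OF that]])
  have D_BP: "B.dirichlet h \<le> P.dirichlet h" if "L2 \<pi> h" for h
  proof -
    have "?wB x y \<le> ennreal 1 * ?wP x y" if "x \<in> space \<nu>" "y \<in> space \<nu>" for x y
      using that barker_le_mh[of p x q y] pq[of x y] pq[of y x] by (intro accept_density_mono p_nonneg q_nonneg) auto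
    from dirichlet_le_if_jump_density_le[OF B wB P wP _ this \<open>L2 \<pi> h\<close>] show ?thesis by simp
  qed
  have D_PB: "P.dirichlet h \<le> 2 * B.dirichlet h" if "L2 \<pi> h" for h
  proof -
    have "?wP x y \<le> ennreal 2 * ?wB x y" if "x \<in> space \<nu>" "y \<in> space \<nu>" for x y
      using that mh_le_twice_barker[of p x q y] pq[of x y] pq[of y x] by (intro accept_density_mono p_nonneg q_nonneg) auto
    from dirichlet_le_if_jump_density_le[OF P wP B wB _ this \<open>L2 \<pi> h\<close>] show ?thesis by simp
  qed
  have D_L: "reversible_kernel.dirichlet \<pi> (?L \<epsilon>) h = (1 - \<epsilon>) * P.dirichlet h"
    if e: "0 < \<epsilon>" "\<epsilon> < 1" and h: "L2 \<pi> h" for \<epsilon> h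
  proof (rule antisym)
    show "reversible_kernel.dirichlet \<pi> (?L \<epsilon>) h \<le> (1 - \<epsilon>) * P.dirichlet h"
      using e by (intro dirichlet_le_if_jump_density_le[OF L[OF e] wL[OF e] P wP _ _ h]) auto
    have "P.dirichlet h \<le> (1 / (1 - \<epsilon>)) * reversible_kernel.dirichlet \<pi> (?L \<epsilon>) h"
    proof (rule dirichlet_le_if_jump_density_le[OF P wP L[OF e] wL[OF e] _ _ h])
      fix x y
      have "ennreal (1 / (1 - \<epsilon>)) * ennreal (1 - \<epsilon>) = 1" using e by (simp flip: ennreal_mult')
      then show "?wP x y \<le> ennreal (1 / (1 - \<epsilon>)) * (ennreal (1 - \<epsilon>) * ?wP x y)"
        by (simp flip: mult.assoc)
    qed (use e in simp)
    then show "(1 - \<epsilon>) * P.dirichlet h \<le> reversible_kernel.dirichlet \<pi> (?L \<epsilon>) h"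
      using e by (simp add: field_simps)
  qed
  have ergP: "P.indicator_ergodic" by (rule P.indicator_ergodic_if_ergodic_kernel[OF ergodic])
  have ergB: "B.poisson_ergodic"
    by (rule B.poisson_ergodic_if_indicator_ergodic, rule indicator_ergodic_transfer[OF P B ergP _ D_PB]) simp_all
  have ergL: "reversible_kernel.poisson_ergodic \<pi> (?L \<epsilon>)" if e: "0 < \<epsilon>" "\<epsilon> < 1" for \<epsilon>
  proof -
    interpret L: reversible_kernel \<nu> \<pi> "?L \<epsilon>" by (rule L[OF e])
    show ?thesis
      using e by (intro L.poisson_ergodic_if_indicator_ergodic indicator_ergodic_transfer[OF P L[OF e] ergP, of "1 / (1 - \<epsilon>)"])
        (auto simp: D_L[OF e])
  qed
  have fL: "L2 \<pi> f" using f_L2 by (simp add: L2_def)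
  have fm: "f \<in> borel_measurable \<nu>" by (rule P.L2_measurable_nu[OF fL])
  define g where "g = P.centered f"
  have gL: "L2 \<pi> g" unfolding g_def by (rule P.centered_L2[OF fL])
  have gB: "B.centered f = g" unfolding g_def P.centered_def[abs_def] B.centered_def[abs_def] ..
  have gsq: "(norm2 \<pi> g)\<^sup>2 = stationary_var \<pi> f"
    unfolding norm2_power2 g_def P.centered_def integral_square_diff[OF fL P.L2_const] stationary_var_def
    by (simp add: P.prob_space[simplified] power2_eq_square)
  \<comment> \<open>Finite asymptotic variance bounds this form, and through it those of the other two kernels.\<close>
  obtain C where C: "\<And>lam. 0 < lam \<Longrightarrow> P.resolvent_form g lam \<le> C"
    using P.resolvent_form_bounded_if_has_Var[OF fL Var_MH] unfolding g_def by blast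
  obtain \<Phi> where \<Phi>: "(P.resolvent_form g \<longlongrightarrow> \<Phi>) (at_right 0)" "\<And>lam. 0 < lam \<Longrightarrow> P.resolvent_form g lam \<le> \<Phi>"
    using P.resolvent_form_convergent[OF gL C] by blast
  have CLT_P: "CLT_with \<nu> \<pi> ?P f (2 * \<Phi> - stationary_var \<pi> f)"
    using P.kipnis_varadhan[OF P.poisson_ergodic_if_indicator_ergodic[OF ergP] fL \<Phi>[unfolded g_def]]
    unfolding gsq[symmetric] g_def .
  have av_P: "asymp_var \<nu> \<pi> ?P f = 2 * \<Phi> - stationary_var \<pi> f"
    by (rule asymp_var_eqI[OF pi PK fm CLT_P])
  have form_L: "reversible_kernel.resolvent_form \<pi> (?L \<epsilon>) g lam = P.resolvent_form g (lam / (1 - \<epsilon>)) / (1 - \<epsilon>)"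
    if e: "0 < \<epsilon>" "\<epsilon> < 1" and lam: "0 < lam" for \<epsilon> lam
    by (rule resolvent_form_dirichlet_scaled[OF L[OF e] P gL lam _ D_L[OF e]]) (use e in auto)
  have lim_L: "(reversible_kernel.resolvent_form \<pi> (?L \<epsilon>) g \<longlongrightarrow> \<Phi> / (1 - \<epsilon>)) (at_right 0)"
    if e: "0 < \<epsilon>" "\<epsilon> < 1" for \<epsilon>
  proof -
    have "filterlim (\<lambda>lam. lam / (1 - \<epsilon>)) (at_right 0) (at_right 0)"
      unfolding filterlim_at
    proof
      show "\<forall>\<^sub>F lam in at_right 0. lam / (1 - \<epsilon>) \<in> {0<..} \<and> lam / (1 - \<epsilon>) \<noteq> 0"
        using eventually_at_right_less[of 0] by eventually_elim (use e in auto)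
      have "((\<lambda>lam. lam / (1 - \<epsilon>)) \<longlongrightarrow> 0 / (1 - \<epsilon>)) (at_right 0)"
        using e by (intro tendsto_intros) auto
      then show "((\<lambda>lam. lam / (1 - \<epsilon>)) \<longlongrightarrow> 0) (at_right 0)" by simp
    qed
    then have "((\<lambda>lam. P.resolvent_form g (lam / (1 - \<epsilon>)) / (1 - \<epsilon>)) \<longlongrightarrow> \<Phi> / (1 - \<epsilon>)) (at_right 0)"
      using e by (intro tendsto_divide filterlim_compose[OF \<Phi>(1)] tendsto_const) auto
    moreover have "\<forall>\<^sub>F lam in at_right 0. P.resolvent_form g (lam / (1 - \<epsilon>)) / (1 - \<epsilon>) =
        reversible_kernel.resolvent_form \<pi> (?L \<epsilon>) g lam"
      using eventually_at_right_less[of 0] by eventually_elim (simp add: form_L[OF e])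
    ultimately show ?thesis by (rule Lim_transform_eventually)
  qed
  have bd_L: "reversible_kernel.resolvent_form \<pi> (?L \<epsilon>) g lam \<le> \<Phi> / (1 - \<epsilon>)"
    if e: "0 < \<epsilon>" "\<epsilon> < 1" and lam: "0 < lam" for \<epsilon> lam
    unfolding form_L[OF that] using e lam by (intro divide_right_mono \<Phi>(2)) auto
  have CLT_L: "CLT_with \<nu> \<pi> (?L \<epsilon>) f (2 * (\<Phi> / (1 - \<epsilon>)) - stationary_var \<pi> f)" if e: "0 < \<epsilon>" "\<epsilon> < 1" for \<epsilon>
  proof -
    interpret L: reversible_kernel \<nu> \<pi> "?L \<epsilon>" by (rule L[OF e])
    have gL': "L.centered f = g" unfolding g_def P.centered_def[abs_def] L.centered_def[abs_def] ..
    show ?thesis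
      using L.kipnis_varadhan[OF ergL[OF e] fL, of "\<Phi> / (1 - \<epsilon>)"] lim_L[OF e] bd_L[OF e]
      unfolding gL' gsq by blast
  qed
  have av_L: "asymp_var \<nu> \<pi> (?L \<epsilon>) f = 2 * (\<Phi> / (1 - \<epsilon>)) - stationary_var \<pi> f" if e: "0 < \<epsilon>" "\<epsilon> < 1" for \<epsilon>
    by (rule asymp_var_eqI[OF pi LK[OF e] fm CLT_L[OF e]])
  have PB: "P.resolvent_form g lam \<le> B.resolvent_form g lam" if "0 < lam" for lam
    by (rule resolvent_form_antimono_dirichlet[OF B P gL that D_BP])
  have BL: "B.resolvent_form g lam \<le> reversible_kernel.resolvent_form \<pi> (?L (1/2)) g lam" if "0 < lam" for lam
  proof (rule resolvent_form_antimono_dirichlet[OF L B gL that])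
    show "reversible_kernel.dirichlet \<pi> (?L (1/2)) h \<le> B.dirichlet h" if "L2 \<pi> h" for h
      using D_PB[OF that] D_L[OF _ _ that, of "1/2"] by simp
  qed simp_all
  have "B.resolvent_form g lam \<le> 2 * \<Phi>" if "0 < lam" for lam
    using BL[OF that] bd_L[OF _ _ that, of "1/2"] by simp
  then obtain \<Psi> where \<Psi>: "(B.resolvent_form g \<longlongrightarrow> \<Psi>) (at_right 0)" "\<And>lam. 0 < lam \<Longrightarrow> B.resolvent_form g lam \<le> \<Psi>"
    using B.resolvent_form_convergent[OF gL] by blast
  have CLT_B: "CLT_with \<nu> \<pi> ?B f (2 * \<Psi> - stationary_var \<pi> f)"
    using B.kipnis_varadhan[OF ergB fL, of \<Psi>] \<Psi> unfolding gB gsq by blast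
  have av_B: "asymp_var \<nu> \<pi> ?B f = 2 * \<Psi> - stationary_var \<pi> f"
    by (rule asymp_var_eqI[OF pi BK fm CLT_B])
  have "\<Phi> \<le> \<Psi>"
    by (rule tendsto_le[OF trivial_limit_at_right_real \<Psi>(1) \<Phi>(1)])
       (use eventually_at_right_less[of 0] PB in \<open>auto elim: eventually_mono\<close>)
  moreover have "\<Psi> \<le> \<Phi> / (1 - 1/2)"
    by (rule tendsto_le[OF trivial_limit_at_right_real lim_L \<Psi>(1)])
       (use eventually_at_right_less[of 0] BL in \<open>auto elim: eventually_mono\<close>)
  ultimately have av_le: "asymp_var \<nu> \<pi> ?P f \<le> asymp_var \<nu> \<pi> ?B f" "asymp_var \<nu> \<pi> ?B f \<le> asymp_var \<nu> \<pi> (?L (1/2)) f"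
    unfolding av_P av_B using av_L[of "1/2"] by simp_all
  have av_L_P: "asymp_var \<nu> \<pi> (?L \<epsilon>) f = 1 / (1 - \<epsilon>) * asymp_var \<nu> \<pi> ?P f + \<epsilon> / (1 - \<epsilon>) * stationary_var \<pi> f"
    if e: "0 < \<epsilon>" "\<epsilon> < 1" for \<epsilon>
  proof -
    define c where "c = 1 - \<epsilon>"
    have c: "0 < c" "\<epsilon> = 1 - c" using e by (auto simp: c_def)
    have "2 * (\<Phi> / c) - stationary_var \<pi> f =
        1 / c * (2 * \<Phi> - stationary_var \<pi> f) + (1 - c) / c * stationary_var \<pi> f"
      using c(1) by (simp add: field_simps)
    then show ?thesis unfolding av_L[OF e] av_P using c(2) by simp
  qed
  show ?thesis
  proof (intro conjI ballI)
    fix \<epsilon> :: real assume "\<epsilon> \<in> {0<..<1}"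
    then have e: "0 < \<epsilon>" "\<epsilon> < 1" by auto
    show "CLT_holds \<nu> \<pi> (?L \<epsilon>) f" using CLT_L[OF e] unfolding CLT_holds_def by blast
    show "asymp_var \<nu> \<pi> (?L \<epsilon>) f = 1 / (1 - \<epsilon>) * asymp_var \<nu> \<pi> ?P f + \<epsilon> / (1 - \<epsilon>) * stationary_var \<pi> f"
      by (rule av_L_P[OF e])
  next
    show "CLT_holds \<nu> \<pi> ?B f" using CLT_B unfolding CLT_holds_def by blast
    show "asymp_var \<nu> \<pi> ?P f \<le> asymp_var \<nu> \<pi> ?B f" by (rule av_le)
    show "asymp_var \<nu> \<pi> ?B f \<le> asymp_var \<nu> \<pi> (?L (1/2)) f" by (rule av_le)
    show "asymp_var \<nu> \<pi> (?L (1/2)) f = 2 * asymp_var \<nu> \<pi> ?P f + stationary_var \<pi> f"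
      using av_L_P[of "1/2"] by simp
  qed
qed

end
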